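(* Let $\mathcal{X}$ be a real Banach space and let $g:[a,b]\to\mathcal{X}$ be Henstock–Dunford integrable, with $gχ_E$ Henstock–Dunford integrable for every $E\in\Sigma$. The following are equivalent: (i) the Henstock–Dunford integral of $g$ is countably additive, i.e. the set function $\Sigma\to\mathcal{X}^{**}$, $E\mapsto \mathcal{HD}\int_E g\,d\mu$, is countably additive; (ii) there is an $N$-function $\phi$ satisfying the $\Delta'$ condition such that $\{y^*g: y^*\in B_{\mathcal{X}^*}\}$ is relatively weakly compact in the Orlicz space $H^\phi(\mu)$.
   Context: $\mu$ is Lebesgue measure on $[a,b]$ and $\Sigma$ the $\sigma$-algebra of Lebesgue measurable subsets; $B_{\mathcal{X}^*}$ is the closed unit ball of $\mathcal{X}^*$. A function $h:[a,b]\to\mathbb{R}$ is Henstock integrable on $[a,b]$ if there is $A\in\mathbb{R}$ such that for every $\epsilon>0$ there is a gauge $\delta:[a,b]\to(0,\infty)$ such that for every tagged partition $\{([u_k,z_k],t_k)\}$ of $[a,b]$ with $t_k\in[u_k,z_k]\subset(t_k-\delta(t_k),t_k+\delta(t_k))$ one has $|\sum_k h(t_k)(z_k-u_k)-A|<\epsilon$; $A=\mathcal{H}\int_a^b h$, and $\mathcal{H}\int_E h:=\mathcal{H}\int_a^b h\chi_E$. A function $g:[a,b]\to\mathcal{X}$ is Henstock–Dunford integrable if $y^*g$ is Henstock integrable for every $y^*\in\mathcal{X}^*$ and for every interval $I\subset[a,b]$ there is $y_I^{**}\in\mathcal{X}^{**}$ with $y_I^{**}(y^* )=\mathcal{H}\int_I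 y^*g$ for all $y^*$; $\mathcal{HD}\int_E g$ denotes the element $y_E^{**}$ with $y_E^{**}(y^* )=\mathcal{H}\int_E y^*g$. An $N$-function is $\phi(u)=\int_0^{|u|}m(t)\,dt$ where $m:[0,\infty)\to[0,\infty)$ is nondecreasing, right continuous, $m(0)=0$, $m(t)>0$ for $t>0$, $m(t)\to\infty$. $\phi$ satisfies $\Delta'$ if there are $k>0$ and $u_0>0$ with $\phi(xy)\le k\phi(x)\phi(y)$ for all $x,y\ge u_0$. The Orlicz space $H^\phi(\mu)$ is the space of ($\mu$-a.e. classes of) measurable $f$ on $[a,b]$ such that $\phi(f/\lambda)$ is Henstock integrable for some $\lambda>0$, with norm $\|f\|_\phi=\inf\{\lambda>0:\mathcal{H}\int_a^b\phi(f/\lambda)\le1\}$. *)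

theory Defs
  imports "HOL-Analysis.Analysis"
begin

(* Dual X* = type 'a =>L real (blinfun), bidual X** = ('a =>L real) =>L real, operator norms. *)

definition leb_sets :: "real \<Rightarrow> real \<Rightarrow> real set set" where
  "leb_sets a b = {E. E \<subseteq> {a..b} \<and> E \<in> sets lebesgue}"

definition H_int_on :: "real \<Rightarrow> real \<Rightarrow> real set \<Rightarrow> (real \<Rightarrow> real) \<Rightarrow> real" where
  "H_int_on a b E h = integral {a..b} (\<lambda>t. indicator E t * h t)"

definition HD_integrable :: "real \<Rightarrow> real \<Rightarrow> (real \<Rightarrow> 'a::banach) \<Rightarrow> bool" where
  "HD_integrable a b g \<longleftrightarrow>
     (\<forall>y::'a \<Rightarrow>\<^sub>L real. (\<lambda>t. blinfun_apply y (g t)) integrable_on {a..b}) \<and>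
     (\<forall>c d. {c..d} \<subseteq> {a..b} \<longrightarrow>
        (\<exists>z::('a \<Rightarrow>\<^sub>L real) \<Rightarrow>\<^sub>L real. \<forall>y. blinfun_apply z y = integral {c..d} (\<lambda>t. blinfun_apply y (g t))))"

definition HD_int :: "real \<Rightarrow> real \<Rightarrow> (real \<Rightarrow> 'a::banach) \<Rightarrow> real set
                       \<Rightarrow> ('a \<Rightarrow>\<^sub>L real) \<Rightarrow>\<^sub>L real" where
  "HD_int a b g E = (THE z. \<forall>y. blinfun_apply z y = H_int_on a b E (\<lambda>t. blinfun_apply y (g t)))"

definition HD_countably_additive :: "real \<Rightarrow> real \<Rightarrow> (real \<Rightarrow> 'a::banach) \<Rightarrow> bool" where
  "HD_countably_additive a b g \<longleftrightarrow>
     (\<forall>A :: nat \<Rightarrow> real set. (\<forall>n. A n \<in> leb_sets a b) \<longrightarrow> disjoint_family A \<longrightarrow>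
        (\<lambda>n. HD_int a b g (A n)) sums HD_int a b g (\<Union>n. A n))"

definition N_function :: "(real \<Rightarrow> real) \<Rightarrow> bool" where
  "N_function \<phi> \<longleftrightarrow>
     (\<exists>m :: real \<Rightarrow> real.
        mono_on {0..} m \<and> (\<forall>t\<ge>0. continuous (at_right t) m) \<and> m 0 = 0 \<and>
        (\<forall>t>0. m t > 0) \<and> filterlim m at_top at_top \<and>
        (\<forall>u. \<phi> u = integral {0..\<bar>u\<bar>} m))"

definition Delta'_cond :: "(real \<Rightarrow> real) \<Rightarrow> bool" where
  "Delta'_cond \<phi> \<longleftrightarrow>
     (\<exists>k>0. \<exists>u0>0. \<forall>x y. x \<ge> u0 \<longrightarrow> y \<ge> u0 \<longrightarrow> \<phi> (x * y) \<le> k * \<phi> x * \<phi> y)"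

text \<open>The Orlicz space H^phi(mu) (as a set of representatives) and its Luxemburg norm.\<close>
definition orlicz_space :: "real \<Rightarrow> real \<Rightarrow> (real \<Rightarrow> real) \<Rightarrow> (real \<Rightarrow> real) set" where
  "orlicz_space a b \<phi> =
     {f. f \<in> borel_measurable (lebesgue_on {a..b}) \<and>
         (\<exists>r>0. (\<lambda>t. \<phi> (f t / r)) integrable_on {a..b})}"

definition orlicz_norm :: "real \<Rightarrow> real \<Rightarrow> (real \<Rightarrow> real) \<Rightarrow> (real \<Rightarrow> real) \<Rightarrow> real" where
  "orlicz_norm a b \<phi> f =
     Inf {r. r > 0 \<and> (\<lambda>t. \<phi> (f t / r)) integrable_on {a..b} \<and>
              integral {a..b} (\<lambda>t. \<phi> (f t / r)) \<le> 1}"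

definition orlicz_dual :: "real \<Rightarrow> real \<Rightarrow> (real \<Rightarrow> real) \<Rightarrow> ((real \<Rightarrow> real) \<Rightarrow> real) set" where
  "orlicz_dual a b \<phi> =
     {L. (\<forall>f\<in>orlicz_space a b \<phi>. \<forall>h\<in>orlicz_space a b \<phi>. L (\<lambda>t. f t + h t) = L f + L h) \<and>
         (\<forall>c. \<forall>f\<in>orlicz_space a b \<phi>. L (\<lambda>t. c * f t) = c * L f) \<and>
         (\<exists>C. \<forall>f\<in>orlicz_space a b \<phi>. \<bar>L f\<bar> \<le> C * orlicz_norm a b \<phi> f)}"

definition orlicz_weak_topology :: "real \<Rightarrow> real \<Rightarrow> (real \<Rightarrow> real) \<Rightarrow> (real \<Rightarrow> real) topology" where
  "orlicz_weak_topology a b \<phi> =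
     subtopology
       (topology_generated_by {{f. L f \<in> U} | L U. L \<in> orlicz_dual a b \<phi> \<and> open U})
       (orlicz_space a b \<phi>)"

definition rel_weakly_compact_orlicz ::
  "real \<Rightarrow> real \<Rightarrow> (real \<Rightarrow> real) \<Rightarrow> (real \<Rightarrow> real) set \<Rightarrow> bool" where
  "rel_weakly_compact_orlicz a b \<phi> S \<longleftrightarrow>
     S \<subseteq> orlicz_space a b \<phi> \<and>
     compactin (orlicz_weak_topology a b \<phi>) (orlicz_weak_topology a b \<phi> closure_of S)"

end

theory Submission
  imports Defs
begin

text \<open>
  Integrability of all \<open>\<chi>\<^sub>E g\<close> makes every \<open>y\<^sup>* g\<close> Lebesgue integrable, so \<open>K = {y\<^sup>* g : \<parallel>y\<^sup>*\<parallel> \<le> 1}\<close>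
  lies in \<open>L\<^sup>1\<close>.

  If \<open>K\<close> is relatively weakly compact in some Orlicz space, the functionals \<open>f \<mapsto> \<integral>\<^sub>E f\<close> are weakly
  continuous. Were the integral not countably additive, a gliding hump around a weak cluster point \<open>f\<close>
  would give functions \<open>h\<^sub>i \<in> K\<close> with \<open>\<integral> h\<^sub>i \<rightarrow> \<integral> f\<close> on each member of a disjoint sequence, but not on a
  union of members; a second cluster point, now of the \<open>h\<^sub>i\<close>, contradicts this.

  Conversely, countable additivity makes \<open>K\<close> equi-integrable, so there are thresholds \<open>T\<^sub>n\<close> with
  \<open>T\<^sub>n\<^sup>2 \<le> T\<^sub>n\<^sub>+\<^sub>1\<close> and \<open>\<integral> (\<bar>f\<bar> - T\<^sub>n)\<^sup>+ \<le> 2\<^sup>-\<^sup>n\<close> on \<open>K\<close>. The density of \<open>\<phi>\<close> jumps by one at each \<open>T\<^sub>n\<close>; the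
  square growth yields \<open>\<Delta>'\<close>. The class \<open>C \<supseteq> K\<close> of all functions obeying these bounds is weakly closed,
  because the bounds are suprema of linear ones, and has equi-absolutely continuous \<open>\<phi>\<close>-norms. Hence
  each functional of the dual is, uniformly on \<open>C\<close>, a limit of combinations of the \<open>f \<mapsto> \<integral>\<^sub>E f\<close>. By
  Radon--Nikodym the image of \<open>C\<close> in the product over the dual is closed, and Tychonoff's theorem makes
  \<open>C\<close> weakly compact.
\<close>

section \<open>Radon--Nikodym for additive set functions\<close>

text \<open>Equi-integrability yields a superlinear \<open>\<phi>\<close> with bounded modular on
  \<open>K\<close> (de la Vallee-Poussin), but such a \<open>\<phi>\<close> need not satisfy Delta',
  nor make norms small on small sets. Thresholds can always be raised, so the density may grow as
  slowly as a count along a tower of squares. Squaring then serves twice: the count at a product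
  exceeds the count at half its larger factor by at most two, and a dilation of \<open>f\<close> is
  absorbed by shifting the thresholds by one index, so that modulars stay finite at every scale. The
  dual of the Orlicz space is never described. The density of a functional is known only to be
  integrable and represents it only on bounded functions, hence the truncations and the
  approximation on \<open>C\<close>. Radon--Nikodym is wanted from finite additivity and an
  epsilon-delta bound, because these pass to pointwise limits of set functions, while countable
  additivity does not. In the converse direction cluster points can stand in for convergent
  subsequences, since the gliding hump asks for good indices only infinitely often.\<close>

lemma (in finite_measure) Radon_Nikodym_additive_nonneg:
  fixes p :: "'a set \<Rightarrow> real"
  assumes add: "\<And>E F. E \<in> sets M \<Longrightarrow> F \<in> sets M \<Longrightarrow> E \<inter> F = {} \<Longrightarrow> p (E \<union> F) = p E + p F"
    and pos: "\<And>E. E \<in> sets M \<Longrightarrow> 0 \<le> p E"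
    and cont: "\<And>e. e > 0 \<Longrightarrow> \<exists>d>0. \<forall>E\<in>sets M. measure M E < d \<longrightarrow> \<bar>p E\<bar> \<le> e"
  shows "\<exists>h. integrable M h \<and> (\<forall>E\<in>sets M. p E = (LINT x|M. indicator E x * h x))"
proof -
  define N where "N = measure_of (space M) (sets M) (\<lambda>E. ennreal (p E))"
  have sN: "sets N = sets M" "space N = space M"
    by (auto simp: N_def)
  have p0: "p {} = 0"
    using add[of "{}" "{}"] by simp
  \<comment> \<open>A finite additive set function is countably additive once it is continuous at
    the empty set. There \<open>cont\<close> applies, because the measures of sets decreasing to the
    empty set tend to 0.\<close>
  have ca: "countably_additive (sets M) (\<lambda>E. ennreal (p E))"
  proof (rule sets.empty_continuous_imp_countably_additive)
    show "positive (sets M) (\<lambda>E. ennreal (p E))"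
      by (simp add: positive_def p0)
    show "additive (sets M) (\<lambda>E. ennreal (p E))"
      by (auto simp: additive_def add pos ennreal_plus[symmetric] simp del: ennreal_plus)
    show "\<forall>A\<in>sets M. ennreal (p A) \<noteq> \<infinity>"
      by simp
    fix A :: "nat \<Rightarrow> 'a set"
    assume A: "range A \<subseteq> sets M" "decseq A" "(\<Inter>i. A i) = {}"
    have "(\<lambda>i. measure M (A i)) \<longlonglongrightarrow> measure M (\<Inter>i. A i)"
      by (rule finite_Lim_measure_decseq) (use A in auto)
    then have lim: "(\<lambda>i. measure M (A i)) \<longlonglongrightarrow> 0"
      using A by simp
    have "(\<lambda>i. p (A i)) \<longlonglongrightarrow> 0"
    proof (rule LIMSEQ_I)
      fix r :: real assume "0 < r"
      then obtain d where d: "d > 0" "\<forall>E\<in>sets M. measure M E < d \<longrightarrow> \<bar>p E\<bar> \<le> r/2"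
        using cont[of "r/2"] by auto
      obtain n0 where "\<forall>n\<ge>n0. norm (measure M (A n) - 0) < d"
        using LIMSEQ_D[OF lim d(1)] by blast
      then have "\<forall>n\<ge>n0. norm (p (A n) - 0) < r"
        using d(2) A(1) \<open>0 < r\<close> by fastforce
      then show "\<exists>no. \<forall>n\<ge>no. norm (p (A n) - 0) < r" by blast
    qed
    then show "(\<lambda>i. ennreal (p (A i))) \<longlonglongrightarrow> 0"
      using tendsto_ennrealI by fastforce
  qed
  have emN: "emeasure N E = ennreal (p E)" if "E \<in> sets M" for E
    unfolding N_def
    by (rule emeasure_measure_of_sigma[OF sets.sigma_algebra_axioms _ ca that])
       (simp add: positive_def p0)
  have "absolutely_continuous M N"
  proof (unfold absolutely_continuous_def, rule subsetI)
    fix E assume E: "E \<in> null_sets M"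
    then have mE: "E \<in> sets M" "measure M E = 0"
      by (auto simp: null_sets_def measure_def)
    have "p E \<le> e" if "e > 0" for e
      using cont[OF that] mE by force
    then have "p E \<le> 0"
      using field_le_epsilon[of "p E" 0] by simp
    with pos[OF mE(1)] have "p E = 0" by simp
    then show "E \<in> null_sets N"
      using emN mE sN by (auto simp: null_sets_def)
  qed
  from Radon_Nikodym[OF this sN(1)] obtain f
    where f: "f \<in> borel_measurable M" "density M f = N" by blast
  have int_f: "(\<integral>\<^sup>+x. f x * indicator E x \<partial>M) = ennreal (p E)" if "E \<in> sets M" for E
    using emN[OF that] f emeasure_density[OF f(1) that] by simp
  have "(\<integral>\<^sup>+x. f x \<partial>M) = (\<integral>\<^sup>+x. f x * indicator (space M) x \<partial>M)"
    by (rule nn_integral_cong) (auto simp: indicator_def)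
  then have fin: "(\<integral>\<^sup>+x. f x \<partial>M) \<noteq> \<infinity>"
    using int_f[of "space M"] by simp
  \<comment> \<open>The total mass \<open>p (space M)\<close> is finite, so \<open>f\<close> is
    finite almost everywhere and \<open>enn2real\<close> loses nothing.\<close>
  have AE: "AE x in M. ennreal (enn2real (f x)) = f x"
    using nn_integral_PInf_AE[OF f(1) fin] by (auto simp: less_top)
  have int_h: "integrable M (\<lambda>x. enn2real (f x))"
  proof (rule integrableI_bounded)
    have "(\<integral>\<^sup>+ x. ennreal (norm (enn2real (f x))) \<partial>M) = (\<integral>\<^sup>+x. f x \<partial>M)"
      by (rule nn_integral_cong_AE) (use AE in auto)
    then show "(\<integral>\<^sup>+ x. ennreal (norm (enn2real (f x))) \<partial>M) < \<infinity>"
      using fin by (simp add: less_top)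
  qed (use f in measurable)
  have "p E = (LINT x|M. indicator E x * enn2real (f x))" if E: "E \<in> sets M" for E
  proof -
    have "(LINT x|M. indicator E x * enn2real (f x))
        = enn2real (\<integral>\<^sup>+x. ennreal (indicator E x * enn2real (f x)) \<partial>M)"
      by (rule integral_eq_nn_integral) (use f E in auto)
    also have "(\<integral>\<^sup>+x. ennreal (indicator E x * enn2real (f x)) \<partial>M)
        = (\<integral>\<^sup>+x. f x * indicator E x \<partial>M)"
      by (rule nn_integral_cong_AE) (use AE in \<open>auto simp: indicator_def\<close>)
    finally show ?thesis
      using int_f[OF E] pos[OF E] by simp
  qed
  with int_h show ?thesis by blast
qed

text \<open>Jordan decomposition by hand: the positive variation \<open>p\<close>, a supremum over
  measurable subsets, and \<open>q = p - \<nu>\<close> are nonnegative, additive and inherit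
  \<open>cont\<close>. The nonnegative case gives each a density, and the difference of the
  densities belongs to \<open>\<nu>\<close>.\<close>

lemma (in finite_measure) Radon_Nikodym_additive:
  fixes \<nu> :: "'a set \<Rightarrow> real"
  assumes add: "\<And>E F. E \<in> sets M \<Longrightarrow> F \<in> sets M \<Longrightarrow> E \<inter> F = {} \<Longrightarrow> \<nu> (E \<union> F) = \<nu> E + \<nu> F"
    and bdd: "\<And>E. E \<in> sets M \<Longrightarrow> \<nu> E \<le> B"
    and cont: "\<And>e. e > 0 \<Longrightarrow> \<exists>d>0. \<forall>E\<in>sets M. measure M E < d \<longrightarrow> \<bar>\<nu> E\<bar> \<le> e"
  shows "\<exists>h. integrable M h \<and> (\<forall>E\<in>sets M. \<nu> E = (LINT x|M. indicator E x * h x))"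
proof -
  define S where "S E = {\<nu> F |F. F \<in> sets M \<and> F \<subseteq> E}" for E
  define p where "p E = Sup (S E)" for E
  have \<nu>0: "\<nu> {} = 0"
    using add[of "{}" "{}"] by simp
  have S0: "0 \<in> S E" for E
    unfolding S_def using \<nu>0 by (force intro: exI[of _ "{}"])
  have bS: "bdd_above (S E)" for E
    unfolding S_def bdd_above_def using bdd by blast
  have upper: "\<nu> F \<le> p E" if "F \<in> sets M" "F \<subseteq> E" for E F
    unfolding p_def by (rule cSup_upper[OF _ bS]) (use that in \<open>auto simp: S_def\<close>)
  have least: "p E \<le> c" if "\<And>F. F \<in> sets M \<Longrightarrow> F \<subseteq> E \<Longrightarrow> \<nu> F \<le> c" for E c
    unfolding p_def by (rule cSup_least) (use that S0[of E] in \<open>auto simp: S_def\<close>)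
  have ppos: "0 \<le> p E" for E
    unfolding p_def by (rule cSup_upper[OF S0 bS])
  have padd: "p (E \<union> F) = p E + p F"
    if EF: "E \<in> sets M" "F \<in> sets M" "E \<inter> F = {}" for E F
  proof (rule antisym)
    show "p (E \<union> F) \<le> p E + p F"
    proof (rule least)
      fix G assume G: "G \<in> sets M" "G \<subseteq> E \<union> F"
      have "\<nu> G = \<nu> ((G \<inter> E) \<union> (G \<inter> F))"
        using G by (intro arg_cong[of _ _ \<nu>]) auto
      also have "\<dots> = \<nu> (G \<inter> E) + \<nu> (G \<inter> F)"
        by (rule add) (use G EF in auto)
      also have "\<dots> \<le> p E + p F"
        by (intro add_mono upper) (use G EF in auto)
      finally show "\<nu> G \<le> p E + p F" .
    qed
    \<comment> \<open>Two suprema are taken one after the other: with \<open>G\<close> fixed the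
      bound holds for every \<open>H\<close>, hence for \<open>p E\<close>; solving for
      \<open>\<nu> G\<close> then allows the supremum over \<open>G\<close>.\<close>
    have "p E \<le> p (E \<union> F) - \<nu> G" if G: "G \<in> sets M" "G \<subseteq> F" for G
    proof (rule least)
      fix H assume H: "H \<in> sets M" "H \<subseteq> E"
      have "\<nu> (H \<union> G) = \<nu> H + \<nu> G"
        by (rule add) (use G H EF in auto)
      moreover have "\<nu> (H \<union> G) \<le> p (E \<union> F)"
        by (rule upper) (use G H EF in auto)
      ultimately show "\<nu> H \<le> p (E \<union> F) - \<nu> G" by simp
    qed
    then have "p F \<le> p (E \<union> F) - p E"
      by (intro least) fastforce
    then show "p E + p F \<le> p (E \<union> F)" by simp
  qed
  have pcont: "\<exists>d>0. \<forall>E\<in>sets M. measure M E < d \<longrightarrow> \<bar>p E\<bar> \<le> e" if e: "e > 0" for e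
  proof -
    obtain d where d: "d > 0" "\<forall>E\<in>sets M. measure M E < d \<longrightarrow> \<bar>\<nu> E\<bar> \<le> e"
      using cont[OF e] by blast
    have "\<bar>p E\<bar> \<le> e" if E: "E \<in> sets M" "measure M E < d" for E
    proof -
      have "p E \<le> e"
      proof (rule least)
        fix F assume F: "F \<in> sets M" "F \<subseteq> E"
        have "measure M F \<le> measure M E"
          by (rule finite_measure_mono) (use E F in auto)
        then show "\<nu> F \<le> e"
          using d(2) F E by force
      qed
      with ppos[of E] show ?thesis by simp
    qed
    with d show ?thesis by blast
  qed
  define q where "q E = p E - \<nu> E" for E
  have qcont: "\<exists>d>0. \<forall>E\<in>sets M. measure M E < d \<longrightarrow> \<bar>q E\<bar> \<le> e" if e: "e > 0" for e
  proof -
    obtain d where d: "d > 0" "\<forall>E\<in>sets M. measure M E < d \<longrightarrow> \<bar>\<nu> E\<bar> \<le> e/2"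
      using cont[of "e/2"] e by auto
    obtain d' where d': "d' > 0" "\<forall>E\<in>sets M. measure M E < d' \<longrightarrow> \<bar>p E\<bar> \<le> e/2"
      using pcont[of "e/2"] e by auto
    have "\<forall>E\<in>sets M. measure M E < min d d' \<longrightarrow> \<bar>q E\<bar> \<le> e"
      using d d' by (fastforce simp: q_def)
    then show ?thesis
      using d d' by (intro exI[of _ "min d d'"]) auto
  qed
  obtain h1 where h1: "integrable M h1" "\<forall>E\<in>sets M. p E = (LINT x|M. indicator E x * h1 x)"
    using Radon_Nikodym_additive_nonneg[of p, OF padd ppos pcont] by blast
  obtain h2 where h2: "integrable M h2" "\<forall>E\<in>sets M. q E = (LINT x|M. indicator E x * h2 x)"
    using Radon_Nikodym_additive_nonneg[of q, OF _ _ qcont] padd add upper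
    unfolding q_def by force
  have "\<nu> E = (LINT x|M. indicator E x * (h1 x - h2 x))" if E: "E \<in> sets M" for E
  proof -
    have "\<nu> E = p E - q E" by (simp add: q_def)
    also have "\<dots> = (LINT x|M. indicator E x * h1 x - indicator E x * h2 x)"
      using h1 h2 E
      by (subst Bochner_Integration.integral_diff) (auto intro!: integrable_mult_indicator[where 'b=real, simplified])
    finally show ?thesis by (simp add: algebra_simps)
  qed
  with h1(1) h2(1) show ?thesis
    by (intro exI[of _ "\<lambda>x. h1 x - h2 x"]) auto
qed

text \<open>Dominated convergence. The intersection is allowed to be a null set because
  Borel--Cantelli will supply no more than that.\<close>

lemma integral_indicator_decseq_tendsto_0:
  fixes f :: "'a \<Rightarrow> real"
  assumes f: "integrable M f" and A: "range A \<subseteq> sets M" "decseq A" "emeasure M (\<Inter>i. A i) = 0"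
  shows "(\<lambda>i. LINT x|M. indicator (A i) x * f x) \<longlonglongrightarrow> 0"
proof -
  have "(\<lambda>i. LINT x|M. indicator (A i) x * f x) \<longlonglongrightarrow> (LINT x|M. (0::real))"
  proof (rule integral_dominated_convergence[where w="\<lambda>x. \<bar>f x\<bar>"])
    have "AE x in M. x \<notin> (\<Inter>i. A i)"
      by (rule AE_not_in) (use A in auto)
    then show "AE x in M. (\<lambda>i. indicator (A i) x * f x) \<longlonglongrightarrow> 0"
    proof eventually_elim
      case (elim x)
      then obtain i where "x \<notin> A i" by blast
      then have "\<forall>j\<ge>i. x \<notin> A j" using A(2) by (auto simp: decseq_def)
      then show ?case
        by (intro tendsto_eventually) (auto simp: eventually_sequentially intro!: exI[of _ i])
    qed
  qed (use f A in \<open>auto intro!: AE_I2 simp: indicator_def\<close>)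
  then show ?thesis by simp
qed

section \<open>Cluster points and initial topologies\<close>

text \<open>If every point of \<open>C\<close> had a neighbourhood visited only finitely often, a
  finite subcover would account for only finitely many indices. This replaces the extraction of a
  convergent subsequence.\<close>

lemma compactin_sequence_cluster_point:
  fixes x :: "nat \<Rightarrow> 'a"
  assumes C: "compactin X C" and x: "\<And>i. x i \<in> C"
  obtains p where "p \<in> C" "\<And>U. openin X U \<Longrightarrow> p \<in> U \<Longrightarrow> \<exists>\<^sub>\<infinity>i. x i \<in> U"
proof -
  have "\<exists>p\<in>C. \<forall>U. openin X U \<longrightarrow> p \<in> U \<longrightarrow> (\<exists>\<^sub>\<infinity>i. x i \<in> U)"
  proof (rule ccontr)
    assume "\<not> ?thesis"
    then have ex: "\<forall>p\<in>C. \<exists>U. openin X U \<and> p \<in> U \<and> finite {i. x i \<in> U}"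
      by (auto simp: frequently_cofinite)
    define \<U> where "\<U> = {U. openin X U \<and> finite {i. x i \<in> U}}"
    have "C \<subseteq> \<Union>\<U>"
      using ex by (auto simp: \<U>_def)
    then obtain \<F> where \<F>: "finite \<F>" "\<F> \<subseteq> \<U>" "C \<subseteq> \<Union>\<F>"
      using compactinD[OF C, of \<U>] unfolding \<U>_def by blast
    have "UNIV \<subseteq> (\<Union>U\<in>\<F>. {i. x i \<in> U})"
      using \<F>(3) x by blast
    moreover have "finite (\<Union>U\<in>\<F>. {i. x i \<in> U})"
      using \<F> by (auto simp: \<U>_def)
    ultimately show False
      using finite_subset infinite_UNIV_nat by blast
  qed
  then show ?thesis using that by blast
qed

lemma compactin_initial_topology:
  fixes \<L> :: "('a \<Rightarrow> real) set"
  defines "e \<equiv> \<lambda>f. restrict (\<lambda>L. L f) \<L>"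
  assumes ne: "\<L> \<noteq> {}"
    and comp: "compactin (product_topology (\<lambda>_. euclideanreal) \<L>) (e ` C)"
  shows "compactin (topology_generated_by {{f. L f \<in> U} | L U. L \<in> \<L> \<and> open U}) C"
proof -
  let ?P = "product_topology (\<lambda>_. euclideanreal) \<L>"
  let ?G = "{{f. L f \<in> U} | L U. L \<in> \<L> \<and> open U}"
  have pull: "\<exists>V. openin ?P V \<and> (\<forall>f. e f \<in> V \<longleftrightarrow> f \<in> W)" if "generate_topology_on ?G W" for W
    using that
  proof induction
    case Empty
    then show ?case by (intro exI[of _ "{}"]) auto
  next
    case (Int a b)
    then obtain V V' where "openin ?P V" "\<forall>f. e f \<in> V \<longleftrightarrow> f \<in> a" "openin ?P V'" "\<forall>f. e f \<in> V' \<longleftrightarrow> f \<in> b"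
      by blast
    then show ?case by (intro exI[of _ "V \<inter> V'"]) auto
  next
    case (UN K)
    then obtain V where V: "\<And>k. k \<in> K \<Longrightarrow> openin ?P (V k) \<and> (\<forall>f. e f \<in> V k \<longleftrightarrow> f \<in> k)"
      by metis
    then have "openin ?P (\<Union>k\<in>K. V k)" by blast
    with V show ?case by (intro exI[of _ "\<Union>k\<in>K. V k"]) auto
  next
    case (Basis s)
    then obtain L U where s: "s = {f. L f \<in> U}" "L \<in> \<L>" "open U" by blast
    have "openin ?P {x \<in> topspace ?P. x L \<in> U}"
      by (rule openin_continuous_map_preimage[OF continuous_map_product_projection[OF s(2)]])
         (use s in auto)
    then show ?case
      using s by (intro exI[of _ "{x \<in> topspace ?P. x L \<in> U}"]) (auto simp: e_def)
  qed
  show ?thesis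
    unfolding compactin_def
  proof (intro conjI allI impI)
    \<comment> \<open>\<open>compactin\<close> also demands that \<open>C\<close> lie in the
      carrier; one functional with the open set \<open>UNIV\<close> makes the whole type a
      generator.\<close>
    obtain L where "L \<in> \<L>" using ne by blast
    then have "UNIV \<in> ?G" by (auto intro!: exI[of _ L] exI[of _ UNIV])
    then show "C \<subseteq> topspace (topology_generated_by ?G)"
      unfolding topology_generated_by_topspace by blast
    fix \<U> assume \<U>: "(\<forall>U\<in>\<U>. openin (topology_generated_by ?G) U) \<and> C \<subseteq> \<Union>\<U>"
    then have "\<forall>U\<in>\<U>. \<exists>V. openin ?P V \<and> (\<forall>f. e f \<in> V \<longleftrightarrow> f \<in> U)"
      using pull openin_topology_generated_by by blast
    then obtain V where V: "\<And>U. U \<in> \<U> \<Longrightarrow> openin ?P (V U)" "\<And>U f. U \<in> \<U> \<Longrightarrow> e f \<in> V U \<longleftrightarrow> f \<in> U"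
      by metis
    have "e ` C \<subseteq> \<Union>(V ` \<U>)"
      using \<U> V(2) by blast
    moreover have "openin ?P W" if "W \<in> V ` \<U>" for W
      using V(1) that by auto
    ultimately have "\<exists>\<F>. finite \<F> \<and> \<F> \<subseteq> V ` \<U> \<and> e ` C \<subseteq> \<Union>\<F>"
      by (intro compactinD[OF comp])
    then obtain \<F> where \<F>: "finite \<F>" "\<F> \<subseteq> V ` \<U>" "e ` C \<subseteq> \<Union>\<F>"
      by (elim exE conjE)
    obtain \<G> where \<G>: "finite \<G>" "\<G> \<subseteq> \<U>" "\<F> = V ` \<G>"
      using finite_subset_image[OF \<F>(1,2)] by auto
    have "C \<subseteq> \<Union>\<G>"
    proof
      fix f assume "f \<in> C"
      then obtain U where "U \<in> \<G>" "e f \<in> V U" using \<F>(3) \<G>(3) by blast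
      then show "f \<in> \<Union>\<G>" using V(2) \<G>(2) by blast
    qed
    then show "\<exists>\<F>. finite \<F> \<and> \<F> \<subseteq> \<U> \<and> C \<subseteq> \<Union>\<F>"
      using \<G> by blast
  qed
qed

section \<open>N-functions and Orlicz spaces\<close>

lemma leb_sets_eq_sets: "leb_sets a b = sets (lebesgue_on {a..b})"
  unfolding leb_sets_def by (rule set_eqI) (simp add: sets_restrict_space_iff)

lemma finite_measure_lebesgue_on_ivl: "finite_measure (lebesgue_on {a..b::real})"
  by (rule finite_measure_lebesgue_on) simp

lemma integrable_indicator_mult:
  fixes f :: "'a \<Rightarrow> real"
  assumes "integrable M f" "E \<in> sets M"
  shows "integrable M (\<lambda>x. indicator E x * f x)"
  using integrable_mult_indicator[OF assms(2,1)] by simp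

lemma H_int_on_eq_LINT:
  assumes "integrable (lebesgue_on {a..b}) f" "E \<in> sets (lebesgue_on {a..b})"
  shows "H_int_on a b E f = (LINT x|lebesgue_on {a..b}. indicator E x * f x)"
  unfolding H_int_on_def
  by (rule lebesgue_integral_eq_integral[symmetric])
     (use integrable_indicator_mult[OF assms] in auto)

text \<open>Modulars \<open>\<phi> (f t / r)\<close> are nonnegative, so through this equivalence
  the gauge-integral definition of the Orlicz space is handled entirely by Lebesgue theory.\<close>

lemma integrable_on_iff_integrable_nonneg:
  fixes f :: "real \<Rightarrow> real"
  assumes "\<And>x. 0 \<le> f x"
  shows "f integrable_on {a..b} \<longleftrightarrow> integrable (lebesgue_on {a..b}) f"
  using assms absolutely_integrable_imp_integrable[OF nonnegative_absolutely_integrable_1, of f "{a..b}"]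
    integrable_on_lebesgue_on[of "{a..b}" f]
  by auto

section \<open>Slope bounds and convexity of N-functions\<close>

lemma integral_mono_on_increment:
  fixes m :: "real \<Rightarrow> real"
  assumes m: "mono_on {0..} m" and st: "0 \<le> s" "s \<le> t"
  shows "(t - s) * m s \<le> integral {0..t} m - integral {0..s} m"
    and "integral {0..t} m - integral {0..s} m \<le> (t - s) * m t"
proof -
  have int: "m integrable_on {s'..t}" if "0 \<le> s'" for s'
    by (rule integrable_on_mono_on) (use m that in \<open>auto simp: monotone_on_def\<close>)
  have "integral {0..s} m + integral {s..t} m = integral {0..t} m"
    by (rule Henstock_Kurzweil_Integration.integral_combine) (use st int in auto)
  then have eq: "integral {0..t} m - integral {0..s} m = integral {s..t} m"
    by simp
  have "integral {s..t} (\<lambda>_. m s) \<le> integral {s..t} m"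
    by (rule integral_le) (use st int m in \<open>auto simp: monotone_on_def\<close>)
  then show "(t - s) * m s \<le> integral {0..t} m - integral {0..s} m"
    using eq st by simp
  have "integral {s..t} m \<le> integral {s..t} (\<lambda>_. m t)"
    by (rule integral_le) (use st int m in \<open>auto simp: monotone_on_def\<close>)
  then show "integral {0..t} m - integral {0..s} m \<le> (t - s) * m t"
    using eq st by simp
qed

text \<open>Between \<open>s\<close> and \<open>t\<close> the mean slope of \<open>\<phi>\<close>
  lies between \<open>m s\<close> and \<open>m t\<close>. This is convexity in the form from which
  monotonicity, scaling and linear growth are drawn, without returning to the integral.\<close>

lemma N_function_increment:
  assumes "N_function \<phi>"
  obtains m where "m 0 = 0" "\<And>t. 0 < t \<Longrightarrow> 0 < m t"
    "\<And>s t. 0 \<le> s \<Longrightarrow> s \<le> t \<Longrightarrow> (t - s) * m s \<le> \<phi> t - \<phi> s"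
    "\<And>s t. 0 \<le> s \<Longrightarrow> s \<le> t \<Longrightarrow> \<phi> t - \<phi> s \<le> (t - s) * m t"
    "\<And>u. \<phi> \<bar>u\<bar> = \<phi> u" "\<phi> 0 = 0"
proof -
  obtain m where m: "mono_on {0..} m" "m 0 = 0" "\<And>t. t > 0 \<Longrightarrow> m t > 0"
    "\<And>u. \<phi> u = integral {0..\<bar>u\<bar>} m"
    using assms unfolding N_function_def by blast
  show ?thesis
    by (rule that[of m]) (use m integral_mono_on_increment[OF m(1)] in auto)
qed

lemma N_function_0: "N_function \<phi> \<Longrightarrow> \<phi> 0 = 0"
  by (metis N_function_increment)

lemma N_function_abs: "N_function \<phi> \<Longrightarrow> \<phi> \<bar>u\<bar> = \<phi> u"
  by (metis N_function_increment)

lemma N_function_mono: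
  assumes N: "N_function \<phi>" and "\<bar>u\<bar> \<le> \<bar>v\<bar>"
  shows "\<phi> u \<le> \<phi> v"
proof -
  obtain m where m: "m 0 = 0" "\<And>t. 0 < t \<Longrightarrow> 0 < m t"
    "\<And>s t. 0 \<le> s \<Longrightarrow> s \<le> t \<Longrightarrow> (t - s) * m s \<le> \<phi> t - \<phi> s" "\<And>u. \<phi> \<bar>u\<bar> = \<phi> u"
    using N_function_increment[OF N] by metis
  have "0 \<le> m \<bar>u\<bar>"
    using m(1) m(2)[of "\<bar>u\<bar>"] by (cases "u = 0") auto
  then have "0 \<le> (\<bar>v\<bar> - \<bar>u\<bar>) * m \<bar>u\<bar>"
    using assms by simp
  also have "\<dots> \<le> \<phi> v - \<phi> u"
    using m(3)[of "\<bar>u\<bar>" "\<bar>v\<bar>"] assms m(4) by simp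
  finally show ?thesis by simp
qed

lemma N_function_nonneg: "N_function \<phi> \<Longrightarrow> 0 \<le> \<phi> u"
  using N_function_mono[of \<phi> 0 u] N_function_0[of \<phi>] by simp

text \<open>Convexity along a ray from 0: the mean slope is at most \<open>m (\<theta> * y)\<close>
  on [0, \<theta>y] and at least \<open>m (\<theta> * y)\<close> on [\<theta>y, y]. Weighting the
  two bounds with 1 - \<theta> and \<theta> eliminates \<open>m\<close>.\<close>

lemma N_function_scale:
  assumes N: "N_function \<phi>" and th: "0 \<le> \<theta>" "\<theta> \<le> 1"
  shows "\<phi> (\<theta> * u) \<le> \<theta> * \<phi> u"
proof -
  obtain m where m:
    "\<And>s t. 0 \<le> s \<Longrightarrow> s \<le> t \<Longrightarrow> (t - s) * m s \<le> \<phi> t - \<phi> s"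
    "\<And>s t. 0 \<le> s \<Longrightarrow> s \<le> t \<Longrightarrow> \<phi> t - \<phi> s \<le> (t - s) * m t"
    "\<And>u. \<phi> \<bar>u\<bar> = \<phi> u" "\<phi> 0 = 0"
    using N_function_increment[OF N] by metis
  define y where "y = \<bar>u\<bar>"
  have y: "0 \<le> y" by (simp add: y_def)
  have le: "\<theta> * y \<le> y" using th y by (simp add: mult_left_le_one_le)
  have 1: "(y - \<theta> * y) * m (\<theta> * y) \<le> \<phi> y - \<phi> (\<theta> * y)"
    by (rule m(1)) (use th y le in auto)
  have 2: "\<phi> (\<theta> * y) \<le> \<theta> * y * m (\<theta> * y)"
    using m(2)[of 0 "\<theta> * y"] m(4) th y by simp
  have "(1 - \<theta>) * \<phi> (\<theta> * y) \<le> (1 - \<theta>) * (\<theta> * y * m (\<theta> * y))"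
    using 2 th by (intro mult_left_mono) auto
  also have "\<dots> = \<theta> * ((y - \<theta> * y) * m (\<theta> * y))"
    by (simp add: algebra_simps)
  also have "\<dots> \<le> \<theta> * (\<phi> y - \<phi> (\<theta> * y))"
    using 1 th by (intro mult_left_mono) auto
  finally have "\<phi> (\<theta> * y) \<le> \<theta> * \<phi> y" by (simp add: algebra_simps)
  then show ?thesis
    using m(3)[of "\<theta> * u"] m(3)[of u] th by (simp add: y_def abs_mult)
qed

lemma N_function_linear_lower_bound:
  assumes N: "N_function \<phi>"
  obtains c where "0 < c" "\<And>u. c * (\<bar>u\<bar> - 1) \<le> \<phi> u"
proof -
  obtain m where m: "\<And>t. 0 < t \<Longrightarrow> 0 < m t"
    "\<And>s t. 0 \<le> s \<Longrightarrow> s \<le> t \<Longrightarrow> (t - s) * m s \<le> \<phi> t - \<phi> s"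
    "\<And>u. \<phi> \<bar>u\<bar> = \<phi> u"
    using N_function_increment[OF N] by metis
  have "m 1 * (\<bar>u\<bar> - 1) \<le> \<phi> u" for u
  proof (cases "\<bar>u\<bar> \<ge> 1")
    case True
    then show ?thesis
      using m(2)[of 1 "\<bar>u\<bar>"] m(3)[of u] N_function_nonneg[OF N, of 1] by (simp add: mult.commute)
  next
    case False
    then have "m 1 * (\<bar>u\<bar> - 1) \<le> 0"
      using m(1)[of 1] by (intro mult_nonneg_nonpos) auto
    then show ?thesis
      using N_function_nonneg[OF N, of u] by simp
  qed
  then show ?thesis
    using that m(1)[of 1] by simp
qed

lemma N_function_measurable:
  assumes N: "N_function \<phi>"
  shows "\<phi> \<in> borel_measurable borel"
proof -
  \<comment> \<open>An even function is monotone only on the half line; the truncation by 0 makes it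
    monotone everywhere, and the absolute value then restores \<open>\<phi>\<close>.\<close>
  have "mono (\<lambda>x. \<phi> (max x 0))"
    by (intro monoI N_function_mono[OF N]) auto
  then have "(\<lambda>x. \<phi> (max x 0)) \<in> borel_measurable borel"
    by (rule borel_measurable_mono)
  then have "(\<lambda>u. \<phi> (max \<bar>u\<bar> 0)) \<in> borel_measurable borel"
    by (rule measurable_compose[rotated]) simp
  then show ?thesis
    using N_function_abs[OF N] by simp
qed

lemma N_function_comp_measurable:
  assumes "N_function \<phi>" "f \<in> borel_measurable M"
  shows "(\<lambda>t. \<phi> (f t / r)) \<in> borel_measurable M"
  using measurable_compose[OF _ N_function_measurable[OF assms(1)], of "\<lambda>t. f t / r"] assms(2)
  by simp

section \<open>The Luxemburg norm and the embedding into L1\<close>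

lemma orlicz_space_iff:
  assumes "N_function \<phi>"
  shows "f \<in> orlicz_space a b \<phi> \<longleftrightarrow> f \<in> borel_measurable (lebesgue_on {a..b}) \<and>
    (\<exists>r>0. integrable (lebesgue_on {a..b}) (\<lambda>t. \<phi> (f t / r)))"
  unfolding orlicz_space_def
  using integrable_on_iff_integrable_nonneg[of "\<lambda>t. \<phi> (f t / _)" a b, OF N_function_nonneg[OF assms]]
  by simp

lemma orlicz_norm_eq:
  assumes "N_function \<phi>"
  shows "orlicz_norm a b \<phi> f =
     Inf {r. r > 0 \<and> integrable (lebesgue_on {a..b}) (\<lambda>t. \<phi> (f t / r)) \<and>
              (LINT t|lebesgue_on {a..b}. \<phi> (f t / r)) \<le> 1}"
proof -
  have "(\<lambda>t. \<phi> (f t / r)) integrable_on {a..b} \<and> integral {a..b} (\<lambda>t. \<phi> (f t / r)) \<le> 1 \<longleftrightarrow>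
    integrable (lebesgue_on {a..b}) (\<lambda>t. \<phi> (f t / r)) \<and>
              (LINT t|lebesgue_on {a..b}. \<phi> (f t / r)) \<le> 1" for r
    using integrable_on_iff_integrable_nonneg[of "\<lambda>t. \<phi> (f t / r)" a b, OF N_function_nonneg[OF assms]]
      lebesgue_integral_eq_integral[of "{a..b}" "\<lambda>t. \<phi> (f t / r)"]
    by auto
  then show ?thesis unfolding orlicz_norm_def by simp
qed

lemma orlicz_norm_le:
  assumes "N_function \<phi>" "r > 0" "integrable (lebesgue_on {a..b}) (\<lambda>t. \<phi> (f t / r))"
    "(LINT t|lebesgue_on {a..b}. \<phi> (f t / r)) \<le> 1"
  shows "orlicz_norm a b \<phi> f \<le> r"
  unfolding orlicz_norm_eq[OF assms(1)]
  by (rule cInf_lower) (use assms in \<open>auto intro!: bdd_belowI[of _ 0]\<close>)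

lemma orlicz_space_dominated:
  assumes N: "N_function \<phi>" and f: "f \<in> orlicz_space a b \<phi>"
    and h: "h \<in> borel_measurable (lebesgue_on {a..b})" "\<And>t. t \<in> {a..b} \<Longrightarrow> \<bar>h t\<bar> \<le> \<bar>f t\<bar>"
  shows "h \<in> orlicz_space a b \<phi>"
proof -
  obtain r where r: "r > 0" "integrable (lebesgue_on {a..b}) (\<lambda>t. \<phi> (f t / r))"
    using f orlicz_space_iff[OF N] by blast
  have "integrable (lebesgue_on {a..b}) (\<lambda>t. \<phi> (h t / r))"
  proof (rule Bochner_Integration.integrable_bound[OF r(2)])
    show "(\<lambda>t. \<phi> (h t / r)) \<in> borel_measurable (lebesgue_on {a..b})"
      by (rule N_function_comp_measurable[OF N h(1)])
    show "AE t in lebesgue_on {a..b}. norm (\<phi> (h t / r)) \<le> norm (\<phi> (f t / r))"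
      using h(2) r(1) N_function_nonneg[OF N]
      by (auto intro!: AE_I2 N_function_mono[OF N] divide_right_mono)
  qed
  with r h show ?thesis using orlicz_space_iff[OF N] by blast
qed

lemma bounded_in_orlicz_space:
  assumes N: "N_function \<phi>" and f: "f \<in> borel_measurable (lebesgue_on {a..b})"
    and B: "\<And>t. t \<in> {a..b} \<Longrightarrow> \<bar>f t\<bar> \<le> B"
  shows "f \<in> orlicz_space a b \<phi>"
proof (rule orlicz_space_dominated[OF N _ f])
  interpret finite_measure "lebesgue_on {a..b}" by (rule finite_measure_lebesgue_on_ivl)
  show "(\<lambda>_. B) \<in> orlicz_space a b \<phi>"
    unfolding orlicz_space_iff[OF N] by (auto intro!: exI[of _ 1])
qed (rule order_trans[OF B abs_ge_self])

lemma orlicz_norm_bounded_le: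
  assumes N: "N_function \<phi>" and f: "f \<in> borel_measurable (lebesgue_on {a..b})" and r: "r > 0"
    and B: "\<And>t. t \<in> {a..b} \<Longrightarrow> \<bar>f t\<bar> \<le> B"
    and le: "\<phi> (B / r) * measure (lebesgue_on {a..b}) (space (lebesgue_on {a..b})) \<le> 1"
  shows "orlicz_norm a b \<phi> f \<le> r"
proof (rule orlicz_norm_le[OF N r])
  interpret finite_measure "lebesgue_on {a..b}" by (rule finite_measure_lebesgue_on_ivl)
  have le_B: "\<phi> (f t / r) \<le> \<phi> (B / r)" if "t \<in> {a..b}" for t
    using B[OF that] r by (intro N_function_mono[OF N]) (auto simp: divide_right_mono)
  show int: "integrable (lebesgue_on {a..b}) (\<lambda>t. \<phi> (f t / r))"
  proof (rule Bochner_Integration.integrable_bound[of _ "\<lambda>_. \<phi> (B / r)"])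
    show "AE t in lebesgue_on {a..b}. norm (\<phi> (f t / r)) \<le> norm (\<phi> (B / r))"
      using le_B N_function_nonneg[OF N] by (intro AE_I2) simp
  qed (use N_function_comp_measurable[OF N f] in auto)
  have "(LINT t|lebesgue_on {a..b}. \<phi> (f t / r)) \<le> (LINT t|lebesgue_on {a..b}. \<phi> (B / r))"
    using int le_B by (intro integral_mono) auto
  with le show "(LINT t|lebesgue_on {a..b}. \<phi> (f t / r)) \<le> 1"
    by (simp add: mult.commute)
qed

text \<open>Dividing by a further factor \<open>s = max 1 I\<close> brings the modular from
  \<open>I\<close> down to at most 1, by convexity. Hence the set under \<open>Inf\<close> in the
  norm is nonempty and the infimum is meaningful on the whole Orlicz space.\<close>

lemma orlicz_space_norm_attained_bound:
  assumes N: "N_function \<phi>" and f: "f \<in> orlicz_space a b \<phi>"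
  shows "\<exists>r>0. integrable (lebesgue_on {a..b}) (\<lambda>t. \<phi> (f t / r)) \<and>
              (LINT t|lebesgue_on {a..b}. \<phi> (f t / r)) \<le> 1"
proof -
  obtain r where r: "r > 0" "integrable (lebesgue_on {a..b}) (\<lambda>t. \<phi> (f t / r))"
    and fm: "f \<in> borel_measurable (lebesgue_on {a..b})"
    using f orlicz_space_iff[OF N] by blast
  define I where "I = (LINT t|lebesgue_on {a..b}. \<phi> (f t / r))"
  have I: "0 \<le> I" unfolding I_def by (rule Bochner_Integration.integral_nonneg) (rule N_function_nonneg[OF N])
  define s where "s = max 1 I"
  have s: "1 \<le> s" "I \<le> s" by (auto simp: s_def)
  have le: "\<phi> (f t / (r * s)) \<le> (1/s) * \<phi> (f t / r)" for t
    using N_function_scale[OF N, of "1/s" "f t / r"] s by (simp add: mult.commute)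
  have int: "integrable (lebesgue_on {a..b}) (\<lambda>t. \<phi> (f t / (r * s)))"
    by (rule Bochner_Integration.integrable_bound[OF integrable_mult_right[OF r(2), of "1/s"]])
       (use le s N_function_nonneg[OF N] N_function_comp_measurable[OF N fm] in \<open>auto intro!: AE_I2\<close>)
  have "(LINT t|lebesgue_on {a..b}. \<phi> (f t / (r * s))) \<le> (LINT t|lebesgue_on {a..b}. (1/s) * \<phi> (f t / r))"
    by (rule integral_mono) (use int le r in auto)
  also have "\<dots> = I / s" by (simp add: I_def)
  also have "\<dots> \<le> 1" using s by simp
  finally show ?thesis
    using int r s by (intro exI[of _ "r * s"]) auto
qed

text \<open>The linear lower bound at \<open>f t / r\<close> reads |f| \<le> r + (r/c) \<phi>(f/r).
  Integrating it with modular at most 1 gives \<open>C * r\<close>, where the two summands of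
  \<open>C\<close> come from the two terms; the infimum over \<open>r\<close> turns \<open>r\<close>
  into the norm.\<close>

lemma orlicz_space_into_L1:
  assumes N: "N_function \<phi>"
  obtains C where "C > 0"
    "\<And>f. f \<in> orlicz_space a b \<phi> \<Longrightarrow> integrable (lebesgue_on {a..b}) f \<and>
        (LINT t|lebesgue_on {a..b}. \<bar>f t\<bar>) \<le> C * orlicz_norm a b \<phi> f"
proof -
  let ?M = "lebesgue_on {a..b}"
  interpret finite_measure ?M by (rule finite_measure_lebesgue_on_ivl)
  obtain c where c: "0 < c" "\<And>u. c * (\<bar>u\<bar> - 1) \<le> \<phi> u"
    using N_function_linear_lower_bound[OF N] by metis
  define C where "C = measure ?M (space ?M) + 1 / c"
  have C: "C > 0" using c by (simp add: C_def add_nonneg_pos)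
  have "integrable ?M f \<and> (LINT t|?M. \<bar>f t\<bar>) \<le> C * orlicz_norm a b \<phi> f"
    if f: "f \<in> orlicz_space a b \<phi>" for f
  proof -
    have fm: "f \<in> borel_measurable ?M" using f orlicz_space_iff[OF N] by blast
    have bound: "integrable ?M f \<and> (LINT t|?M. \<bar>f t\<bar>) \<le> C * r"
      if r: "r > 0" "integrable ?M (\<lambda>t. \<phi> (f t / r))" "(LINT t|?M. \<phi> (f t / r)) \<le> 1" for r
    proof -
      have le: "\<bar>f t\<bar> \<le> r + (r / c) * \<phi> (f t / r)" for t
      proof -
        have "(r/c) * (c * (\<bar>f t / r\<bar> - 1)) \<le> (r/c) * \<phi> (f t / r)"
          using c(1) r by (intro mult_left_mono c(2)) auto
        moreover have "(r/c) * (c * (\<bar>f t / r\<bar> - 1)) = \<bar>f t\<bar> - r"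
          using c r by (simp add: field_simps)
        ultimately show ?thesis by simp
      qed
      have i2: "integrable ?M (\<lambda>t. r + (r / c) * \<phi> (f t / r))"
        using r by auto
      have i1: "integrable ?M f"
        by (rule Bochner_Integration.integrable_bound[OF i2])
           (use fm le in \<open>auto intro!: AE_I2 intro: order_trans[OF _ abs_ge_self]\<close>)
      have "(LINT t|?M. \<bar>f t\<bar>) \<le> (LINT t|?M. r + (r / c) * \<phi> (f t / r))"
        by (rule integral_mono) (use i1 i2 le in auto)
      also have "\<dots> = r * measure ?M (space ?M) + (r / c) * (LINT t|?M. \<phi> (f t / r))"
        using r by (subst Bochner_Integration.integral_add) auto
      also have "\<dots> \<le> r * measure ?M (space ?M) + (r / c) * 1"
        using r c by (intro add_left_mono mult_left_mono) auto
      finally show ?thesis using i1 by (simp add: C_def algebra_simps)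
    qed
    obtain r0 where r0: "r0 > 0" "integrable ?M (\<lambda>t. \<phi> (f t / r0))" "(LINT t|?M. \<phi> (f t / r0)) \<le> 1"
      using orlicz_space_norm_attained_bound[OF N f] by blast
    have "(LINT t|?M. \<bar>f t\<bar>) / C \<le> orlicz_norm a b \<phi> f"
      unfolding orlicz_norm_eq[OF N]
      by (rule cInf_greatest) (use r0 bound C in \<open>auto simp: field_simps\<close>)
    then show ?thesis
      using bound[OF r0] C by (simp add: field_simps)
  qed
  with C show ?thesis using that by blast
qed

text \<open>Both integrals are continuous for the norm because the L1 norm is. Differences are
  treated at once since the threshold bounds are inequalities on the integral over \<open>P\<close>
  minus the integral over \<open>Q\<close>; a single integral is the case
  \<open>F = {}\<close>.\<close>

lemma H_int_on_diff_in_orlicz_dual: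
  assumes N: "N_function \<phi>" and E: "E \<in> sets (lebesgue_on {a..b})" and F: "F \<in> sets (lebesgue_on {a..b})"
  shows "(\<lambda>f. H_int_on a b E f - H_int_on a b F f) \<in> orlicz_dual a b \<phi>"
proof -
  let ?M = "lebesgue_on {a..b}"
  obtain C where C: "C > 0"
    "\<And>f. f \<in> orlicz_space a b \<phi> \<Longrightarrow> integrable ?M f \<and> (LINT t|?M. \<bar>f t\<bar>) \<le> C * orlicz_norm a b \<phi> f"
    using orlicz_space_into_L1[OF N] by blast
  have lin: "H_int_on a b G (\<lambda>t. f t + h t) = H_int_on a b G f + H_int_on a b G h"
    "H_int_on a b G (\<lambda>t. c * f t) = c * H_int_on a b G f"
    if "f \<in> orlicz_space a b \<phi>" "h \<in> orlicz_space a b \<phi>" "G \<in> sets ?M" for f h c G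
  proof -
    have i: "integrable ?M f" "integrable ?M h" using C that by auto
    show "H_int_on a b G (\<lambda>t. f t + h t) = H_int_on a b G f + H_int_on a b G h"
      using i that(3) integrable_indicator_mult[OF i(1) that(3)] integrable_indicator_mult[OF i(2) that(3)]
      by (simp add: H_int_on_eq_LINT distrib_left)
    show "H_int_on a b G (\<lambda>t. c * f t) = c * H_int_on a b G f"
      using i that(3) by (simp add: H_int_on_eq_LINT mult.left_commute)
  qed
  have bd: "\<bar>H_int_on a b G f\<bar> \<le> C * orlicz_norm a b \<phi> f"
    if "f \<in> orlicz_space a b \<phi>" "G \<in> sets ?M" for f G
  proof -
    have i: "integrable ?M f" using C that by auto
    have "\<bar>H_int_on a b G f\<bar> \<le> (LINT t|?M. \<bar>indicator G t * f t\<bar>)"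
      using i that(2) by (simp add: H_int_on_eq_LINT integral_abs_bound)
    also have "\<dots> \<le> (LINT t|?M. \<bar>f t\<bar>)"
      by (rule integral_mono)
         (use i integrable_abs[OF integrable_indicator_mult[OF i that(2)]] in \<open>auto simp: indicator_def\<close>)
    finally show ?thesis using C that by fastforce
  qed
  have "\<bar>H_int_on a b E f - H_int_on a b F f\<bar> \<le> (2 * C) * orlicz_norm a b \<phi> f"
    if "f \<in> orlicz_space a b \<phi>" for f
    using bd[OF that E] bd[OF that F] by simp
  then show ?thesis
    unfolding orlicz_dual_def using lin E F
    by (auto simp: algebra_simps intro!: exI[of _ "2 * C"])
qed

lemma H_int_on_in_orlicz_dual:
  assumes "N_function \<phi>" "E \<in> sets (lebesgue_on {a..b})"
  shows "H_int_on a b E \<in> orlicz_dual a b \<phi>"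
  using H_int_on_diff_in_orlicz_dual[OF assms, of "{}"] by (simp add: H_int_on_def[of _ _ "{}"])

section \<open>The weak topology\<close>

lemma topspace_orlicz_weak_topology [simp]:
  "topspace (orlicz_weak_topology a b \<phi>) = orlicz_space a b \<phi>"
proof -
  have "(\<lambda>_. 0) \<in> orlicz_dual a b \<phi>"
    by (auto simp: orlicz_dual_def intro: exI[of _ 0])
  then have "UNIV \<in> {{f. L f \<in> U} | L U. L \<in> orlicz_dual a b \<phi> \<and> open U}"
    by (auto intro!: exI[of _ "\<lambda>_. 0"] exI[of _ UNIV])
  then show ?thesis
    unfolding orlicz_weak_topology_def topspace_subtopology topology_generated_by_topspace by blast
qed

lemma openin_orlicz_weak_topology:
  assumes "L \<in> orlicz_dual a b \<phi>" "open U"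
  shows "openin (orlicz_weak_topology a b \<phi>) {f \<in> orlicz_space a b \<phi>. L f \<in> U}"
proof -
  have "openin (topology_generated_by {{f. L f \<in> U} | L U. L \<in> orlicz_dual a b \<phi> \<and> open U}) {f. L f \<in> U}"
    by (rule topology_generated_by_Basis) (use assms in blast)
  moreover have "{f \<in> orlicz_space a b \<phi>. L f \<in> U} = {f. L f \<in> U} \<inter> orlicz_space a b \<phi>" by auto
  ultimately show ?thesis
    unfolding orlicz_weak_topology_def openin_subtopology by blast
qed

lemma closedin_orlicz_weak_topology_le:
  assumes "L \<in> orlicz_dual a b \<phi>"
  shows "closedin (orlicz_weak_topology a b \<phi>) {f \<in> orlicz_space a b \<phi>. L f \<le> c}"
proof -
  have "orlicz_space a b \<phi> - {f \<in> orlicz_space a b \<phi>. L f \<le> c} = {f \<in> orlicz_space a b \<phi>. L f \<in> {c<..}}"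
    by auto
  then show ?thesis
    using openin_orlicz_weak_topology[OF assms, of "{c<..}"] by (auto simp: closedin_def)
qed

section \<open>Weak compactness implies countable additivity\<close>

lemma disjoint_family_UN_disjoint:
  assumes A: "disjoint_family A" and J: "J \<inter> J' = {}"
  shows "(\<Union>k\<in>J. A k) \<inter> (\<Union>k\<in>J'. A k) = {}"
proof -
  have "A k \<inter> A k' = {}" if "k \<in> J" "k' \<in> J'" for k k'
    using disjoint_family_onD[OF A, of k k'] J that by blast
  then show ?thesis by blast
qed

text \<open>To be read with \<open>d j\<close> as the signed measure, on sets of indices, of the
  \<open>j\<close>-th function minus a cluster point. A block {n..<q} carries more than 3e/4 of some
  \<open>d j\<close>; \<open>tail\<close> leaves less than e/4 beyond \<open>q\<close>, and
  \<open>small\<close> picks the next \<open>j\<close> with less than e/4 before its block. On the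
  union \<open>S\<close> of all blocks at least 3e/4 - e/4 - e/4 survives for each chosen
  \<open>j\<close> with a predecessor.\<close>

lemma gliding_hump:
  fixes d :: "nat \<Rightarrow> nat set \<Rightarrow> real"
  assumes e: "e > 0"
    and add: "\<And>j J J'. J \<inter> J' = {} \<Longrightarrow> d j (J \<union> J') = d j J + d j J'"
    and tail: "\<And>j r. r > 0 \<Longrightarrow> \<exists>q. \<forall>J\<subseteq>{q..}. \<bar>d j J\<bar> < r"
    and small: "\<And>p r. r > 0 \<Longrightarrow> \<exists>\<^sub>\<infinity>j. \<forall>J\<subseteq>{..<p}. \<bar>d j J\<bar> < r"
    and big: "\<And>j. j \<ge> j0 \<Longrightarrow> \<exists>n\<ge>j. \<bar>d j {n..}\<bar> > e"
  obtains S r where "\<And>i. \<bar>d (r i) S\<bar> > e / 4" "\<And>k. (\<lambda>i. d (r i) {k}) \<longlonglongrightarrow> 0"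
proof -
  \<comment> \<open>A state (j, n, q) is a functional with its block. \<open>P\<close> is the
    quality of one state, \<open>Q\<close> the compatibility of successive ones; the factor 1 /
    \<open>Suc i\<close> in \<open>Q\<close> is what makes the values on singletons tend to
    0.\<close>
  define P where "P x \<longleftrightarrow> (case x of (j, n, q) \<Rightarrow> n \<le> q \<and> \<bar>d j {n..<q}\<bar> > 3 * e / 4 \<and>
      (\<forall>J\<subseteq>{q..}. \<bar>d j J\<bar> < e / 4))" for x :: "nat \<times> nat \<times> nat"
  define Q where "Q i x x' \<longleftrightarrow> (case (x, x') of ((j, n, q), (j', n', q')) \<Rightarrow> q \<le> n' \<and> q < q' \<and>
      (\<forall>J\<subseteq>{..<q}. \<bar>d j' J\<bar> < e / 4 / real (Suc i)))" for i and x x' :: "nat \<times> nat \<times> nat"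
  have step: "\<exists>n q. l \<le> n \<and> l < q \<and> P (j, n, q)" if j: "j \<ge> j0" "j \<ge> l" for j l
  proof -
    obtain n where n: "n \<ge> j" "\<bar>d j {n..}\<bar> > e" using big[OF j(1)] by blast
    obtain q0 where q0: "\<forall>J\<subseteq>{q0..}. \<bar>d j J\<bar> < e / 4" using tail[of "e/4" j] e by (metis divide_pos_pos zero_less_numeral)
    \<comment> \<open>Cutting {n..} at \<open>q\<close> costs less than e/4 of the more than
      \<open>e\<close> found there; exceeding \<open>l\<close> as well makes the ends of the blocks
      strictly increasing.\<close>
    define q where "q = max q0 (Suc (max n l))"
    have tq: "\<forall>J\<subseteq>{q..}. \<bar>d j J\<bar> < e / 4"
    proof (intro allI impI)
      fix J assume "J \<subseteq> {q..}"
      also have "{q..} \<subseteq> {q0..}" by (simp add: q_def)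
      finally show "\<bar>d j J\<bar> < e / 4" using q0 by blast
    qed
    have "{n..} = {n..<q} \<union> {q..}" by (auto simp: q_def)
    then have "d j {n..} = d j {n..<q} + d j {q..}"
      using add[of "{n..<q}" "{q..}" j] by (simp add: ivl_disj_int)
    moreover have "\<bar>d j {q..}\<bar> < e / 4" using tq by simp
    ultimately have "\<bar>d j {n..<q}\<bar> > 3 * e / 4" using n(2) by linarith
    moreover have "n \<le> q" "l < q" by (auto simp: q_def)
    ultimately show ?thesis
      using n(1) j(2) tq unfolding P_def split by (intro exI[of _ n] exI[of _ q] conjI) linarith+
  qed
  have "\<exists>x. \<forall>i. P (x i) \<and> Q i (x i) (x (Suc i))"
  proof (rule dependent_nat_choice)
    show "\<exists>x. P x" using step[of j0 0] by blast
    fix x i assume "P x"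
    obtain j n q where x: "x = (j, n, q)" by (metis prod_cases3)
    have "e / 4 / real (Suc i) > 0" using e by simp
    from small[OF this, of q] have "\<exists>j'\<ge>max j0 q. \<forall>J\<subseteq>{..<q}. \<bar>d j' J\<bar> < e / 4 / real (Suc i)"
      unfolding cofinite_eq_sequentially frequently_sequentially by blast
    then obtain j' where j': "j' \<ge> j0" "j' \<ge> q" "\<forall>J\<subseteq>{..<q}. \<bar>d j' J\<bar> < e / 4 / real (Suc i)"
      by auto
    obtain n' q' where "q \<le> n'" "q < q'" "P (j', n', q')" using step[OF j'(1,2)] by blast
    then show "\<exists>y. P y \<and> Q i x y"
      using j' x by (intro exI[of _ "(j', n', q')"]) (auto simp: Q_def)
  qed
  then obtain x where x: "\<And>i. P (x i)" "\<And>i. Q i (x i) (x (Suc i))" by blast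
  define j n q where "j i = fst (x i)" and "n i = fst (snd (x i))" and "q i = snd (snd (x i))" for i
  have nq: "n i \<le> q i" "\<bar>d (j i) {n i..<q i}\<bar> > 3 * e / 4" "\<And>J. J \<subseteq> {q i..} \<Longrightarrow> \<bar>d (j i) J\<bar> < e / 4" for i
    using x(1)[of i] by (auto simp: P_def j_def n_def q_def split: prod.splits)
  have qn: "q i \<le> n (Suc i)" "q i < q (Suc i)"
      "\<And>J. J \<subseteq> {..<q i} \<Longrightarrow> \<bar>d (j (Suc i)) J\<bar> < e / 4 / real (Suc i)" for i
    using x(2)[of i] by (auto simp: Q_def j_def n_def q_def split: prod.splits)
  have smq: "strict_mono q" using qn(2) by (simp add: strict_mono_Suc_iff)
  then have monoq: "q i \<le> q l" if "i \<le> l" for i l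
    using that by (simp add: strict_mono_less_eq)
  have qi: "i \<le> q i" for i using smq by (simp add: strict_mono_imp_increasing)
  define S where "S = (\<Union>i. {n i..<q i})"
  \<comment> \<open>The index is \<open>Suc i\<close> because only a state with a predecessor has
    control over the part of \<open>S\<close> below its block.\<close>
  have dS: "\<bar>d (j (Suc i)) S\<bar> > e / 4" for i
  proof -
    let ?j = "j (Suc i)"
    let ?I = "{n (Suc i)..<q (Suc i)}"
    \<comment> \<open>Earlier blocks end by \<open>q i\<close> and later ones begin at
      \<open>q (Suc i)\<close> or beyond, so the window meets \<open>S\<close> in its own block
      alone.\<close>
    have sub: "S \<inter> {q i..<q (Suc i)} = ?I"
    proof (rule set_eqI)
      fix k
      have *: "k \<notin> {n l..<q l}" if "k \<in> {q i..<q (Suc i)}" "l \<noteq> Suc i" for l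
      proof (cases "l \<le> i")
        case True
        then show ?thesis using monoq[of l i] that by auto
      next
        case False
        then have "q (Suc i) \<le> q (l - 1)" "q (l - 1) \<le> n l"
          using that(2) monoq[of "Suc i" "l - 1"] qn(1)[of "l - 1"] by auto
        then show ?thesis using that by auto
      qed
      show "k \<in> S \<inter> {q i..<q (Suc i)} \<longleftrightarrow> k \<in> ?I"
      proof
        assume k: "k \<in> S \<inter> {q i..<q (Suc i)}"
        then obtain l where l: "k \<in> {n l..<q l}" unfolding S_def by blast
        with * k have "l = Suc i" by blast
        with l show "k \<in> ?I" by simp
      next
        assume "k \<in> ?I"
        then show "k \<in> S \<inter> {q i..<q (Suc i)}" using qn(1)[of i] unfolding S_def by auto
      qed
    qed
    have "S = (S \<inter> {..<q i}) \<union> (?I \<union> (S \<inter> {q (Suc i)..}))"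
      unfolding sub[symmetric] using qn(2)[of i] by auto
    then have "d ?j S = d ?j ((S \<inter> {..<q i}) \<union> (?I \<union> (S \<inter> {q (Suc i)..})))" by simp
    also have "\<dots> = d ?j (S \<inter> {..<q i}) + d ?j (?I \<union> (S \<inter> {q (Suc i)..}))"
      by (rule add) (use qn(1,2)[of i] in auto)
    also have "d ?j (?I \<union> (S \<inter> {q (Suc i)..})) = d ?j ?I + d ?j (S \<inter> {q (Suc i)..})"
      by (rule add) auto
    finally have "d ?j S = d ?j (S \<inter> {..<q i}) + (d ?j ?I + d ?j (S \<inter> {q (Suc i)..}))" .
    moreover have "\<bar>d ?j (S \<inter> {..<q i})\<bar> < e / 4 / real (Suc i)" by (rule qn(3)) auto
    moreover have "e / 4 / real (Suc i) \<le> e / 4" using e by (simp add: field_simps)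
    moreover have "\<bar>d ?j (S \<inter> {q (Suc i)..})\<bar> < e / 4" by (rule nq(3)) auto
    ultimately show ?thesis using nq(2)[of "Suc i"] by linarith
  qed
  have lim: "(\<lambda>i. d (j (Suc i)) {k}) \<longlonglongrightarrow> 0" for k
  proof (rule Lim_null_comparison)
    show "\<forall>\<^sub>F i in sequentially. norm (d (j (Suc i)) {k}) \<le> e / 4 / real (Suc i)"
      unfolding eventually_sequentially
    proof (intro exI allI impI)
      fix i assume "Suc k \<le> i"
      then have "{k} \<subseteq> {..<q i}" using qi[of i] by auto
      then show "norm (d (j (Suc i)) {k}) \<le> e / 4 / real (Suc i)" using qn(3) by force
    qed
    show "(\<lambda>i. e / 4 / real (Suc i)) \<longlonglongrightarrow> 0"
      using LIMSEQ_Suc[OF lim_const_over_n[of "e / 4"]] by simp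
  qed
  show ?thesis using that[of "\<lambda>i. j (Suc i)" S] dS lim by blast
qed

text \<open>Sets \<open>J\<close> of indices turn each \<open>f\<close> in \<open>C\<close> into a
  set function \<open>\<nu> f\<close> on the naturals with vanishing tails. Such set functions are
  determined by their values on singletons; a weak cluster point must therefore see the same
  singletons and yet different values on the set built by the gliding hump.\<close>

lemma rel_weakly_compact_orlicz_uniform_tail:
  fixes A :: "nat \<Rightarrow> real set"
  assumes N: "N_function \<phi>" and comp: "rel_weakly_compact_orlicz a b \<phi> S"
    and A: "\<And>n. A n \<in> sets (lebesgue_on {a..b})" "disjoint_family A" and e0: "e0 > 0"
  shows "\<exists>n0. \<forall>n\<ge>n0. \<forall>f\<in>S. \<bar>H_int_on a b (\<Union>k\<in>{n..}. A k) f\<bar> \<le> e0"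
proof (rule ccontr)
  let ?M = "lebesgue_on {a..b}"
  let ?T = "orlicz_weak_topology a b \<phi>"
  define C where "C = ?T closure_of S"
  have C: "compactin ?T C" "S \<subseteq> C" "C \<subseteq> orlicz_space a b \<phi>"
    using comp closure_of_subset[of S ?T] closure_of_subset_topspace[of ?T S]
    unfolding rel_weakly_compact_orlicz_def C_def by auto
  have intg: "integrable ?M f" if "f \<in> C" for f
    using orlicz_space_into_L1[OF N] that C(3) by (metis subsetD)
  define V where "V J = (\<Union>k\<in>J. A k)" for J
  have Vm[measurable]: "V J \<in> sets ?M" for J
    unfolding V_def using A(1) by (intro sets.countable_UN'') auto
  define \<nu> where "\<nu> f J = H_int_on a b (V J) f" for f J
  have \<nu>_eq: "\<nu> f J = (LINT x|?M. indicator (V J) x * f x)" if "f \<in> C" for f J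
    unfolding \<nu>_def by (rule H_int_on_eq_LINT[OF intg[OF that] Vm])
  have \<nu>_dual: "(\<lambda>f. \<nu> f J) \<in> orlicz_dual a b \<phi>" for J
    unfolding \<nu>_def by (rule H_int_on_in_orlicz_dual[OF N Vm])
  have V_Un: "indicator (V (J \<union> J')) x = (indicator (V J) x + indicator (V J') x :: real)"
    if "J \<inter> J' = {}" for J J' x
  proof -
    have "V J \<inter> V J' = {}"
      unfolding V_def by (rule disjoint_family_UN_disjoint[OF A(2) that])
    then show ?thesis by (auto simp: indicator_def V_def)
  qed
  have \<nu>_add: "\<nu> f (J \<union> J') = \<nu> f J + \<nu> f J'" if "f \<in> C" "J \<inter> J' = {}" for f J J'
    using integrable_indicator_mult[OF intg[OF that(1)] Vm, of J]
      integrable_indicator_mult[OF intg[OF that(1)] Vm, of J']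
    by (simp add: \<nu>_eq that V_Un distrib_right)
  \<comment> \<open>One \<open>q\<close> serves all \<open>J\<close> beyond it, because |f| over
    \<open>V {q..}\<close> dominates every such integral.\<close>
  have \<nu>_tail: "\<exists>q. \<forall>J\<subseteq>{q..}. \<bar>\<nu> f J\<bar> < r" if f: "f \<in> C" and r: "r > 0" for f r
  proof -
    have "(\<lambda>q. LINT x|?M. indicator (V {q..}) x * \<bar>f x\<bar>) \<longlonglongrightarrow> 0"
    proof (rule integral_indicator_decseq_tendsto_0)
      show "decseq (\<lambda>q. V {q..})" unfolding decseq_def V_def by (intro allI impI UN_mono) auto
      have "x \<notin> (\<Inter>q. V {q..})" for x
      proof
        assume x: "x \<in> (\<Inter>q. V {q..})"
        then obtain k where k: "x \<in> A k" by (auto simp: V_def)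
        from x obtain l where "l \<ge> Suc k" "x \<in> A l" by (auto simp: V_def)
        then show False using disjoint_family_onD[OF A(2), of k l] k by auto
      qed
      then have "(\<Inter>q. V {q..}) = {}" by blast
      then show "emeasure ?M (\<Inter>q. V {q..}) = 0" by simp
    qed (use intg[OF f] in auto)
    from LIMSEQ_D[OF this r] obtain q where
      q: "\<bar>LINT x|?M. indicator (V {q..}) x * \<bar>f x\<bar>\<bar> < r" by auto
    have "\<bar>\<nu> f J\<bar> < r" if "J \<subseteq> {q..}" for J
    proof -
      have "\<bar>\<nu> f J\<bar> \<le> (LINT x|?M. \<bar>indicator (V J) x * f x\<bar>)"
        by (simp add: \<nu>_eq[OF f] integral_abs_bound)
      also have "\<dots> \<le> (LINT x|?M. indicator (V {q..}) x * \<bar>f x\<bar>)"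
      proof (rule integral_mono)
        have "V J \<subseteq> V {q..}" using that by (auto simp: V_def)
        then show "\<bar>indicator (V J) x * f x\<bar> \<le> indicator (V {q..}) x * \<bar>f x\<bar>" for x
          by (auto simp: indicator_def)
      qed (use integrable_indicator_mult[OF intg[OF f] Vm] integrable_indicator_mult[OF integrable_abs[OF intg[OF f]] Vm]
           in \<open>auto intro!: integrable_abs\<close>)
      finally show ?thesis using q by simp
    qed
    then show ?thesis by blast
  qed
  have cluster: "\<exists>\<^sub>\<infinity>i. \<forall>J\<in>\<J>. \<bar>\<nu> (h i) J - \<nu> p J\<bar> < r"
    if p: "p \<in> C" "\<And>U. openin ?T U \<Longrightarrow> p \<in> U \<Longrightarrow> \<exists>\<^sub>\<infinity>i. h i \<in> U" and r: "r > 0" and fin: "finite \<J>" "\<J> \<noteq> {}"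
    for h :: "nat \<Rightarrow> real \<Rightarrow> real" and p \<J> r
  proof -
    let ?U = "\<lambda>J. {f \<in> orlicz_space a b \<phi>. \<nu> f J \<in> ball (\<nu> p J) r}"
    have "openin ?T (\<Inter>J\<in>\<J>. ?U J)"
      using fin by (intro openin_Inter) (auto intro!: openin_orlicz_weak_topology \<nu>_dual simp del: mem_ball)
    moreover have "p \<in> (\<Inter>J\<in>\<J>. ?U J)" using p(1) C(3) r by auto
    ultimately have "\<exists>\<^sub>\<infinity>i. h i \<in> (\<Inter>J\<in>\<J>. ?U J)" by (rule p(2))
    then show ?thesis
      by (rule frequently_elim1) (auto simp: dist_real_def abs_minus_commute)
  qed
  assume "\<not> ?thesis"
  then have "\<forall>j. \<exists>n\<ge>j. \<exists>f\<in>S. \<bar>\<nu> f {n..}\<bar> > e0"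
    unfolding \<nu>_def V_def by (meson not_le)
  then obtain N' h where h: "\<And>j. N' j \<ge> j" "\<And>j. h j \<in> S" "\<And>j. \<bar>\<nu> (h j) {N' j..}\<bar> > e0"
    by metis
  have hC: "h j \<in> C" for j using h(2) C(2) by blast
  obtain f where f: "f \<in> C" "\<And>U. openin ?T U \<Longrightarrow> f \<in> U \<Longrightarrow> \<exists>\<^sub>\<infinity>i. h i \<in> U"
    using compactin_sequence_cluster_point[OF C(1), of h] hC by metis
  define d where "d j J = \<nu> (h j) J - \<nu> f J" for j J
  obtain q where q: "\<And>J. J \<subseteq> {q..} \<Longrightarrow> \<bar>\<nu> f J\<bar> < e0/2" using \<nu>_tail[OF f(1) half_gt_zero[OF e0]] by blast
  obtain S' r where S': "\<And>i. \<bar>d (r i) S'\<bar> > e0 / 2 / 4" "\<And>k. (\<lambda>i. d (r i) {k}) \<longlonglongrightarrow> 0"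
  proof (rule gliding_hump)
    show "e0 / 2 > 0" using e0 by simp
    show "d j (J \<union> J') = d j J + d j J'" if "J \<inter> J' = {}" for j J J'
      using \<nu>_add[OF f(1) that] \<nu>_add[OF hC that, of j] by (simp add: d_def)
    show "\<exists>q. \<forall>J\<subseteq>{q..}. \<bar>d j J\<bar> < r" if r: "r > 0" for j r
    proof -
      obtain q1 where q1: "\<And>J. J \<subseteq> {q1..} \<Longrightarrow> \<bar>\<nu> f J\<bar> < r/2" using \<nu>_tail[OF f(1) half_gt_zero[OF r]] by blast
      obtain q2 where q2: "\<And>J. J \<subseteq> {q2..} \<Longrightarrow> \<bar>\<nu> (h j) J\<bar> < r/2" using \<nu>_tail[OF hC half_gt_zero[OF r], of j] by blast
      have "\<bar>d j J\<bar> < r" if "J \<subseteq> {max q1 q2..}" for J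
      proof -
        have "J \<subseteq> {q1..}" "J \<subseteq> {q2..}" using that by auto
        then show ?thesis using q1[of J] q2[of J] by (simp add: d_def)
      qed
      then show ?thesis by blast
    qed
    \<comment> \<open>A weak neighbourhood controls finitely many functionals together, and {..<p}
      has finitely many subsets.\<close>
    show "\<exists>\<^sub>\<infinity>j. \<forall>J\<subseteq>{..<p}. \<bar>d j J\<bar> < r" if "r > 0" for p r
      unfolding d_def using cluster[OF f that, of "Pow {..<p}"] by (auto simp: Pow_def)
    \<comment> \<open>Beyond \<open>q\<close> the cluster point has tails below e0/2, so subtracting
      it leaves more than half of the tail of \<open>h j\<close>.\<close>
    show "\<exists>n\<ge>j. \<bar>d j {n..}\<bar> > e0 / 2" if "j \<ge> q" for j
    proof -
      have "{N' j..} \<subseteq> {q..}" using h(1)[of j] that by auto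
      from q[OF this] h(3)[of j] have "\<bar>d j {N' j..}\<bar> > e0 / 2" unfolding d_def by linarith
      then show ?thesis using h(1)[of j] by blast
    qed
  qed metis
  obtain p where p: "p \<in> C" "\<And>U. openin ?T U \<Longrightarrow> p \<in> U \<Longrightarrow> \<exists>\<^sub>\<infinity>i. h (r i) \<in> U"
    using compactin_sequence_cluster_point[OF C(1), of "\<lambda>i. h (r i)"] hC by metis
  \<comment> \<open>On a singleton the values of \<open>h (r i)\<close> converge to that of
    \<open>f\<close>, while that of \<open>p\<close> is one of their cluster values.\<close>
  have pk: "\<nu> p {k} = \<nu> f {k}" for k
  proof (rule ccontr)
    assume "\<nu> p {k} \<noteq> \<nu> f {k}"
    then have s: "\<bar>\<nu> p {k} - \<nu> f {k}\<bar> / 2 > 0" by simp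
    have "\<exists>\<^sub>\<infinity>i. \<forall>J\<in>{{k}}. \<bar>\<nu> (h (r i)) J - \<nu> p J\<bar> < \<bar>\<nu> p {k} - \<nu> f {k}\<bar> / 2"
      by (rule cluster[of p "\<lambda>i. h (r i)", OF p s]) auto
    moreover have "\<forall>\<^sub>\<infinity>i. \<bar>d (r i) {k}\<bar> < \<bar>\<nu> p {k} - \<nu> f {k}\<bar> / 2"
      using order_tendstoD(2)[OF tendsto_rabs_zero[OF S'(2)] s] by (simp add: cofinite_eq_sequentially)
    ultimately have "\<exists>\<^sub>\<infinity>i. \<bar>d (r i) {k}\<bar> < \<bar>\<nu> p {k} - \<nu> f {k}\<bar> / 2 \<and>
        (\<forall>J\<in>{{k}}. \<bar>\<nu> (h (r i)) J - \<nu> p J\<bar> < \<bar>\<nu> p {k} - \<nu> f {k}\<bar> / 2)"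
      by (rule frequently_eventually_conj)
    then obtain i where "\<bar>d (r i) {k}\<bar> < \<bar>\<nu> p {k} - \<nu> f {k}\<bar> / 2"
        "\<bar>\<nu> (h (r i)) {k} - \<nu> p {k}\<bar> < \<bar>\<nu> p {k} - \<nu> f {k}\<bar> / 2"
      by (auto dest!: frequently_ex)
    moreover have "\<bar>u - w\<bar> \<le> \<bar>v - u\<bar> + \<bar>v - w\<bar>" for u v w :: real by linarith
    ultimately show False unfolding d_def by (smt (verit) field_sum_of_halves)
  qed
  have p_fin: "\<nu> p J = \<nu> f J" if "finite J" for J
    using that
  proof induction
    case empty
    then show ?case by (simp add: \<nu>_def V_def H_int_on_def)
  next
    case (insert k J)
    then show ?case
      using \<nu>_add[OF p(1), of "{k}" J] \<nu>_add[OF f(1), of "{k}" J] pk[of k] by simp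
  qed
  \<comment> \<open>Agreement on finite sets reaches the infinite set \<open>S'\<close> because both
    tails beyond \<open>q\<close> are below t/2.\<close>
  have "\<bar>\<nu> p S' - \<nu> f S'\<bar> \<le> t" if t: "t > 0" for t
  proof -
    obtain q1 where q1: "\<And>J. J \<subseteq> {q1..} \<Longrightarrow> \<bar>\<nu> f J\<bar> < t/2" using \<nu>_tail[OF f(1) half_gt_zero[OF t]] by blast
    obtain q2 where q2: "\<And>J. J \<subseteq> {q2..} \<Longrightarrow> \<bar>\<nu> p J\<bar> < t/2" using \<nu>_tail[OF p(1) half_gt_zero[OF t]] by blast
    define q where "q = max q1 q2"
    have S'_eq: "S' = (S' \<inter> {..<q}) \<union> (S' \<inter> {q..})" by auto
    have "(S' \<inter> {..<q}) \<inter> (S' \<inter> {q..}) = {}" by auto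
    from \<nu>_add[OF p(1) this] \<nu>_add[OF f(1) this] S'_eq p_fin[of "S' \<inter> {..<q}"]
    have "\<nu> p S' - \<nu> f S' = \<nu> p (S' \<inter> {q..}) - \<nu> f (S' \<inter> {q..})" by simp
    moreover have "S' \<inter> {q..} \<subseteq> {q1..}" "S' \<inter> {q..} \<subseteq> {q2..}" by (auto simp: q_def)
    ultimately show ?thesis
      using q1[of "S' \<inter> {q..}"] q2[of "S' \<inter> {q..}"] by simp
  qed
  then have "\<nu> p S' = \<nu> f S'"
    using field_le_epsilon[of "\<bar>\<nu> p S' - \<nu> f S'\<bar>" 0] by simp
  moreover have "\<exists>\<^sub>\<infinity>i. \<forall>J\<in>{S'}. \<bar>\<nu> (h (r i)) J - \<nu> p J\<bar> < e0 / 2 / 4"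
    by (rule cluster[of p "\<lambda>i. h (r i)", OF p]) (use e0 in auto)
  then obtain i where "\<bar>\<nu> (h (r i)) S' - \<nu> p S'\<bar> < e0 / 2 / 4"
    using frequently_ex by fastforce
  ultimately show False using S'(1)[of i] by (simp add: d_def)
qed

text \<open>With \<open>E\<close> the set where f = y g is nonnegative, 2 \<chi>_E f - f = |f|.
  Gauge integrability of \<chi>_E f thus gives that of |f|, which is absolute, hence Lebesgue,
  integrability.\<close>

lemma HD_integrable_imp_integrable:
  fixes g :: "real \<Rightarrow> 'a::banach" and y :: "'a \<Rightarrow>\<^sub>L real"
  assumes "HD_integrable a b g"
    and "\<forall>E\<in>leb_sets a b. HD_integrable a b (\<lambda>t. indicator E t *\<^sub>R g t)"
  shows "integrable (lebesgue_on {a..b}) (\<lambda>t. blinfun_apply y (g t))"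
proof -
  let ?M = "lebesgue_on {a..b}"
  let ?f = "\<lambda>t. blinfun_apply y (g t)"
  have f: "?f integrable_on {a..b}" using assms(1) unfolding HD_integrable_def by blast
  have fm[measurable]: "?f \<in> borel_measurable ?M" using integrable_imp_measurable[OF f] .
  define E where "E = {t \<in> space ?M. ?f t \<ge> 0}"
  have "E \<in> leb_sets a b" unfolding leb_sets_eq_sets E_def by measurable
  then have "(\<lambda>t. blinfun_apply y (indicator E t *\<^sub>R g t)) integrable_on {a..b}"
    using assms(2) unfolding HD_integrable_def by blast
  then have iE: "(\<lambda>t. indicator E t * ?f t) integrable_on {a..b}"
    by (simp add: blinfun.scaleR_right)
  have "(\<lambda>t. 2 * (indicator E t * ?f t) - ?f t) integrable_on {a..b}"
    using integrable_diff[OF integrable_on_cmult_left[OF iE, of 2] f] by simp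
  then have "(\<lambda>t. norm (?f t)) integrable_on {a..b}"
    by (rule integrable_eq) (auto simp: E_def indicator_def)
  then have "?f absolutely_integrable_on {a..b}"
    using f by (intro absolutely_integrable_onI)
  then show ?thesis by (rule absolutely_integrable_imp_integrable) simp
qed

text \<open>Justifies the definite description in \<open>HD_int\<close>: a witness is the bidual
  element that integrability of \<chi>_E g attaches to the interval {a..b} itself, and a bounded
  functional is determined by its values.\<close>

lemma HD_int_apply:
  fixes g :: "real \<Rightarrow> 'a::banach" and y :: "'a \<Rightarrow>\<^sub>L real"
  assumes "\<forall>E\<in>leb_sets a b. HD_integrable a b (\<lambda>t. indicator E t *\<^sub>R g t)" "E \<in> leb_sets a b"
  shows "blinfun_apply (HD_int a b g E) y = H_int_on a b E (\<lambda>t. blinfun_apply y (g t))"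
proof -
  have "HD_integrable a b (\<lambda>t. indicator E t *\<^sub>R g t)" using assms by blast
  then obtain z :: "('a \<Rightarrow>\<^sub>L real) \<Rightarrow>\<^sub>L real" where z: "\<forall>y. blinfun_apply z y = integral {a..b} (\<lambda>t. blinfun_apply y (indicator E t *\<^sub>R g t))"
    unfolding HD_integrable_def by blast
  have "\<exists>!z. \<forall>y. blinfun_apply z y = H_int_on a b E (\<lambda>t. blinfun_apply y (g t))"
    using z by (intro ex1I[of _ z]) (auto simp: H_int_on_def blinfun.scaleR_right intro!: blinfun_eqI)
  from theI'[OF this] show ?thesis unfolding HD_int_def by blast
qed

text \<open>The error of a partial sum is, up to sign, the integral over the remaining tail of sets.
  Its bidual norm is a supremum over the unit ball, so a tail bound uniform in \<open>K\<close> is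
  convergence in norm.\<close>

lemma HD_countably_additive_if_rel_weakly_compact:
  fixes g :: "real \<Rightarrow> 'a::banach"
  assumes g: "HD_integrable a b g"
    "\<forall>E\<in>leb_sets a b. HD_integrable a b (\<lambda>t. indicator E t *\<^sub>R g t)"
    and N: "N_function \<phi>"
    and comp: "rel_weakly_compact_orlicz a b \<phi>
         {(\<lambda>t. blinfun_apply y (g t)) | y :: 'a \<Rightarrow>\<^sub>L real. norm y \<le> 1}"
  shows "HD_countably_additive a b g"
  unfolding HD_countably_additive_def
proof (intro allI impI)
  let ?M = "lebesgue_on {a..b}"
  fix A :: "nat \<Rightarrow> real set" assume "\<forall>n. A n \<in> leb_sets a b" and disj: "disjoint_family A"
  then have A: "\<And>n. A n \<in> sets ?M" by (simp add: leb_sets_eq_sets)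
  have V: "(\<Union>k\<in>J. A k) \<in> sets ?M" for J
    using A by (intro sets.countable_UN'') auto
  let ?s = "\<lambda>n. (\<Sum>k<n. HD_int a b g (A k)) - HD_int a b g (\<Union>n. A n)"
  have s_apply: "blinfun_apply (?s n) y = - H_int_on a b (\<Union>k\<in>{n..}. A k) (\<lambda>t. blinfun_apply y (g t))" for n y
  proof -
    let ?f = "\<lambda>t. blinfun_apply y (g t)"
    have f: "integrable ?M ?f" by (rule HD_integrable_imp_integrable[OF g])
    have dis: "indicator (\<Union>n. A n) x = (\<Sum>k<n. indicator (A k) x) + (indicator (\<Union>k\<in>{n..}. A k) x :: real)" for x
    proof -
      have "(\<Union>n. A n) = (\<Union>k<n. A k) \<union> (\<Union>k\<in>{n..}. A k)"
        unfolding UN_Un[symmetric] by (rule arg_cong[where f="\<lambda>J. \<Union>(A ` J)"]) auto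
      moreover have "(\<Union>k<n. A k) \<inter> (\<Union>k\<in>{n..}. A k) = {}"
        by (rule disjoint_family_UN_disjoint[OF disj]) auto
      moreover have "(indicator (\<Union>k<n. A k) x :: real) = (\<Sum>k<n. indicator (A k) x)"
        by (rule indicator_UN_disjoint) (use disj in \<open>auto simp: disjoint_family_on_def\<close>)
      ultimately show ?thesis by (simp add: indicator_disj_union)
    qed
    have LINT_sum: "(LINT x|?M. (\<Sum>k<n. F k x) + G x) = (\<Sum>k<n. LINT x|?M. F k x) + (LINT x|?M. G x)"
      if "\<And>k. integrable ?M (F k)" "integrable ?M G" for F :: "nat \<Rightarrow> real \<Rightarrow> real" and G :: "real \<Rightarrow> real"
      by (simp add: that)
    have "H_int_on a b (\<Union>n. A n) ?f = (LINT x|?M. (\<Sum>k<n. indicator (A k) x * ?f x) + indicator (\<Union>k\<in>{n..}. A k) x * ?f x)"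
      unfolding H_int_on_eq_LINT[OF f V[of UNIV]] dis by (simp add: distrib_right sum_distrib_right)
    also have "\<dots> = (\<Sum>k<n. H_int_on a b (A k) ?f) + H_int_on a b (\<Union>k\<in>{n..}. A k) ?f"
      unfolding H_int_on_eq_LINT[OF f A] H_int_on_eq_LINT[OF f V]
      by (rule LINT_sum) (intro integrable_indicator_mult f A V)+
    finally show ?thesis
      using A V[of UNIV] by (simp add: blinfun.diff_left blinfun.sum_left HD_int_apply[OF g(2)] leb_sets_eq_sets)
  qed
  have "?s \<longlonglongrightarrow> 0"
  proof (rule LIMSEQ_I)
    fix r :: real assume r: "0 < r"
    then have "r / 2 > 0" by simp
    from rel_weakly_compact_orlicz_uniform_tail[OF N comp A disj this] obtain n0 where
      n0: "\<And>n y. n \<ge> n0 \<Longrightarrow> norm y \<le> 1 \<Longrightarrow> \<bar>H_int_on a b (\<Union>k\<in>{n..}. A k) (\<lambda>t. blinfun_apply y (g t))\<bar> \<le> r / 2"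
      by blast
    have "norm (?s n) \<le> r / 2" if n: "n \<ge> n0" for n
    proof (rule norm_blinfun_bound)
      fix y :: "'a \<Rightarrow>\<^sub>L real"
      show "norm (blinfun_apply (?s n) y) \<le> r / 2 * norm y"
      proof (cases "y = 0")
        case False
        define u where "u = (1 / norm y) *\<^sub>R y"
        have u: "norm u \<le> 1" "y = norm y *\<^sub>R u" using False by (auto simp: u_def)
        have "norm (blinfun_apply (?s n) u) \<le> r / 2"
          unfolding s_apply using n0[OF n u(1)] by simp
        from mult_left_mono[OF this norm_ge_zero[of y]]
        have "norm (blinfun_apply (?s n) (norm y *\<^sub>R u)) \<le> r / 2 * norm y"
          by (simp only: blinfun.scaleR_right norm_scaleR abs_norm_cancel mult.commute)
        then show ?thesis using u(2) by simp
      qed (simp add: blinfun.zero_right)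
    qed (use r in simp)
    then show "\<exists>no. \<forall>n\<ge>no. norm (?s n - 0) < r"
      using r by (intro exI[of _ n0]) fastforce
  qed
  then show "(\<lambda>n. HD_int a b g (A n)) sums HD_int a b g (\<Union>n. A n)"
    unfolding sums_def using Lim_null by blast
qed

section \<open>Countable additivity implies equi-integrability\<close>

text \<open>Otherwise there are sets of measure below 2^-n with integrals above \<open>e\<close>.
  Once they are made disjoint, countable additivity yields a convergent series in the bidual, whose
  terms must tend to 0, although functionals of the unit ball keep their norms above e/2.\<close>

lemma HD_countably_additive_abs_continuous:
  fixes g :: "real \<Rightarrow> 'a::banach" and e :: real
  assumes g: "HD_integrable a b g"
    "\<forall>E\<in>leb_sets a b. HD_integrable a b (\<lambda>t. indicator E t *\<^sub>R g t)"
    and ca: "HD_countably_additive a b g" and e: "e > 0"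
  shows "\<exists>d>0. \<forall>E\<in>sets (lebesgue_on {a..b}). measure (lebesgue_on {a..b}) E < d \<longrightarrow>
    (\<forall>y :: 'a \<Rightarrow>\<^sub>L real. norm y \<le> 1 \<longrightarrow> \<bar>LINT t|lebesgue_on {a..b}. indicator E t * blinfun_apply y (g t)\<bar> \<le> e)"
proof (rule ccontr)
  let ?M = "lebesgue_on {a..b}"
  interpret finite_measure ?M by (rule finite_measure_lebesgue_on_ivl)
  define \<nu> where "\<nu> y E = (LINT t|?M. indicator E t * blinfun_apply y (g t))" for y :: "'a \<Rightarrow>\<^sub>L real" and E
  assume "\<not> ?thesis"
  then have "\<forall>d>0. \<exists>E\<in>sets ?M. measure ?M E < d \<and> (\<exists>y. norm y \<le> 1 \<and> \<bar>\<nu> y E\<bar> > e)"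
    unfolding \<nu>_def by (meson not_le)
  then have "\<exists>E y. E \<in> sets ?M \<and> measure ?M E < (1/2)^n \<and> norm y \<le> 1 \<and> \<bar>\<nu> y E\<bar> > e" for n
    by (meson zero_less_divide_1_iff zero_less_numeral zero_less_power)
  then obtain E y where E: "\<And>n. E n \<in> sets ?M" "\<And>n. measure ?M (E n) < (1/2)^n"
    and y: "\<And>n. norm (y n) \<le> 1" "\<And>n. \<bar>\<nu> (y n) (E n)\<bar> > e"
    by metis
  \<comment> \<open>Removing a late tail \<open>F m\<close> from \<open>E n\<close> makes the sets disjoint and, for the fixed functional
    \<open>y n\<close>, hardly changes the integral.\<close>
  define F where "F n = (\<Union>k\<in>{n..}. E k)" for n
  have F: "F n \<in> sets ?M" for n
    unfolding F_def using E(1) by (intro sets.countable_UN'') auto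
  have decF: "decseq F" unfolding decseq_def F_def by (intro allI impI UN_mono) auto
  \<comment> \<open>The measures are summable, so by Borel--Cantelli the tails \<open>F n\<close>
    decrease to a null set and their integrals vanish for each fixed functional.\<close>
  have "limsup E \<in> null_sets ?M"
  proof (rule borel_cantelli_limsup1[OF E(1)])
    show "summable (\<lambda>n. measure ?M (E n))"
      by (rule summable_comparison_test'[of "\<lambda>n. (1/2)^n" 0]) (use E(2) in \<open>auto intro: less_imp_le\<close>)
  qed (simp add: less_top[symmetric])
  then have nullF: "emeasure ?M (\<Inter>n. F n) = 0"
    unfolding limsup_INF_SUP F_def by auto
  have f: "integrable ?M (\<lambda>t. blinfun_apply y (g t))" for y :: "'a \<Rightarrow>\<^sub>L real"
    by (rule HD_integrable_imp_integrable[OF g])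
  have "\<exists>m>n. \<bar>\<nu> (y n) (E n - F m)\<bar> > e / 2" for n
  proof -
    have "(\<lambda>m. LINT t|?M. indicator (F m) t * \<bar>blinfun_apply (y n) (g t)\<bar>) \<longlonglongrightarrow> 0"
      by (rule integral_indicator_decseq_tendsto_0) (use f F decF nullF in auto)
    from LIMSEQ_D[OF this half_gt_zero[OF e]] obtain m0 where
      m0: "\<And>m. m \<ge> m0 \<Longrightarrow> \<bar>LINT t|?M. indicator (F m) t * \<bar>blinfun_apply (y n) (g t)\<bar>\<bar> < e / 2"
      by auto
    define m where "m = max m0 (Suc n)"
    have m: "m > n" "m \<ge> m0" by (auto simp: m_def)
    let ?f = "\<lambda>t. blinfun_apply (y n) (g t)"
    have sp: "\<nu> (y n) (E n) = \<nu> (y n) (E n - F m) + \<nu> (y n) (E n \<inter> F m)"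
      unfolding \<nu>_def
    proof (subst Bochner_Integration.integral_add[symmetric])
      show "integrable ?M (\<lambda>t. indicator (E n - F m) t * ?f t)"
        by (rule integrable_indicator_mult) (use f E F in auto)
      show "integrable ?M (\<lambda>t. indicator (E n \<inter> F m) t * ?f t)"
        by (rule integrable_indicator_mult) (use f E F in auto)
    qed (auto intro!: Bochner_Integration.integral_cong simp: indicator_def)
    have "\<bar>\<nu> (y n) (E n \<inter> F m)\<bar> \<le> (LINT t|?M. \<bar>indicator (E n \<inter> F m) t * ?f t\<bar>)"
      unfolding \<nu>_def by (rule integral_abs_bound)
    also have "\<dots> \<le> (LINT t|?M. indicator (F m) t * \<bar>?f t\<bar>)"
    proof (rule integral_mono)
      show "integrable ?M (\<lambda>t. \<bar>indicator (E n \<inter> F m) t * ?f t\<bar>)"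
        by (intro integrable_abs integrable_indicator_mult) (use f E F in auto)
      show "integrable ?M (\<lambda>t. indicator (F m) t * \<bar>?f t\<bar>)"
        by (intro integrable_indicator_mult integrable_abs) (use f E F in auto)
    qed (auto simp: indicator_def)
    also have "\<dots> < e / 2" using m0[OF m(2)] by linarith
    finally have "\<bar>\<nu> (y n) (E n \<inter> F m)\<bar> < e / 2" .
    then have "\<bar>\<nu> (y n) (E n - F m)\<bar> > e / 2" using sp y(2)[of n] by linarith
    with m show ?thesis by blast
  qed
  then obtain nx where nx: "\<And>n. nx n > n" "\<And>n. \<bar>\<nu> (y n) (E n - F (nx n))\<bar> > e / 2" by metis
  \<comment> \<open>Iterating \<open>nx\<close> makes the tail removed from \<open>E (N i)\<close>
    start at \<open>N (Suc i)\<close>, so it contains every later \<open>E (N l)\<close>; this is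
    the disjointness.\<close>
  define N where "N i = (nx ^^ i) 0" for i
  have NS: "N (Suc i) = nx (N i)" for i by (simp add: N_def)
  then have "strict_mono N" using nx(1) by (simp add: strict_mono_Suc_iff)
  then have monoN: "N i \<le> N l" if "i \<le> l" for i l using that by (simp add: strict_mono_less_eq)
  define D where "D i = E (N i) - F (N (Suc i))" for i
  have D: "D i \<in> sets ?M" for i unfolding D_def using E F by auto
  have D0: "D i \<inter> D l = {}" if "i < l" for i l
  proof -
    have "E (N l) \<subseteq> F (N (Suc i))" unfolding F_def using monoN[of "Suc i" l] that by auto
    then show ?thesis unfolding D_def by auto
  qed
  have "disjoint_family D"
    unfolding disjoint_family_on_def
  proof (intro ballI impI)
    fix i l :: nat assume "i \<noteq> l"
    then show "D i \<inter> D l = {}" using D0[of i l] D0[of l i] by (cases "i < l") auto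
  qed
  then have "summable (\<lambda>i. HD_int a b g (D i))"
    using ca D unfolding HD_countably_additive_def leb_sets_eq_sets by (blast intro: sums_summable)
  then have "(\<lambda>i. HD_int a b g (D i)) \<longlonglongrightarrow> 0" by (rule summable_LIMSEQ_zero)
  from LIMSEQ_D[OF this half_gt_zero[OF e]] obtain i where i: "norm (HD_int a b g (D i)) < e / 2" by auto
  have "\<nu> (y (N i)) (D i) = blinfun_apply (HD_int a b g (D i)) (y (N i))"
    using D[of i] by (simp add: HD_int_apply[OF g(2)] leb_sets_eq_sets H_int_on_eq_LINT[OF f] \<nu>_def)
  then have "\<bar>\<nu> (y (N i)) (D i)\<bar> \<le> norm (HD_int a b g (D i)) * norm (y (N i))"
    using norm_blinfun[of "HD_int a b g (D i)" "y (N i)"] by simp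
  also have "\<dots> \<le> norm (HD_int a b g (D i))"
    using y(1)[of "N i"] by (simp add: mult_left_le)
  finally show False using i nx(2)[of "N i"] by (simp add: D_def NS)
qed

text \<open>The parts of \<open>E\<close> where the function is nonnegative or negative are
  themselves sets of small measure; each contributes at most \<open>e\<close>, whence the factor
  2.\<close>

lemma abs_continuous_imp_abs_integral_small:
  fixes f :: "'b \<Rightarrow> 'a \<Rightarrow> real"
  assumes int: "\<And>i. i \<in> I \<Longrightarrow> integrable M (f i)" and M: "finite_measure M"
    and small: "\<forall>E\<in>sets M. measure M E < d \<longrightarrow> (\<forall>i\<in>I. \<bar>LINT t|M. indicator E t * f i t\<bar> \<le> e)"
    and E: "E \<in> sets M" "measure M E < d" and i: "i \<in> I"
  shows "(LINT t|M. indicator E t * \<bar>f i t\<bar>) \<le> 2 * e"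
proof -
  interpret finite_measure M by fact
  have [measurable]: "f i \<in> borel_measurable M" using int[OF i] by auto
  define P where "P = E \<inter> {t\<in>space M. f i t \<ge> 0}"
  define Q where "Q = E \<inter> {t\<in>space M. f i t < 0}"
  have PQ: "P \<in> sets M" "Q \<in> sets M" unfolding P_def Q_def using E(1) by measurable
  have "measure M P \<le> measure M E" "measure M Q \<le> measure M E"
    using E(1) by (auto intro!: finite_measure_mono simp: P_def Q_def)
  then have b: "\<bar>LINT t|M. indicator P t * f i t\<bar> \<le> e" "\<bar>LINT t|M. indicator Q t * f i t\<bar> \<le> e"
    using small PQ E(2) i by auto
  have "(LINT t|M. indicator E t * \<bar>f i t\<bar>) = (LINT t|M. indicator P t * f i t - indicator Q t * f i t)"
    by (rule Bochner_Integration.integral_cong) (auto simp: P_def Q_def indicator_def)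
  also have "\<dots> = (LINT t|M. indicator P t * f i t) - (LINT t|M. indicator Q t * f i t)"
    by (rule Bochner_Integration.integral_diff) (intro integrable_indicator_mult int[OF i] PQ)+
  finally show ?thesis using b by linarith
qed

text \<open>Lebesgue measure has no atoms: finitely many intervals of length d/2 cover [a,b], and
  each contributes at most 1. Shared endpoints do no harm to an upper bound.\<close>

lemma equi_integrable_imp_L1_bounded:
  fixes K :: "(real \<Rightarrow> real) set"
  assumes int: "\<And>f. f \<in> K \<Longrightarrow> integrable (lebesgue_on {a..b}) f"
    and d: "d > 0"
    and small: "\<And>E f. E \<in> sets (lebesgue_on {a..b}) \<Longrightarrow> measure (lebesgue_on {a..b}) E < d \<Longrightarrow> f \<in> K \<Longrightarrow>
        (LINT t|lebesgue_on {a..b}. indicator E t * \<bar>f t\<bar>) \<le> 1"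
  shows "\<exists>R. \<forall>f\<in>K. (LINT t|lebesgue_on {a..b}. \<bar>f t\<bar>) \<le> R"
proof -
  let ?M = "lebesgue_on {a..b}"
  define h where "h = d / 2"
  have h: "h > 0" "h < d" using d by (auto simp: h_def)
  define n where "n = nat \<lfloor>(b - a) / h\<rfloor>"
  define P where "P k = {a + real k * h .. a + real (Suc k) * h} \<inter> {a..b}" for k
  have P: "P k \<in> sets ?M" for k
    unfolding P_def by (subst sets_restrict_space_iff) auto
  have mP: "measure ?M (P k) < d" for k
  proof -
    have "measure ?M (P k) = measure lebesgue (P k)"
      by (rule measure_restrict_space) (auto simp: P_def)
    also have "\<dots> \<le> measure lebesgue {a + real k * h .. a + real (Suc k) * h}"
      by (rule measure_mono_fmeasurable) (auto simp: P_def)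
    also have "\<dots> = h" using h by (simp add: algebra_simps)
    finally show ?thesis using h by simp
  qed
  have cover: "\<exists>k\<le>n. t \<in> P k" if t: "t \<in> {a..b}" for t
  proof -
    define k where "k = nat \<lfloor>(t - a) / h\<rfloor>"
    have nn: "0 \<le> (t - a) / h" using t h by simp
    have kn: "k \<le> n" unfolding k_def n_def using t h by (intro nat_mono floor_mono divide_right_mono) auto
    have "real k = real_of_int \<lfloor>(t - a) / h\<rfloor>" using nn by (simp add: k_def)
    then have "real k \<le> (t - a) / h" "(t - a) / h \<le> real k + 1"
      using floor_correct[of "(t - a) / h"] by auto
    then have "real k * h \<le> t - a" "t - a \<le> (real k + 1) * h"
      using h by (auto simp: field_simps)
    then have "t \<in> P k" using t by (auto simp: P_def algebra_simps)
    with kn show ?thesis by blast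
  qed
  have "(LINT t|?M. \<bar>f t\<bar>) \<le> real (Suc n)" if f: "f \<in> K" for f
  proof -
    have i: "integrable ?M (\<lambda>t. indicator (P k) t * \<bar>f t\<bar>)" for k
      by (intro integrable_indicator_mult integrable_abs int f P)
    have "(LINT t|?M. \<bar>f t\<bar>) \<le> (LINT t|?M. (\<Sum>k\<le>n. indicator (P k) t * \<bar>f t\<bar>))"
    proof (rule integral_mono)
      show "integrable ?M (\<lambda>t. \<Sum>k\<le>n. indicator (P k) t * \<bar>f t\<bar>)"
        by (intro Bochner_Integration.integrable_sum i)
      fix t assume "t \<in> space ?M"
      then obtain k where k: "k \<le> n" "t \<in> P k" using cover by auto
      then have "\<bar>f t\<bar> = indicator (P k) t * \<bar>f t\<bar>" by simp
      also have "\<dots> \<le> (\<Sum>k\<le>n. indicator (P k) t * \<bar>f t\<bar>)"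
        by (rule member_le_sum) (use k in auto)
      finally show "\<bar>f t\<bar> \<le> (\<Sum>k\<le>n. indicator (P k) t * \<bar>f t\<bar>)" .
    qed (use int f in auto)
    also have "\<dots> = (\<Sum>k\<le>n. LINT t|?M. indicator (P k) t * \<bar>f t\<bar>)"
      by (rule Bochner_Integration.integral_sum) (rule i)
    also have "\<dots> \<le> (\<Sum>k\<le>n. 1)"
      by (intro sum_mono small P mP f)
    finally show ?thesis by simp
  qed
  then show ?thesis by blast
qed

text \<open>By Markov's inequality the set where |f| \<ge> T has measure below \<open>d\<close>
  uniformly in \<open>K\<close> once \<open>T\<close> is large, and the excess over \<open>T\<close>
  lives there. Every larger \<open>T\<close> works too, which leaves the freedom to impose the
  growth by squares.\<close>

lemma equi_integrable_thresholds:
  fixes K :: "('a \<Rightarrow> real) set"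
  assumes M: "finite_measure M" and int: "\<And>f. f \<in> K \<Longrightarrow> integrable M f"
    and R: "\<And>f. f \<in> K \<Longrightarrow> (LINT t|M. \<bar>f t\<bar>) \<le> R"
    and equi: "\<And>e. e > 0 \<Longrightarrow> \<exists>d>0. \<forall>E\<in>sets M. measure M E < d \<longrightarrow>
        (\<forall>f\<in>K. (LINT t|M. indicator E t * \<bar>f t\<bar>) \<le> e)"
  obtains T :: "nat \<Rightarrow> real" where "2 \<le> T 0" "\<And>n. (T n)\<^sup>2 \<le> T (Suc n)"
    "\<And>n f. f \<in> K \<Longrightarrow> (LINT t|M. max (\<bar>f t\<bar> - T n) 0) \<le> (1/2) ^ n"
proof -
  interpret finite_measure M by fact
  have "\<exists>\<tau>. \<forall>T\<ge>\<tau>. \<forall>f\<in>K. (LINT t|M. max (\<bar>f t\<bar> - T) 0) \<le> e" if e: "e > 0" for e :: real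
  proof -
    obtain d where d: "d > 0" "\<forall>E\<in>sets M. measure M E < d \<longrightarrow> (\<forall>f\<in>K. (LINT t|M. indicator E t * \<bar>f t\<bar>) \<le> e)"
      using equi[OF e] by blast
    \<comment> \<open>The added 1 makes the bound from Markov's inequality strict and, with the
      absolute value, keeps \<open>\<tau>\<close> positive for every real \<open>R\<close>.\<close>
    define \<tau> where "\<tau> = (\<bar>R\<bar> + 1) / d"
    have "(LINT t|M. max (\<bar>f t\<bar> - T) 0) \<le> e" if T: "T \<ge> \<tau>" and f: "f \<in> K" for T f
    proof -
      have \<tau>: "\<tau> > 0" using d by (simp add: \<tau>_def add_nonneg_pos)
      with T have T0: "T > 0" by simp
      have [measurable]: "f \<in> borel_measurable M" using int[OF f] by auto
      define E where "E = {t\<in>space M. T \<le> \<bar>f t\<bar>}"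
      have E: "E \<in> sets M" unfolding E_def by measurable
      have "measure M E \<le> (LINT t|M. \<bar>f t\<bar>) / T"
        unfolding E_def by (rule integral_Markov_inequality_measure[of _ _ "{}"]) (use int[OF f] T0 in auto)
      also have "\<dots> < d"
      proof -
        have "(LINT t|M. \<bar>f t\<bar>) < \<bar>R\<bar> + 1" using R[OF f] by linarith
        also have "\<dots> = d * \<tau>" using d by (simp add: \<tau>_def)
        also have "\<dots> \<le> d * T" using d T by simp
        finally show ?thesis using T0 by (simp add: field_simps)
      qed
      finally have le: "(LINT t|M. indicator E t * \<bar>f t\<bar>) \<le> e" using d(2) E f by blast
      have "(LINT t|M. max (\<bar>f t\<bar> - T) 0) \<le> (LINT t|M. indicator E t * \<bar>f t\<bar>)"
      proof (rule integral_mono)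
        show "integrable M (\<lambda>t. max (\<bar>f t\<bar> - T) 0)" using int[OF f] by auto
        show "integrable M (\<lambda>t. indicator E t * \<bar>f t\<bar>)"
          by (intro integrable_indicator_mult integrable_abs int f E)
      qed (use T0 in \<open>auto simp: E_def indicator_def\<close>)
      with le show ?thesis by simp
    qed
    then show ?thesis by blast
  qed
  then have "\<forall>n. \<exists>\<tau>. \<forall>T\<ge>\<tau>. \<forall>f\<in>K. (LINT t|M. max (\<bar>f t\<bar> - T) 0) \<le> (1/2) ^ n"
    by simp
  then obtain \<tau> where \<tau>: "\<And>n T f. T \<ge> \<tau> n \<Longrightarrow> f \<in> K \<Longrightarrow> (LINT t|M. max (\<bar>f t\<bar> - T) 0) \<le> (1/2) ^ n"
    by metis
  define T where "T = rec_nat (max 2 (\<tau> 0)) (\<lambda>n x. max (x\<^sup>2) (\<tau> (Suc n)))"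
  have T: "T 0 = max 2 (\<tau> 0)" "\<And>n. T (Suc n) = max ((T n)\<^sup>2) (\<tau> (Suc n))"
    by (simp_all add: T_def)
  have "T n \<ge> \<tau> n" for n by (cases n) (auto simp: T)
  then show ?thesis
    using that[of T] T \<tau> by auto
qed

section \<open>A slowly growing N-function\<close>

text \<open>The summand \<open>min t 1\<close> only serves to make the density positive to the right of 0.\<close>

definition step_density :: "(nat \<Rightarrow> real) \<Rightarrow> real \<Rightarrow> real" where
  "step_density T t = min t 1 + real (card {n. T n \<le> t})"

definition step_N_function :: "(nat \<Rightarrow> real) \<Rightarrow> real \<Rightarrow> real" where
  "step_N_function T u = integral {0..\<bar>u\<bar>} (step_density T)"

text \<open>Starting at 2 turns squaring into at least doubling, so the thresholds tend to infinity
  and only finitely many lie below a given point.\<close>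

locale square_growth =
  fixes T :: "nat \<Rightarrow> real"
  assumes T0: "2 \<le> T 0" and T_square: "\<And>n. (T n)\<^sup>2 \<le> T (Suc n)"
begin

lemma T_ge_2: "2 \<le> T n"
proof (induction n)
  case (Suc n)
  have "2 \<le> (T n) * (T n)" using mult_mono[of 2 "T n" 1 "T n"] Suc by simp
  then show ?case using T_square[of n] by (simp add: power2_eq_square)
qed (rule T0)

lemma T_double: "2 * T n \<le> T (Suc n)"
proof -
  have "2 * T n \<le> T n * T n" using T_ge_2[of n] by (intro mult_right_mono) auto
  then show ?thesis using T_square[of n] by (simp add: power2_eq_square)
qed

lemma T_mono: "n \<le> k \<Longrightarrow> T n \<le> T k"
proof (rule lift_Suc_mono_le[of T])
  show "T n \<le> T (Suc n)" for n using T_double[of n] T_ge_2[of n] by linarith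
qed

lemma T_gt_nat: "real n < T n"
proof (induction n)
  case 0
  then show ?case using T0 by simp
next
  case (Suc n)
  then show ?case using T_double[of n] T_ge_2[of n] by simp
qed

lemma finite_T_le: "finite {n. T n \<le> t}"
proof (rule finite_subset)
  show "{n. T n \<le> t} \<subseteq> {..nat \<lceil>t\<rceil>}"
  proof
    fix n assume "n \<in> {n. T n \<le> t}"
    then have "real n \<le> t" using T_gt_nat[of n] by simp
    then have "int n \<le> \<lceil>t\<rceil>" by linarith
    then show "n \<in> {..nat \<lceil>t\<rceil>}" by simp
  qed
qed simp

lemma mono_on_step_density: "mono_on {0..} (step_density T)"
  unfolding monotone_on_def step_density_def
  by (intro ballI impI add_mono of_nat_mono card_mono finite_T_le) auto

lemma step_density_ge_1: "1 \<le> t \<Longrightarrow> 1 \<le> step_density T t"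
  by (simp add: step_density_def)

lemma N_function_step_N_function: "N_function (step_N_function T)"
  unfolding N_function_def
proof (intro exI[of _ "step_density T"] conjI allI impI)
  show "mono_on {0..} (step_density T)" by (rule mono_on_step_density)
  have "{n. T n \<le> 0} = {}" using T_ge_2 by (auto simp: not_le intro: less_le_trans[OF zero_less_numeral])
  then show "step_density T 0 = 0" by (simp add: step_density_def)
  show "step_density T t > 0" if "t > 0" for t using that by (simp add: step_density_def add_pos_nonneg)
  show "filterlim (step_density T) at_top at_top"
    unfolding filterlim_at_top
  proof
    fix Z :: real
    obtain k :: nat where k: "Z \<le> real k" using real_arch_simple by blast
    have "Z \<le> step_density T t" if t: "t \<ge> T k" for t
    proof -
      have "{..<k} \<subseteq> {n. T n \<le> t}" using T_mono t by (auto intro: order_trans less_imp_le)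
      then have "card {..<k} \<le> card {n. T n \<le> t}" by (intro card_mono finite_T_le)
      then show ?thesis using k t T_ge_2[of k] by (simp add: step_density_def)
    qed
    then show "\<forall>\<^sub>F t in at_top. Z \<le> step_density T t" unfolding eventually_at_top_linorder by blast
  qed
  show "continuous (at_right t) (step_density T)" for t
  proof -
    \<comment> \<open>Just to the right of \<open>t\<close> none of the finitely many thresholds in
      (t, t+1] has been reached, so the count is constant there. The non-strict inequality in the
      count is what makes it continuous from the right.\<close>
    let ?F = "{n. T n \<le> t + 1 \<and> t < T n}"
    have "finite ?F" by (rule finite_subset[OF _ finite_T_le[of "t + 1"]]) auto
    then have "\<forall>\<^sub>F s in at_right t. \<forall>n\<in>?F. s < T n"
      by (rule eventually_ball_finite) (auto intro: eventually_at_right_less order_tendstoD(2)[OF tendsto_ident_at])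
    moreover have "\<forall>\<^sub>F s in at_right t. s < t + 1"
      by (rule order_tendstoD(2)[OF tendsto_ident_at]) simp
    moreover have "\<forall>\<^sub>F s in at_right t. t < s"
      by (simp add: eventually_at_right_less)
    ultimately have ev: "\<forall>\<^sub>F s in at_right t. min s 1 + real (card {n. T n \<le> t}) = step_density T s"
    proof eventually_elim
      case (elim s)
      have "T n \<le> s \<longleftrightarrow> T n \<le> t" for n
        using elim by (cases "n \<in> ?F") auto
      then show ?case by (simp add: step_density_def)
    qed
    have "((\<lambda>s. min s 1 + real (card {n. T n \<le> t})) \<longlongrightarrow> min t 1 + real (card {n. T n \<le> t})) (at_right t)"
      by (intro tendsto_intros)
    then show ?thesis
      unfolding continuous_within step_density_def[of T t] by (rule Lim_transform_eventually[OF _ ev])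
  qed
qed (simp add: step_N_function_def)

text \<open>If T (k+2) \<le> x y \<le> y^2, a square root gives T (k+1) \<le> y and the doubling
  gives T k \<le> y / 2: the count grows by at most two. The factor 3 absorbs this 2, as the density
  is at least 1 from 1 on. Half arguments appear because \<open>\<phi>\<close> at \<open>x\<close>
  is bounded below by its density at x/2.\<close>

lemma step_density_mult_le:
  assumes "2 \<le> x" "x \<le> y"
  shows "step_density T (x * y) \<le> 3 * step_density T (x / 2) * step_density T (y / 2)"
proof -
  have sub: "{n. T n \<le> x * y} \<subseteq> {0, 1} \<union> (\<lambda>n. n + 2) ` {n. T n \<le> y / 2}"
  proof
    fix n assume n: "n \<in> {n. T n \<le> x * y}"
    show "n \<in> {0, 1} \<union> (\<lambda>n. n + 2) ` {n. T n \<le> y / 2}"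
    proof (cases "n < 2")
      case False
      then obtain k where k: "n = Suc (Suc k)" by (metis add_2_eq_Suc le_add_diff_inverse not_less)
      have "(T (Suc k))\<^sup>2 \<le> x * y" using T_square[of "Suc k"] n k by simp
      also have "\<dots> \<le> y\<^sup>2" using assms by (simp add: power2_eq_square mult_right_mono)
      finally have "T (Suc k) \<le> y" by (rule power2_le_imp_le) (use assms in simp)
      then have "T k \<le> y / 2" using T_double[of k] by simp
      then show ?thesis using k by (auto simp: image_iff)
    qed auto
  qed
  have "card {n. T n \<le> x * y} \<le> card ({0, 1} \<union> (\<lambda>n. n + 2) ` {n. T n \<le> y / 2})"
    by (rule card_mono[OF _ sub]) (intro finite_UnI finite_imageI finite_T_le finite.intros)
  also have "\<dots> \<le> card {0, 1::nat} + card ((\<lambda>n. n + 2) ` {n. T n \<le> y / 2})" by (rule card_Un_le)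
  also have "\<dots> \<le> 2 + card {n. T n \<le> y / 2}" using card_image_le[OF finite_T_le[of "y / 2"], of "\<lambda>n. n + 2"] by simp
  finally have "real (card {n. T n \<le> x * y}) \<le> 2 + real (card {n. T n \<le> y / 2})" by linarith
  then have "step_density T (x * y) \<le> 2 + step_density T (y / 2)"
    using assms by (simp add: step_density_def)
  also have "\<dots> \<le> 3 * step_density T (y / 2)" using step_density_ge_1[of "y / 2"] assms by simp
  also have "\<dots> \<le> 3 * (step_density T (x / 2) * step_density T (y / 2))"
    using step_density_ge_1[of "y / 2"] step_density_ge_1[of "x / 2"] assms
      mult_right_mono[of 1 "step_density T (x / 2)" "step_density T (y / 2)"] by simp
  finally show ?thesis by (simp add: mult.assoc)
qed

text \<open>From above \<phi>(xy) \<le> xy m(xy), and from below \<phi>(x) \<ge> (x/2) m(x/2) by the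
  slope on [x/2, x]. The 3 of the density estimate and the two halves multiply to 12.\<close>

lemma Delta'_cond_step_N_function: "Delta'_cond (step_N_function T)"
proof -
  let ?\<phi> = "step_N_function T" and ?m = "step_density T"
  have lower: "x / 2 * ?m (x / 2) \<le> ?\<phi> x" if "2 \<le> x" for x
  proof -
    have "(x - x/2) * ?m (x/2) \<le> ?\<phi> x - ?\<phi> (x/2)"
      using integral_mono_on_increment(1)[OF mono_on_step_density, of "x/2" x] that
      by (simp add: step_N_function_def)
    then show ?thesis using N_function_nonneg[OF N_function_step_N_function, of "x/2"] by simp
  qed
  have *: "?\<phi> (x * y) \<le> 12 * ?\<phi> x * ?\<phi> y" if xy: "2 \<le> x" "x \<le> y" for x y
  proof -
    have xy0: "0 \<le> x * y" using xy by simp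
    have "?\<phi> (x * y) \<le> x * y * ?m (x * y)"
      using integral_mono_on_increment(2)[OF mono_on_step_density, of 0 "x * y"] xy0
      by (simp add: step_N_function_def)
    also have "\<dots> \<le> x * y * (3 * ?m (x / 2) * ?m (y / 2))"
      by (rule mult_left_mono[OF step_density_mult_le[OF xy] xy0])
    also have "\<dots> = 12 * ((x / 2 * ?m (x / 2)) * (y / 2 * ?m (y / 2)))" by simp
    also have "\<dots> \<le> 12 * (?\<phi> x * ?\<phi> y)"
      using lower[of x] lower[of y] xy step_density_ge_1[of "x/2"] step_density_ge_1[of "y/2"]
      by (intro mult_left_mono mult_mono N_function_nonneg[OF N_function_step_N_function]) auto
    finally show ?thesis by simp
  qed
  have "?\<phi> (x * y) \<le> 12 * ?\<phi> x * ?\<phi> y" if xy: "2 \<le> x" "2 \<le> y" for x y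
    using *[of x y] *[of y x] xy by (cases "x \<le> y") (auto simp: mult_ac)
  then show ?thesis
    unfolding Delta'_cond_def by (intro exI[of _ 12] exI[of _ 2] conjI) auto
qed

text \<open>Integrating the jump at \<open>T n\<close> produces the ramp (|u| - T n)^+, the very
  quantity whose integral is bounded on the class; the part \<open>min t 1\<close> contributes at
  most |u|.\<close>

lemma step_N_function_le:
  assumes "\<bar>u\<bar> < T K"
  shows "step_N_function T u \<le> \<bar>u\<bar> + (\<Sum>n<K. max (\<bar>u\<bar> - T n) 0)"
proof -
  let ?I = "\<lambda>n t. if t \<in> {T n..\<bar>u\<bar>} then 1 else (0::real)"
  have I: "(?I n has_integral max (\<bar>u\<bar> - T n) 0) {0..\<bar>u\<bar>}" for n
  proof -
    have "((\<lambda>_. 1::real) has_integral max (\<bar>u\<bar> - T n) 0) {T n..\<bar>u\<bar>}"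
      using has_integral_const_real[of "1::real" "T n" "\<bar>u\<bar>"] by (cases "T n \<le> \<bar>u\<bar>") auto
    then show ?thesis
      by (subst has_integral_restrict) (use T_ge_2[of n] in auto)
  qed
  have "((\<lambda>t. 1 + (\<Sum>n<K. ?I n t)) has_integral \<bar>u\<bar> + (\<Sum>n<K. max (\<bar>u\<bar> - T n) 0)) {0..\<bar>u\<bar>}"
  proof (rule has_integral_add)
    show "((\<lambda>t. 1) has_integral \<bar>u\<bar>) {0..\<bar>u\<bar>}"
      using has_integral_const_real[of "1::real" 0 "\<bar>u\<bar>"] by simp
  qed (rule has_integral_sum, simp, rule I)
  moreover have "step_density T integrable_on {0..\<bar>u\<bar>}"
    by (rule integrable_on_mono_on) (use mono_on_step_density in \<open>auto simp: monotone_on_def\<close>)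
  moreover have "step_density T t \<le> 1 + (\<Sum>n<K. ?I n t)" if t: "t \<in> {0..\<bar>u\<bar>}" for t
  proof -
    have "{n. T n \<le> t} = {n. n < K \<and> T n \<le> t}"
      using T_mono assms t by (auto simp: not_less) (meson atLeastAtMost_iff leD le_less_trans not_le order_trans)
    then have "card {n. T n \<le> t} = card ({..<K} \<inter> {n. T n \<le> t})" by (auto intro: arg_cong[of _ _ card])
    also have "real \<dots> = (\<Sum>n<K. if T n \<le> t then 1 else 0)" by (simp add: sum.If_cases)
    also have "\<dots> = (\<Sum>n<K. ?I n t)" using t by (intro sum.cong) auto
    finally show ?thesis by (simp add: step_density_def)
  qed
  ultimately show ?thesis
    unfolding step_N_function_def by (intro has_integral_le[OF integrable_integral]) auto
qed

text \<open>For c \<le> T k one has c T (n+k) \<le> T (n+k)^2 \<le> T (n+k+1), so the ramp of c u at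
  index n+k+1 is at most c times the ramp of u at n+k. The first k+1 ramps are each at most |c u|
  and join the linear term, giving k+2. The series is in \<open>ennreal\<close> so that it can be
  integrated termwise.\<close>

lemma step_N_function_scaled_le:
  assumes c: "0 \<le> c" "c \<le> T k"
  shows "ennreal (step_N_function T (c * u)) \<le>
    ennreal (c * (real k + 2) * \<bar>u\<bar>) + (\<Sum>n. ennreal (c * max (\<bar>u\<bar> - T (n + k)) 0))"
proof -
  obtain K0 :: nat where K0: "\<bar>c * u\<bar> < real K0" using reals_Archimedean2 by blast
  define K where "K = K0 + Suc k"
  have "T K0 \<le> T K" by (rule T_mono) (simp add: K_def)
  then have "\<bar>c * u\<bar> < T K" using K0 T_gt_nat[of K0] by linarith
  from step_N_function_le[OF this]
  have "step_N_function T (c * u) \<le> \<bar>c * u\<bar> + (\<Sum>n<K. max (\<bar>c * u\<bar> - T n) 0)" .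
  also have "(\<Sum>n<K. max (\<bar>c * u\<bar> - T n) 0) = (\<Sum>n<Suc k. max (\<bar>c * u\<bar> - T n) 0) + (\<Sum>n<K0. max (\<bar>c * u\<bar> - T (n + Suc k)) 0)"
    unfolding K_def by (induction K0) (simp_all add: add_ac)
  also have "(\<Sum>n<Suc k. max (\<bar>c * u\<bar> - T n) 0) \<le> (\<Sum>n<Suc k. \<bar>c * u\<bar>)"
    by (rule sum_mono) (use T_ge_2 in \<open>auto intro: order_trans[OF _ T_ge_2]\<close>)
  also have "(\<Sum>n<K0. max (\<bar>c * u\<bar> - T (n + Suc k)) 0) \<le> (\<Sum>n<K0. c * max (\<bar>u\<bar> - T (n + k)) 0)"
  proof (rule sum_mono)
    fix n
    have "c * T (n + k) \<le> T (n + k) * T (n + k)"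
      using c T_mono[of k "n + k"] T_ge_2[of "n + k"] by (intro mult_right_mono) auto
    also have "\<dots> \<le> T (n + Suc k)" using T_square[of "n + k"] by (simp add: power2_eq_square)
    finally have "\<bar>c * u\<bar> - T (n + Suc k) \<le> c * (\<bar>u\<bar> - T (n + k))"
      using c by (simp add: abs_mult algebra_simps)
    also have "\<dots> \<le> c * max (\<bar>u\<bar> - T (n + k)) 0" using c by (intro mult_left_mono) auto
    finally show "max (\<bar>c * u\<bar> - T (n + Suc k)) 0 \<le> c * max (\<bar>u\<bar> - T (n + k)) 0"
      using c by simp
  qed
  finally have "step_N_function T (c * u) \<le> c * (real k + 2) * \<bar>u\<bar> + (\<Sum>n<K0. c * max (\<bar>u\<bar> - T (n + k)) 0)"
    using c by (simp add: abs_mult algebra_simps)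
  then have "ennreal (step_N_function T (c * u)) \<le> ennreal (c * (real k + 2) * \<bar>u\<bar> + (\<Sum>n<K0. c * max (\<bar>u\<bar> - T (n + k)) 0))"
    by (rule ennreal_leI)
  also have "\<dots> = ennreal (c * (real k + 2) * \<bar>u\<bar>) + (\<Sum>n<K0. ennreal (c * max (\<bar>u\<bar> - T (n + k)) 0))"
    using c by (subst ennreal_plus) (auto intro!: sum_nonneg simp: sum_ennreal)
  also have "\<dots> \<le> ennreal (c * (real k + 2) * \<bar>u\<bar>) + (\<Sum>n. ennreal (c * max (\<bar>u\<bar> - T (n + k)) 0))"
    by (intro add_left_mono sum_le_suminf) auto
  finally show ?thesis .
qed

end

section \<open>Functionals on Orlicz spaces\<close>

lemma orlicz_dual_bound:
  assumes N: "N_function \<phi>" and L: "L \<in> orlicz_dual a b \<phi>"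
  obtains C where "C > 0" "\<And>f r. f \<in> orlicz_space a b \<phi> \<Longrightarrow> orlicz_norm a b \<phi> f \<le> r \<Longrightarrow> \<bar>L f\<bar> \<le> C * r"
proof -
  obtain C where C: "\<And>f. f \<in> orlicz_space a b \<phi> \<Longrightarrow> \<bar>L f\<bar> \<le> C * orlicz_norm a b \<phi> f"
    using L unfolding orlicz_dual_def by blast
  have "\<bar>L f\<bar> \<le> (\<bar>C\<bar> + 1) * r" if f: "f \<in> orlicz_space a b \<phi>" and r: "orlicz_norm a b \<phi> f \<le> r" for f r
  proof -
    have n0: "0 \<le> orlicz_norm a b \<phi> f"
      unfolding orlicz_norm_eq[OF N]
      by (rule cInf_greatest) (use orlicz_space_norm_attained_bound[OF N f] in auto)
    have "\<bar>L f\<bar> \<le> C * orlicz_norm a b \<phi> f" by (rule C[OF f])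
    also have "\<dots> \<le> (\<bar>C\<bar> + 1) * r" using n0 r by (intro mult_mono) auto
    finally show ?thesis .
  qed
  then show ?thesis using that[of "\<bar>C\<bar> + 1"] by (simp add: add_nonneg_pos)
qed

lemma orlicz_dual_add:
  "L \<in> orlicz_dual a b \<phi> \<Longrightarrow> f \<in> orlicz_space a b \<phi> \<Longrightarrow> h \<in> orlicz_space a b \<phi> \<Longrightarrow>
    L (\<lambda>t. f t + h t) = L f + L h"
  unfolding orlicz_dual_def by blast

lemma orlicz_dual_cmult:
  "L \<in> orlicz_dual a b \<phi> \<Longrightarrow> f \<in> orlicz_space a b \<phi> \<Longrightarrow> L (\<lambda>t. c * f t) = c * L f"
  unfolding orlicz_dual_def by blast

lemma indicator_in_orlicz_space:
  assumes "N_function \<phi>" "E \<in> sets (lebesgue_on {a..b})"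
  shows "indicator E \<in> orlicz_space a b \<phi>"
  by (rule bounded_in_orlicz_space[OF assms(1), of _ _ _ 1]) (use assms(2) in \<open>auto simp: indicator_def\<close>)

lemma simple_in_orlicz_space:
  assumes "N_function \<phi>" "\<And>i. E i \<in> sets (lebesgue_on {a..b})"
  shows "(\<lambda>t. \<Sum>i<n. c i * indicator (E i) t) \<in> orlicz_space a b \<phi>"
proof (rule bounded_in_orlicz_space[OF assms(1)])
  show "(\<lambda>t. \<Sum>i<n. c i * indicator (E i) t) \<in> borel_measurable (lebesgue_on {a..b})"
    using assms(2) by measurable
  show "\<bar>\<Sum>i<n. c i * indicator (E i) t\<bar> \<le> (\<Sum>i<n. \<bar>c i\<bar>)" for t
    by (rule order_trans[OF sum_abs]) (auto intro!: sum_mono simp: indicator_def abs_mult)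
qed

lemma orlicz_dual_simple:
  fixes n :: nat
  assumes N: "N_function \<phi>" and L: "L \<in> orlicz_dual a b \<phi>"
    and E: "\<And>i. E i \<in> sets (lebesgue_on {a..b})"
  shows "L (\<lambda>t. \<Sum>i<n. c i * indicator (E i) t) = (\<Sum>i<n. c i * L (indicator (E i)))"
proof (induction n)
  case 0
  have "L (\<lambda>t. 0 * indicator (E 0) t) = 0 * L (indicator (E 0))"
    by (rule orlicz_dual_cmult[OF L indicator_in_orlicz_space[OF N E]])
  then show ?case by simp
next
  case (Suc n)
  have cn: "(\<lambda>t. c n * indicator (E n) t) \<in> orlicz_space a b \<phi>"
    by (rule bounded_in_orlicz_space[OF N, of _ _ _ "\<bar>c n\<bar>"]) (use E in \<open>auto simp: indicator_def\<close>)
  have "L (\<lambda>t. (\<Sum>i<n. c i * indicator (E i) t) + c n * indicator (E n) t)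
      = L (\<lambda>t. \<Sum>i<n. c i * indicator (E i) t) + L (\<lambda>t. c n * indicator (E n) t)"
    by (rule orlicz_dual_add[OF L simple_in_orlicz_space[OF N E] cn])
  also have "L (\<lambda>t. c n * indicator (E n) t) = c n * L (indicator (E n))"
    by (rule orlicz_dual_cmult[OF L indicator_in_orlicz_space[OF N E]])
  finally show ?case by (simp only: Suc sum.lessThan_Suc)
qed

lemma orlicz_norm_indicator_le:
  assumes N: "N_function \<phi>" and E: "E \<in> sets (lebesgue_on {a..b})" and r: "r > 0"
    and le: "\<phi> (1 / r) * measure (lebesgue_on {a..b}) E \<le> 1"
  shows "orlicz_norm a b \<phi> (indicator E) \<le> r"
proof (rule orlicz_norm_le[OF N r])
  interpret finite_measure "lebesgue_on {a..b}" by (rule finite_measure_lebesgue_on_ivl)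
  have eq: "\<phi> (indicator E t / r) = \<phi> (1 / r) * indicator E t" for t
    using N_function_0[OF N] by (simp add: indicator_def)
  show "integrable (lebesgue_on {a..b}) (\<lambda>t. \<phi> (indicator E t / r))"
    unfolding eq using E by (intro integrable_mult_right integrable_real_indicator) (auto simp: less_top[symmetric])
  show "(LINT t|lebesgue_on {a..b}. \<phi> (indicator E t / r)) \<le> 1"
    unfolding eq using le sets.Int_space_eq2[OF E] by simp
qed

lemma N_function_inverse_small:
  assumes N: "N_function \<phi>" and m: "0 \<le> m"
  obtains s where "s > 0" "\<phi> (1 / s) * m \<le> 1"
proof
  \<comment> \<open>For s \<ge> 1 convexity gives \<phi>(1/s) \<le> \<phi>(1)/s, so \<open>s\<close>
    has only to reach \<phi>(1) m as well.\<close>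
  define s where "s = max 1 (\<phi> 1 * m)"
  have s: "1 \<le> s" "\<phi> 1 * m \<le> s" by (auto simp: s_def)
  then show "s > 0" by simp
  have "\<phi> (1 / s) \<le> 1 / s * \<phi> 1" using N_function_scale[OF N, of "1 / s" 1] s by simp
  from mult_right_mono[OF this m] have "\<phi> (1 / s) * m \<le> (\<phi> 1 * m) / s" by simp
  also have "\<dots> \<le> 1" using s by simp
  finally show "\<phi> (1 / s) * m \<le> 1" .
qed

text \<open>\<open>u\<close> is rounded down to a multiple of \<open>\<eta>\<close>. Subtracting
  \<open>int K\<close> lets the natural numbers below 2K index the negative levels too; the 1 in the
  choice of \<open>K\<close> leaves room for the floor.\<close>

lemma bounded_measurable_quantize:
  fixes u :: "'a \<Rightarrow> real"
  assumes u: "u \<in> borel_measurable M" and B: "\<And>t. t \<in> space M \<Longrightarrow> \<bar>u t\<bar> \<le> B" and \<eta>: "\<eta> > 0"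
  shows "\<exists>(n::nat) c E. (\<forall>i. E i \<in> sets M) \<and>
    (\<forall>t\<in>space M. \<bar>u t - (\<Sum>i<n. c i * indicator (E i) t)\<bar> \<le> \<eta>)"
proof -
  obtain K :: nat where K: "B / \<eta> + 1 < real K" using reals_Archimedean2 by blast
  define E where "E i = {t \<in> space M. \<lfloor>u t / \<eta>\<rfloor> = int i - int K}" for i
  define c where "c i = \<eta> * real_of_int (int i - int K)" for i
  have E: "E i \<in> sets M" for i unfolding E_def using u by measurable
  have "\<bar>u t - (\<Sum>i<2 * K. c i * indicator (E i) t)\<bar> \<le> \<eta>" if t: "t \<in> space M" for t
  proof -
    define j where "j = \<lfloor>u t / \<eta>\<rfloor>"
    have "\<bar>u t / \<eta>\<bar> \<le> B / \<eta>" using B[OF t] \<eta> by (simp add: divide_right_mono)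
    then have "- real K < u t / \<eta> - 1" "u t / \<eta> < real K" using K by linarith+
    moreover have j: "of_int j \<le> u t / \<eta>" "u t / \<eta> < of_int j + 1" by (auto simp: j_def)
    ultimately have "- int K \<le> j" "j < int K" by linarith+
    then obtain J where J: "J < 2 * K" "j = int J - int K"
      by (intro that[of "nat (j + int K)"]) auto
    have "(\<Sum>i<2 * K. c i * indicator (E i) t) = (\<Sum>i<2 * K. if i = J then \<eta> * of_int j else 0)"
      by (rule sum.cong) (use t J(2) in \<open>auto simp: c_def E_def j_def[symmetric] indicator_def\<close>)
    also have "\<dots> = \<eta> * of_int j" using J(1) by simp
    finally have eq: "(\<Sum>i<2 * K. c i * indicator (E i) t) = \<eta> * of_int j" .
    have "\<eta> * of_int j \<le> u t" "u t \<le> \<eta> * of_int j + \<eta>"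
      using j \<eta> by (auto simp: field_simps)
    then show ?thesis unfolding eq by linarith
  qed
  with E show ?thesis by blast
qed

lemma LINT_simple_mult:
  fixes h :: "'a \<Rightarrow> real" and n :: nat
  assumes h: "integrable M h" and E: "\<And>i. E i \<in> sets M"
  shows "integrable M (\<lambda>t. (\<Sum>i<n. c i * indicator (E i) t) * h t)"
    "(LINT t|M. (\<Sum>i<n. c i * indicator (E i) t) * h t) = (\<Sum>i<n. c i * (LINT t|M. indicator (E i) t * h t))"
proof -
  have i: "integrable M (\<lambda>t. c i * (indicator (E i) t * h t))" for i
    by (intro integrable_mult_right integrable_indicator_mult h E)
  have eq: "(\<lambda>t. (\<Sum>i<n. c i * indicator (E i) t) * h t) = (\<lambda>t. \<Sum>i<n. c i * (indicator (E i) t * h t))"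
    by (simp only: sum_distrib_right mult.assoc)
  show "integrable M (\<lambda>t. (\<Sum>i<n. c i * indicator (E i) t) * h t)"
    unfolding eq by (intro Bochner_Integration.integrable_sum i)
  show "(LINT t|M. (\<Sum>i<n. c i * indicator (E i) t) * h t) = (\<Sum>i<n. c i * (LINT t|M. indicator (E i) t * h t))"
    unfolding eq by (subst Bochner_Integration.integral_sum[OF i]) (intro sum.cong refl integral_mult_right_zero)
qed

lemma abs_LINT_mult_le:
  fixes u f :: "'a \<Rightarrow> real"
  assumes f: "integrable M f" and u: "u \<in> borel_measurable M" and \<eta>: "\<And>t. t \<in> space M \<Longrightarrow> \<bar>u t\<bar> \<le> \<eta>"
  shows "integrable M (\<lambda>t. u t * f t)" "\<bar>LINT t|M. u t * f t\<bar> \<le> \<eta> * (LINT t|M. \<bar>f t\<bar>)"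
proof -
  have le: "\<bar>u t * f t\<bar> \<le> \<eta> * \<bar>f t\<bar>" if "t \<in> space M" for t
    using \<eta>[OF that] by (simp add: abs_mult mult_right_mono)
  show i: "integrable M (\<lambda>t. u t * f t)"
  proof (rule Bochner_Integration.integrable_bound)
    show "integrable M (\<lambda>t. \<eta> * \<bar>f t\<bar>)" using f by auto
    show "AE t in M. norm (u t * f t) \<le> norm (\<eta> * \<bar>f t\<bar>)"
      using le by (intro AE_I2) (force intro: order_trans[OF _ abs_ge_self])
  qed (use u f in measurable)
  have "\<bar>LINT t|M. u t * f t\<bar> \<le> (LINT t|M. \<bar>u t * f t\<bar>)" by (rule integral_abs_bound)
  also have "\<dots> \<le> (LINT t|M. \<eta> * \<bar>f t\<bar>)"
    by (rule integral_mono) (use i f le in auto)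
  finally show "\<bar>LINT t|M. u t * f t\<bar> \<le> \<eta> * (LINT t|M. \<bar>f t\<bar>)" by simp
qed

text \<open>On indicators \<open>L\<close> is an additive set function, and it is absolutely
  continuous because the norm of an indicator tends to 0 with the measure of its set. The formula
  then extends from simple to bounded \<open>u\<close>, since both sides are continuous under
  uniform approximation on [a,b].\<close>

lemma orlicz_dual_density:
  assumes N: "N_function \<phi>" and L: "L \<in> orlicz_dual a b \<phi>"
  shows "\<exists>h. integrable (lebesgue_on {a..b}) h \<and>
    (\<forall>u B. u \<in> borel_measurable (lebesgue_on {a..b}) \<longrightarrow> (\<forall>t\<in>{a..b}. \<bar>u t\<bar> \<le> B) \<longrightarrow>
        L u = (LINT t|lebesgue_on {a..b}. u t * h t))"
proof -
  let ?M = "lebesgue_on {a..b}"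
  interpret finite_measure ?M by (rule finite_measure_lebesgue_on_ivl)
  obtain C where C: "C > 0" "\<And>f r. f \<in> orlicz_space a b \<phi> \<Longrightarrow> orlicz_norm a b \<phi> f \<le> r \<Longrightarrow> \<bar>L f\<bar> \<le> C * r"
    using orlicz_dual_bound[OF N L] by metis
  obtain s where s: "s > 0" "\<phi> (1 / s) * measure ?M (space ?M) \<le> 1"
    using N_function_inverse_small[OF N, of "measure ?M (space ?M)"] by (metis measure_nonneg)
  have "\<exists>h. integrable ?M h \<and> (\<forall>E\<in>sets ?M. L (indicator E) = (LINT x|?M. indicator E x * h x))"
  proof (rule Radon_Nikodym_additive)
    fix E F assume E: "E \<in> sets ?M" "F \<in> sets ?M" "E \<inter> F = {}"
    have "(indicator (E \<union> F) :: real \<Rightarrow> real) = (\<lambda>t. indicator E t + indicator F t)"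
      using E(3) by (intro ext) (rule indicator_disj_union)
    then show "L (indicator (E \<union> F)) = L (indicator E) + L (indicator F)"
      using orlicz_dual_add[OF L indicator_in_orlicz_space[OF N E(1)] indicator_in_orlicz_space[OF N E(2)]] by simp
  next
    fix E assume E: "E \<in> sets ?M"
    have "\<phi> (1 / s) * measure ?M E \<le> \<phi> (1 / s) * measure ?M (space ?M)"
      by (intro mult_left_mono bounded_measure N_function_nonneg[OF N])
    then have "orlicz_norm a b \<phi> (indicator E) \<le> s"
      using s by (intro orlicz_norm_indicator_le[OF N E]) auto
    from C(2)[OF indicator_in_orlicz_space[OF N E] this] show "L (indicator E) \<le> C * s" by simp
  next
    fix e :: real assume e: "e > 0"
    define r where "r = e / C"
    have r: "r > 0" using e C by (simp add: r_def)
    \<comment> \<open>The norm of the indicator is at most \<open>r\<close> as soon as \<phi>(1/r)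
      times the measure is at most 1; the added 1 avoids division by zero.\<close>
    define d where "d = 1 / (\<phi> (1 / r) + 1)"
    have p: "\<phi> (1 / r) \<ge> 0" by (rule N_function_nonneg[OF N])
    then have d: "d > 0" by (simp add: d_def)
    have "\<bar>L (indicator E)\<bar> \<le> e" if E: "E \<in> sets ?M" "measure ?M E < d" for E
    proof -
      have "\<phi> (1 / r) * measure ?M E \<le> (\<phi> (1 / r) + 1) * d"
        using p E d by (intro mult_mono) auto
      also have "\<dots> = 1" using p by (simp add: d_def)
      finally have "orlicz_norm a b \<phi> (indicator E) \<le> r" by (rule orlicz_norm_indicator_le[OF N E(1) r])
      from C(2)[OF indicator_in_orlicz_space[OF N E(1)] this] show ?thesis using C by (simp add: r_def)
    qed
    then show "\<exists>d>0. \<forall>E\<in>sets ?M. measure ?M E < d \<longrightarrow> \<bar>L (indicator E)\<bar> \<le> e" using d by blast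
  qed
  then obtain h where h: "integrable ?M h" "\<And>E. E \<in> sets ?M \<Longrightarrow> L (indicator E) = (LINT x|?M. indicator E x * h x)"
    by blast
  have "L u = (LINT t|?M. u t * h t)"
    if u: "u \<in> borel_measurable ?M" and B: "\<And>t. t \<in> {a..b} \<Longrightarrow> \<bar>u t\<bar> \<le> B" for u B
  proof -
    have uO: "u \<in> orlicz_space a b \<phi>" by (rule bounded_in_orlicz_space[OF N u B])
    \<comment> \<open>Collects the costs of a uniform error \<open>\<eta>\<close>: at most C \<eta>
      s through \<open>L\<close>, and \<eta> times the L1 norm of \<open>h\<close> through the
      integral.\<close>
    define Z where "Z = C * s + (LINT t|?M. \<bar>h t\<bar>)"
    have Z: "Z > 0" unfolding Z_def using C s by (intro add_pos_nonneg) auto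
    have est: "\<bar>L u - (LINT t|?M. u t * h t)\<bar> \<le> \<eta> * Z" if \<eta>: "\<eta> > 0" for \<eta>
    proof -
      obtain n :: nat and c E where E: "\<And>i. E i \<in> sets ?M"
        and q: "\<And>t. t \<in> space ?M \<Longrightarrow> \<bar>u t - (\<Sum>i<n. c i * indicator (E i) t)\<bar> \<le> \<eta>"
        using bounded_measurable_quantize[OF u _ \<eta>, of B] B unfolding space_lebesgue_on by blast
      define w where "w t = (\<Sum>i<n. c i * indicator (E i) t)" for t
      define v where "v t = u t - w t" for t
      have wm: "w \<in> borel_measurable ?M" unfolding w_def using E by measurable
      have vm: "v \<in> borel_measurable ?M" unfolding v_def using u wm by measurable
      have vb: "\<bar>v t\<bar> \<le> \<eta>" if "t \<in> {a..b}" for t using q[of t] that by (simp add: v_def w_def)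
      have wO: "w \<in> orlicz_space a b \<phi>" unfolding w_def by (rule simple_in_orlicz_space[OF N E])
      have vO: "v \<in> orlicz_space a b \<phi>" by (rule bounded_in_orlicz_space[OF N vm vb])
      have "orlicz_norm a b \<phi> v \<le> \<eta> * s"
        by (rule orlicz_norm_bounded_le[OF N vm _ vb]) (use \<eta> s in auto)
      then have 1: "\<bar>L v\<bar> \<le> C * (\<eta> * s)" by (rule C(2)[OF vO])
      have "L (\<lambda>t. v t + w t) = L v + L w" by (rule orlicz_dual_add[OF L vO wO])
      then have 2: "L u = L v + L w" by (simp add: v_def)
      have "L w = (\<Sum>i<n. c i * L (indicator (E i)))"
        unfolding w_def by (rule orlicz_dual_simple[OF N L E])
      also have "\<dots> = (LINT t|?M. w t * h t)"
        unfolding w_def LINT_simple_mult(2)[OF h(1) E] using h(2)[OF E] by simp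
      finally have 3: "L w = (LINT t|?M. w t * h t)" .
      have 4: "integrable ?M (\<lambda>t. v t * h t)" "\<bar>LINT t|?M. v t * h t\<bar> \<le> \<eta> * (LINT t|?M. \<bar>h t\<bar>)"
        using abs_LINT_mult_le[OF h(1) vm, of \<eta>] vb by auto
      have "integrable ?M (\<lambda>t. w t * h t)" unfolding w_def by (rule LINT_simple_mult(1)[OF h(1) E])
      from Bochner_Integration.integral_add[OF 4(1) this]
      have 5: "(LINT t|?M. u t * h t) = (LINT t|?M. v t * h t) + (LINT t|?M. w t * h t)"
        by (simp add: v_def algebra_simps)
      have "\<bar>L u - (LINT t|?M. u t * h t)\<bar> \<le> C * (\<eta> * s) + \<eta> * (LINT t|?M. \<bar>h t\<bar>)"
        using 1 2 3 4(2) 5 by linarith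
      then show ?thesis by (simp add: Z_def algebra_simps)
    qed
    have "\<bar>L u - (LINT t|?M. u t * h t)\<bar> \<le> e" if "e > 0" for e
      using est[of "e / Z"] that Z by simp
    then have "\<bar>L u - (LINT t|?M. u t * h t)\<bar> \<le> 0"
      using field_le_epsilon[of "\<bar>L u - (LINT t|?M. u t * h t)\<bar>" 0] by simp
    then show ?thesis by simp
  qed
  with h(1) show ?thesis by blast
qed

section \<open>Threshold classes\<close>

definition threshold_class :: "real \<Rightarrow> real \<Rightarrow> (nat \<Rightarrow> real) \<Rightarrow> (real \<Rightarrow> real) set" where
  "threshold_class a b T = {f. integrable (lebesgue_on {a..b}) f \<and>
     (\<forall>n. (LINT t|lebesgue_on {a..b}. max (\<bar>f t\<bar> - T n) 0) \<le> (1/2) ^ n)}"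

lemma threshold_classD:
  assumes "f \<in> threshold_class a b T"
  shows "integrable (lebesgue_on {a..b}) f"
    "(LINT t|lebesgue_on {a..b}. max (\<bar>f t\<bar> - T n) 0) \<le> (1/2) ^ n"
  using assms by (auto simp: threshold_class_def)

context square_growth
begin

text \<open>|f| \<le> T n + (|f| - T n)^+ holds pointwise. As \<open>n\<close> is free, it can be
  chosen to make the second term small before the measure of \<open>E\<close> is restricted.\<close>

lemma threshold_class_L1_on_le:
  assumes f: "f \<in> threshold_class a b T" and E: "E \<in> sets (lebesgue_on {a..b})"
  shows "(LINT t|lebesgue_on {a..b}. indicator E t * \<bar>f t\<bar>) \<le> T n * measure (lebesgue_on {a..b}) E + (1/2) ^ n"
proof -
  let ?M = "lebesgue_on {a..b}"
  interpret finite_measure ?M by (rule finite_measure_lebesgue_on_ivl)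
  note fi = threshold_classD(1)[OF f]
  have i: "integrable ?M (\<lambda>t. T n * indicator E t)"
    using E by (intro integrable_mult_right integrable_real_indicator) (auto simp: less_top[symmetric])
  have i': "integrable ?M (\<lambda>t. max (\<bar>f t\<bar> - T n) 0)" using fi by auto
  have "(LINT t|?M. indicator E t * \<bar>f t\<bar>) \<le> (LINT t|?M. T n * indicator E t + max (\<bar>f t\<bar> - T n) 0)"
  proof (rule integral_mono)
    show "integrable ?M (\<lambda>t. indicator E t * \<bar>f t\<bar>)"
      by (intro integrable_indicator_mult integrable_abs fi E)
    show "integrable ?M (\<lambda>t. T n * indicator E t + max (\<bar>f t\<bar> - T n) 0)"
      by (intro Bochner_Integration.integrable_add i i')
  qed (use T_ge_2[of n] in \<open>auto simp: indicator_def\<close>)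
  also have "\<dots> = T n * measure ?M E + (LINT t|?M. max (\<bar>f t\<bar> - T n) 0)"
    using Bochner_Integration.integral_add[OF i i'] sets.Int_space_eq2[OF E] by simp
  finally show ?thesis using threshold_classD(2)[OF f, of n] by simp
qed

lemma threshold_class_equi_integrable:
  assumes e: "e > 0"
  obtains d where "d > 0" "\<And>E f. E \<in> sets (lebesgue_on {a..b}) \<Longrightarrow> measure (lebesgue_on {a..b}) E < d \<Longrightarrow>
     f \<in> threshold_class a b T \<Longrightarrow> (LINT t|lebesgue_on {a..b}. indicator E t * \<bar>f t\<bar>) \<le> e"
proof -
  obtain n where n: "(1/2::real) ^ n < e / 2" using real_arch_pow_inv[of "e/2" "1/2"] e by auto
  define d where "d = e / (2 * T n)"
  have T: "T n > 0" using T_ge_2[of n] by linarith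
  then have d: "d > 0" using e by (simp add: d_def)
  have "(LINT t|lebesgue_on {a..b}. indicator E t * \<bar>f t\<bar>) \<le> e"
    if E: "E \<in> sets (lebesgue_on {a..b})" "measure (lebesgue_on {a..b}) E < d" and f: "f \<in> threshold_class a b T" for E f
  proof -
    have "T n * measure (lebesgue_on {a..b}) E \<le> T n * d" using E T by (intro mult_left_mono) auto
    also have "\<dots> = e / 2" using T by (simp add: d_def)
    finally show ?thesis using threshold_class_L1_on_le[OF f E(1), of n] n by linarith
  qed
  with d show ?thesis using that by blast
qed

lemma threshold_class_L1_bounded:
  obtains R where "R > 0" "\<And>f. f \<in> threshold_class a b T \<Longrightarrow> (LINT t|lebesgue_on {a..b}. \<bar>f t\<bar>) \<le> R"
proof
  let ?M = "lebesgue_on {a..b}"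
  show "T 0 * measure ?M (space ?M) + 1 > 0" using T0 by (intro add_nonneg_pos mult_nonneg_nonneg) auto
  fix f assume f: "f \<in> threshold_class a b T"
  have "(LINT t|?M. \<bar>f t\<bar>) = (LINT t|?M. indicator (space ?M) t * \<bar>f t\<bar>)"
    by (rule Bochner_Integration.integral_cong) auto
  also have "\<dots> \<le> T 0 * measure ?M (space ?M) + (1/2) ^ 0"
    by (rule threshold_class_L1_on_le[OF f]) simp
  finally show "(LINT t|?M. \<bar>f t\<bar>) \<le> T 0 * measure ?M (space ?M) + 1" by simp
qed

text \<open>Termwise integration of the scaled pointwise bound; the thresholds beyond
  \<open>k\<close> give a geometric series. The two summands are controlled separately: the second
  by enlarging \<open>k\<close>, the first afterwards by making the integral of |f| over
  \<open>E\<close> small.\<close>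

lemma threshold_class_modular_le:
  assumes f: "f \<in> threshold_class a b T" and E: "E \<in> sets (lebesgue_on {a..b})"
    and c: "0 \<le> c" "c \<le> T k"
  defines "I \<equiv> LINT t|lebesgue_on {a..b}. indicator E t * \<bar>f t\<bar>"
  shows "integrable (lebesgue_on {a..b}) (\<lambda>t. step_N_function T (c * (indicator E t * f t)))"
    "(LINT t|lebesgue_on {a..b}. step_N_function T (c * (indicator E t * f t))) \<le> c * (real k + 2) * I + 2 * c * (1/2) ^ k"
proof -
  let ?M = "lebesgue_on {a..b}" and ?\<phi> = "step_N_function T"
  note N = N_function_step_N_function
  note fi = threshold_classD(1)[OF f]
  have [measurable]: "f \<in> borel_measurable ?M" using fi by auto
  have [measurable]: "E \<in> sets ?M" by fact
  have iE: "integrable ?M (\<lambda>t. indicator E t * \<bar>f t\<bar>)"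
    by (intro integrable_indicator_mult integrable_abs fi E)
  have I0: "0 \<le> I" unfolding I_def by (rule Bochner_Integration.integral_nonneg) auto
  have meas: "(\<lambda>t. ?\<phi> (c * (indicator E t * f t))) \<in> borel_measurable ?M"
    by (rule measurable_compose[OF _ N_function_measurable[OF N]]) measurable
  have 1: "(\<integral>\<^sup>+t. ennreal (c * (real k + 2) * \<bar>indicator E t * f t\<bar>) \<partial>?M) = ennreal (c * (real k + 2) * I)"
  proof -
    have "(\<integral>\<^sup>+t. ennreal (c * (real k + 2) * \<bar>indicator E t * f t\<bar>) \<partial>?M) = ennreal (LINT t|?M. c * (real k + 2) * (indicator E t * \<bar>f t\<bar>))"
      using c iE by (subst nn_integral_eq_integral[symmetric]) (auto simp: abs_mult)
    then show ?thesis by (simp add: I_def)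
  qed
  have 2: "(\<integral>\<^sup>+t. ennreal (c * max (\<bar>indicator E t * f t\<bar> - T (n + k)) 0) \<partial>?M) \<le> ennreal (c * (1/2) ^ (n + k))" for n
  proof -
    have "(\<integral>\<^sup>+t. ennreal (c * max (\<bar>indicator E t * f t\<bar> - T (n + k)) 0) \<partial>?M) \<le> (\<integral>\<^sup>+t. ennreal (c * max (\<bar>f t\<bar> - T (n + k)) 0) \<partial>?M)"
      using c T_ge_2[of "n + k"]
      by (intro nn_integral_mono ennreal_leI mult_left_mono) (auto simp: indicator_def)
    also have "\<dots> = ennreal (LINT t|?M. c * max (\<bar>f t\<bar> - T (n + k)) 0)"
      using c fi by (intro nn_integral_eq_integral) auto
    also have "\<dots> \<le> ennreal (c * (1/2) ^ (n + k))"
      using threshold_classD(2)[OF f, of "n + k"] c by (intro ennreal_leI) (simp add: mult_left_mono)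
    finally show ?thesis .
  qed
  have geo: "(\<Sum>n. ennreal (c * (1/2) ^ (n + k))) = ennreal (2 * c * (1/2) ^ k)"
  proof -
    have "(\<lambda>n. (1/2) ^ n) sums (1 / (1 - 1/2 :: real))" by (rule geometric_sums) simp
    then have "(\<lambda>n. (1/2) ^ n) sums (2 :: real)" by simp
    from sums_mult[OF this, of "c * (1/2) ^ k"]
    have "(\<lambda>n. c * (1/2) ^ (n + k)) sums (2 * c * (1/2) ^ k)"
      by (simp add: power_add mult_ac)
    then show ?thesis using c by (intro suminf_ennreal_eq) auto
  qed
  have "(\<integral>\<^sup>+t. ennreal (?\<phi> (c * (indicator E t * f t))) \<partial>?M) \<le>
      (\<integral>\<^sup>+t. ennreal (c * (real k + 2) * \<bar>indicator E t * f t\<bar>) + (\<Sum>n. ennreal (c * max (\<bar>indicator E t * f t\<bar> - T (n + k)) 0)) \<partial>?M)"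
    by (intro nn_integral_mono step_N_function_scaled_le c)
  also have "\<dots> = (\<integral>\<^sup>+t. ennreal (c * (real k + 2) * \<bar>indicator E t * f t\<bar>) \<partial>?M) + (\<Sum>n. \<integral>\<^sup>+t. ennreal (c * max (\<bar>indicator E t * f t\<bar> - T (n + k)) 0) \<partial>?M)"
    by (subst nn_integral_add, measurable, subst nn_integral_suminf, measurable)
  also have "\<dots> \<le> ennreal (c * (real k + 2) * I) + (\<Sum>n. ennreal (c * (1/2) ^ (n + k)))"
    unfolding 1 by (intro add_left_mono suminf_le 2) auto
  also have "\<dots> = ennreal (c * (real k + 2) * I + 2 * c * (1/2) ^ k)"
    unfolding geo using c I0 by (subst ennreal_plus) auto
  finally have le: "(\<integral>\<^sup>+t. ennreal (?\<phi> (c * (indicator E t * f t))) \<partial>?M) \<le> ennreal (c * (real k + 2) * I + 2 * c * (1/2) ^ k)" .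
  then show int: "integrable ?M (\<lambda>t. ?\<phi> (c * (indicator E t * f t)))"
    using meas N_function_nonneg[OF N] by (intro integrableI_nonneg) (auto intro: le_less_trans)
  have "ennreal (LINT t|?M. ?\<phi> (c * (indicator E t * f t))) \<le> ennreal (c * (real k + 2) * I + 2 * c * (1/2) ^ k)"
    using le N_function_nonneg[OF N] by (subst nn_integral_eq_integral[OF int, symmetric]) auto
  then show "(LINT t|?M. ?\<phi> (c * (indicator E t * f t))) \<le> c * (real k + 2) * I + 2 * c * (1/2) ^ k"
    by (rule ennreal_le_iff[THEN iffD1, rotated]) (use c I0 in auto)
qed

lemma threshold_class_subset_orlicz_space: "threshold_class a b T \<subseteq> orlicz_space a b (step_N_function T)"
proof
  let ?M = "lebesgue_on {a..b}"
  fix f assume f: "f \<in> threshold_class a b T"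
  have "integrable ?M (\<lambda>t. step_N_function T (1 * (indicator (space ?M) t * f t)))"
    by (rule threshold_class_modular_le(1)[OF f _ _ order_trans[OF _ T0]]) auto
  also have "?this \<longleftrightarrow> integrable ?M (\<lambda>t. step_N_function T (f t / 1))"
    by (rule Bochner_Integration.integrable_cong) auto
  finally show "f \<in> orlicz_space a b (step_N_function T)"
    using threshold_classD(1)[OF f] unfolding orlicz_space_iff[OF N_function_step_N_function]
    by (auto intro!: exI[of _ 1])
qed

lemma threshold_class_norm_bounded:
  obtains B where "\<And>f. f \<in> threshold_class a b T \<Longrightarrow> orlicz_norm a b (step_N_function T) f \<le> B"
proof -
  let ?M = "lebesgue_on {a..b}"
  obtain R where R: "R > 0" "\<And>f. f \<in> threshold_class a b T \<Longrightarrow> (LINT t|?M. \<bar>f t\<bar>) \<le> R"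
    using threshold_class_L1_bounded[of a b] by metis
  \<comment> \<open>With \<open>k = 0\<close> the modular at scale \<open>c\<close> is at most 2cR +
    2c, which this choice makes 1.\<close>
  define c where "c = 1 / (2 * R + 2)"
  have "c > 0" "c \<le> 1" using R(1) by (auto simp: c_def)
  then have c: "c > 0" "c \<le> T 0" using T0 by auto
  have "orlicz_norm a b (step_N_function T) f \<le> 1 / c" if f: "f \<in> threshold_class a b T" for f
  proof (rule orlicz_norm_le[OF N_function_step_N_function])
    have eq: "step_N_function T (f t / (1 / c)) = step_N_function T (c * (indicator (space ?M) t * f t))"
      if "t \<in> space ?M" for t using that by (simp add: mult.commute)
    have I: "(LINT t|?M. indicator (space ?M) t * \<bar>f t\<bar>) = (LINT t|?M. \<bar>f t\<bar>)"
      by (rule Bochner_Integration.integral_cong) auto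
    note m = threshold_class_modular_le[OF f sets.top less_imp_le[OF c(1)] c(2)]
    show "integrable ?M (\<lambda>t. step_N_function T (f t / (1 / c)))"
      using m(1) by (subst Bochner_Integration.integrable_cong[OF refl eq])
    have "(LINT t|?M. step_N_function T (f t / (1 / c))) \<le> c * (real 0 + 2) * (LINT t|?M. \<bar>f t\<bar>) + 2 * c * (1/2) ^ 0"
      using m(2) unfolding I by (subst Bochner_Integration.integral_cong[OF refl eq])
    also have "\<dots> \<le> c * 2 * R + 2 * c" using R(2)[OF f] c by simp
    also have "\<dots> = c * (2 * R + 2)" by (simp add: algebra_simps)
    also have "\<dots> = 1" using R(1) by (simp add: c_def)
    finally show "(LINT t|?M. step_N_function T (f t / (1 / c))) \<le> 1" .
  qed (use c in simp)
  then show ?thesis using that by blast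
qed

text \<open>A norm at most \<open>e\<close> means a modular at most 1 at scale c = 1/e. The order of
  choice is \<open>c\<close>, then \<open>k\<close> with c \<le> T k and geometric part at most 1/2,
  then \<open>d\<close> so that the linear part is at most 1/2.\<close>

lemma threshold_class_equi_norm:
  assumes e: "e > 0"
  obtains d where "d > 0" "\<And>E f. E \<in> sets (lebesgue_on {a..b}) \<Longrightarrow> measure (lebesgue_on {a..b}) E < d \<Longrightarrow>
     f \<in> threshold_class a b T \<Longrightarrow> orlicz_norm a b (step_N_function T) (\<lambda>t. indicator E t * f t) \<le> e"
proof -
  let ?M = "lebesgue_on {a..b}"
  define c where "c = 1 / e"
  have c: "c > 0" using e by (simp add: c_def)
  obtain k1 where k1: "(1/2::real) ^ k1 < 1 / (4 * c)" using real_arch_pow_inv[of "1 / (4 * c)" "1/2"] c by auto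
  obtain k2 :: nat where k2: "c < real k2" using reals_Archimedean2 by blast
  define k where "k = max k1 k2"
  have ck: "c \<le> T k" using k2 T_gt_nat[of k2] T_mono[of k2 k] by (simp add: k_def)
  have "(1/2::real) ^ k \<le> (1/2) ^ k1" by (rule power_decreasing) (auto simp: k_def)
  with k1 have "(1/2) ^ k \<le> 1 / (4 * c)" by linarith
  then have "2 * c * (1/2) ^ k \<le> 2 * c * (1 / (4 * c))" using c by (intro mult_left_mono) auto
  then have pk: "2 * c * (1/2) ^ k \<le> 1 / 2" using c by simp
  define e' where "e' = 1 / (2 * c * (real k + 2))"
  have e': "e' > 0" using c by (simp add: e'_def)
  obtain d where d: "d > 0" "\<And>E f. E \<in> sets ?M \<Longrightarrow> measure ?M E < d \<Longrightarrow>
     f \<in> threshold_class a b T \<Longrightarrow> (LINT t|?M. indicator E t * \<bar>f t\<bar>) \<le> e'"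
    using threshold_class_equi_integrable[OF e', of a b] by metis
  have "orlicz_norm a b (step_N_function T) (\<lambda>t. indicator E t * f t) \<le> e"
    if E: "E \<in> sets ?M" "measure ?M E < d" and f: "f \<in> threshold_class a b T" for E f
  proof (rule orlicz_norm_le[OF N_function_step_N_function e])
    have eq: "indicator E t * f t / e = c * (indicator E t * f t)" for t by (simp add: c_def)
    note m = threshold_class_modular_le[OF f E(1) less_imp_le[OF c] ck]
    show "integrable ?M (\<lambda>t. step_N_function T (indicator E t * f t / e))" unfolding eq by (rule m(1))
    have "c * (real k + 2) * (LINT t|?M. indicator E t * \<bar>f t\<bar>) \<le> c * (real k + 2) * e'"
      using d(2)[OF E f] c by (intro mult_left_mono) auto
    also have "\<dots> = 1 / 2"
    proof -
      have "c * (real k + 2) \<noteq> 0" using c by (simp add: add_nonneg_eq_0_iff)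
      then show ?thesis by (simp add: e'_def field_simps)
    qed
    finally show "(LINT t|?M. step_N_function T (indicator E t * f t / e)) \<le> 1"
      unfolding eq using m(2) pk by linarith
  qed
  with d(1) show ?thesis using that by blast
qed

text \<open>The integral of (|f| - T n)^+ is the largest value, over disjoint \<open>P\<close> and
  \<open>Q\<close>, of the integral over \<open>P\<close> minus that over \<open>Q\<close> minus T n
  times the measure of their union; it is reached at the sets f > T n and f < - T n.\<close>

lemma threshold_class_iff_linear:
  assumes f: "integrable (lebesgue_on {a..b}) f"
  shows "f \<in> threshold_class a b T \<longleftrightarrow>
    (\<forall>n. \<forall>P\<in>sets (lebesgue_on {a..b}). \<forall>Q\<in>sets (lebesgue_on {a..b}). P \<inter> Q = {} \<longrightarrow>
       H_int_on a b P f - H_int_on a b Q f \<le> T n * measure (lebesgue_on {a..b}) (P \<union> Q) + (1/2) ^ n)"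
proof -
  let ?M = "lebesgue_on {a..b}"
  interpret finite_measure ?M by (rule finite_measure_lebesgue_on_ivl)
  have [measurable]: "f \<in> borel_measurable ?M" using f by auto
  have imax: "integrable ?M (\<lambda>t. max (\<bar>f t\<bar> - T n) 0)" for n using f by auto
  have lin: "integrable ?M (\<lambda>t. indicator P t * f t - indicator Q t * f t - T n * indicator (P \<union> Q) t)"
    "(LINT t|?M. indicator P t * f t - indicator Q t * f t - T n * indicator (P \<union> Q) t) =
      H_int_on a b P f - H_int_on a b Q f - T n * measure ?M (P \<union> Q)"
    if PQ: "P \<in> sets ?M" "Q \<in> sets ?M" for P Q n
  proof -
    have iP: "integrable ?M (\<lambda>t. indicator P t * f t)" "integrable ?M (\<lambda>t. indicator Q t * f t)"
      by (intro integrable_indicator_mult f PQ)+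
    have iU: "integrable ?M (\<lambda>t. T n * indicator (P \<union> Q) t)"
      using PQ by (intro integrable_mult_right integrable_real_indicator) (auto simp: less_top[symmetric])
    show "integrable ?M (\<lambda>t. indicator P t * f t - indicator Q t * f t - T n * indicator (P \<union> Q) t)"
      by (intro Bochner_Integration.integrable_diff iP iU)
    have "(P \<union> Q) \<inter> space ?M = P \<union> Q" using PQ by (intro sets.Int_space_eq2) auto
    then show "(LINT t|?M. indicator P t * f t - indicator Q t * f t - T n * indicator (P \<union> Q) t) =
      H_int_on a b P f - H_int_on a b Q f - T n * measure ?M (P \<union> Q)"
      unfolding H_int_on_eq_LINT[OF f PQ(1)] H_int_on_eq_LINT[OF f PQ(2)]
      by (subst Bochner_Integration.integral_diff[OF Bochner_Integration.integrable_diff[OF iP] iU],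
          subst Bochner_Integration.integral_diff[OF iP]) simp
  qed
  show ?thesis
  proof (intro iffI allI ballI impI)
    fix n P Q assume fC: "f \<in> threshold_class a b T" and PQ: "P \<in> sets ?M" "Q \<in> sets ?M" "P \<inter> Q = {}"
    have "(LINT t|?M. indicator P t * f t - indicator Q t * f t - T n * indicator (P \<union> Q) t) \<le> (LINT t|?M. max (\<bar>f t\<bar> - T n) 0)"
      by (rule integral_mono[OF lin(1)[OF PQ(1,2)] imax]) (use PQ(3) in \<open>auto simp: indicator_def\<close>)
    then show "H_int_on a b P f - H_int_on a b Q f \<le> T n * measure ?M (P \<union> Q) + (1/2) ^ n"
      using lin(2)[OF PQ(1,2), of n] threshold_classD(2)[OF fC, of n] by linarith
  next
    assume *: "\<forall>n. \<forall>P\<in>sets ?M. \<forall>Q\<in>sets ?M. P \<inter> Q = {} \<longrightarrow>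
       H_int_on a b P f - H_int_on a b Q f \<le> T n * measure ?M (P \<union> Q) + (1/2) ^ n"
    have "(LINT t|?M. max (\<bar>f t\<bar> - T n) 0) \<le> (1/2) ^ n" for n
    proof -
      define P where "P = {t \<in> space ?M. f t > T n}"
      define Q where "Q = {t \<in> space ?M. f t < - T n}"
      have PQ: "P \<in> sets ?M" "Q \<in> sets ?M" unfolding P_def Q_def by measurable
      have "P \<inter> Q = {}" using T_ge_2[of n] by (auto simp: P_def Q_def)
      with * PQ have le: "H_int_on a b P f - H_int_on a b Q f \<le> T n * measure ?M (P \<union> Q) + (1/2) ^ n" by blast
      have "(LINT t|?M. max (\<bar>f t\<bar> - T n) 0) = (LINT t|?M. indicator P t * f t - indicator Q t * f t - T n * indicator (P \<union> Q) t)"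
        by (rule Bochner_Integration.integral_cong) (use T_ge_2[of n] in \<open>auto simp: P_def Q_def indicator_def\<close>)
      then show ?thesis using le lin(2)[OF PQ, of n] by linarith
    qed
    then show "f \<in> threshold_class a b T" using f by (simp add: threshold_class_def)
  qed
qed

end

section \<open>Weak compactness of threshold classes\<close>

lemma (in finite_measure) measure_abs_gt_tendsto_0:
  fixes h :: "'a \<Rightarrow> real"
  assumes h: "integrable M h" and d: "d > 0"
  obtains K where "K > 0" "measure M {t \<in> space M. K < \<bar>h t\<bar>} < d"
proof -
  have [measurable]: "h \<in> borel_measurable M" using h by auto
  define I where "I = (LINT t|M. \<bar>h t\<bar>)"
  have I: "I \<ge> 0" unfolding I_def by simp
  define K where "K = (I + 1) / d"
  have K: "K > 0" using I d by (simp add: K_def)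
  have "measure M {t \<in> space M. K < \<bar>h t\<bar>} \<le> measure M {t \<in> space M. K \<le> \<bar>h t\<bar>}"
    by (rule finite_measure_mono) auto
  also have "\<dots> \<le> I / K"
    unfolding I_def by (rule integral_Markov_inequality_measure[of _ _ "{}"]) (use h K in auto)
  also have "\<dots> < d" using K d I by (simp add: K_def field_simps)
  finally show ?thesis using that K by blast
qed

context square_growth
begin

text \<open>The density \<open>h\<close> of the functional is only integrable. Cutting it off at height \<open>K\<close> is harmless
  because \<open>f\<close> restricted to the small set where \<open>\<bar>h\<bar> > K\<close> has small norm, uniformly in \<open>f\<close>.\<close>

lemma orlicz_dual_approx_on_threshold_class:
  assumes L: "L \<in> orlicz_dual a b (step_N_function T)" and e: "e > 0"
  obtains n :: nat and c E where "\<And>i. E i \<in> sets (lebesgue_on {a..b})"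
    "\<And>f. f \<in> threshold_class a b T \<Longrightarrow> \<bar>L f - (\<Sum>i<n. c i * H_int_on a b (E i) f)\<bar> \<le> e"
proof -
  let ?M = "lebesgue_on {a..b}" and ?\<phi> = "step_N_function T"
  interpret finite_measure ?M by (rule finite_measure_lebesgue_on_ivl)
  note N = N_function_step_N_function
  obtain C where C: "C > 0" "\<And>f r. f \<in> orlicz_space a b ?\<phi> \<Longrightarrow> orlicz_norm a b ?\<phi> f \<le> r \<Longrightarrow> \<bar>L f\<bar> \<le> C * r"
    using orlicz_dual_bound[OF N L] by metis
  obtain h where h: "integrable ?M h"
    "\<And>u B. u \<in> borel_measurable ?M \<Longrightarrow> \<forall>t\<in>{a..b}. \<bar>u t\<bar> \<le> B \<Longrightarrow> L u = (LINT t|?M. u t * h t)"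
    using orlicz_dual_density[OF N L] by blast
  have [measurable]: "h \<in> borel_measurable ?M" using h by auto
  have "e / (3 * C) > 0" using e C by simp
  then obtain d1 where d1: "d1 > 0" "\<And>E f. E \<in> sets ?M \<Longrightarrow> measure ?M E < d1 \<Longrightarrow>
     f \<in> threshold_class a b T \<Longrightarrow> orlicz_norm a b ?\<phi> (\<lambda>t. indicator E t * f t) \<le> e / (3 * C)"
    using threshold_class_equi_norm[of "e / (3 * C)" a b] by metis
  obtain K where K: "K > 0" "measure ?M {t \<in> space ?M. K < \<bar>h t\<bar>} < d1 / 2"
    using measure_abs_gt_tendsto_0[OF h(1), of "d1 / 2"] d1(1) by auto
  define H where "H = {t \<in> space ?M. K < \<bar>h t\<bar>}"
  have Hm[measurable]: "H \<in> sets ?M" unfolding H_def by measurable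
  define hK where "hK t = (if \<bar>h t\<bar> \<le> K then h t else 0)" for t
  have hKm[measurable]: "hK \<in> borel_measurable ?M" unfolding hK_def by measurable
  have hKb: "\<bar>hK t\<bar> \<le> K" for t using K by (simp add: hK_def)
  have "e / (3 * K) > 0" using e K by simp
  then obtain d2 where d2: "d2 > 0" "\<And>E f. E \<in> sets ?M \<Longrightarrow> measure ?M E < d2 \<Longrightarrow>
     f \<in> threshold_class a b T \<Longrightarrow> (LINT t|?M. indicator E t * \<bar>f t\<bar>) \<le> e / (3 * K)"
    using threshold_class_equi_integrable[of "e / (3 * K)" a b] by metis
  obtain R where R: "R > 0" "\<And>f. f \<in> threshold_class a b T \<Longrightarrow> (LINT t|?M. \<bar>f t\<bar>) \<le> R"
    using threshold_class_L1_bounded[of a b] by metis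
  \<comment> \<open>\<open>f\<close> must be cut as well, since the density represents
    \<open>L\<close> only on bounded functions. On the union of \<open>H\<close> and
    \<open>G\<close> the norm of \<open>f\<close> is small; off it \<open>f\<close> is bounded. The
    bound \<open>B\<close>, and so \<open>G\<close>, may depend on \<open>f\<close>, as only
    \<open>d1\<close> and \<open>d2\<close> need be uniform.\<close>
  have approx_hK: "\<bar>L f - (LINT t|?M. hK t * f t)\<bar> \<le> 2 * e / 3" if f: "f \<in> threshold_class a b T" for f
  proof -
    note fi = threshold_classD(1)[OF f]
    have [measurable]: "f \<in> borel_measurable ?M" using fi by auto
    have fO: "f \<in> orlicz_space a b ?\<phi>" using threshold_class_subset_orlicz_space f by blast
    obtain B where B: "B > 0" "measure ?M {t \<in> space ?M. B < \<bar>f t\<bar>} < min (d1 / 2) d2"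
      using measure_abs_gt_tendsto_0[OF fi, of "min (d1 / 2) d2"] d1(1) d2(1) by auto
    define G where "G = {t \<in> space ?M. B < \<bar>f t\<bar>}"
    have Gm[measurable]: "G \<in> sets ?M" unfolding G_def by measurable
    define E where "E = H \<union> G"
    have E: "E \<in> sets ?M" unfolding E_def by measurable
    have "measure ?M E \<le> measure ?M H + measure ?M G"
      unfolding E_def by (rule measure_Un_le[OF Hm Gm])
    also have "\<dots> < d1" using B(2) K(2) unfolding H_def[symmetric] G_def[symmetric] by simp
    finally have norm: "orlicz_norm a b ?\<phi> (\<lambda>t. indicator E t * f t) \<le> e / (3 * C)"
      by (rule d1(2)[OF E _ f])
    define u where "u t = indicator (space ?M - E) t * f t" for t
    have um: "u \<in> borel_measurable ?M" unfolding u_def using E by measurable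
    have ub: "\<bar>u t\<bar> \<le> B" if "t \<in> {a..b}" for t
      using B(1) that by (auto simp: u_def E_def G_def indicator_def)
    have EO: "(\<lambda>t. indicator E t * f t) \<in> orlicz_space a b ?\<phi>"
      by (rule orlicz_space_dominated[OF N fO]) (use E in \<open>auto simp: indicator_def\<close>)
    have uO: "u \<in> orlicz_space a b ?\<phi>" by (rule bounded_in_orlicz_space[OF N um ub])
    define v where "v t = (if t \<in> space ?M then 0 else f t)" for t
    have vm: "v \<in> borel_measurable ?M" unfolding v_def by measurable
    have vO: "v \<in> orlicz_space a b ?\<phi>"
      by (rule bounded_in_orlicz_space[OF N vm, of 0]) (simp add: v_def)
    \<comment> \<open>\<open>v\<close> carries the values outside \<open>[a,b]\<close>, which \<open>L\<close> does not see\<close>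
    have Lv: "L v = 0"
    proof -
      have "L v = (LINT t|?M. v t * h t)" by (rule h(2)[OF vm, of 0]) (simp add: v_def)
      also have "\<dots> = (LINT t|?M. 0)" by (rule Bochner_Integration.integral_cong) (auto simp: v_def)
      finally show ?thesis by simp
    qed
    have uvO: "(\<lambda>t. u t + v t) \<in> orlicz_space a b ?\<phi>"
    proof (rule bounded_in_orlicz_space[OF N, of _ _ _ B])
      show "(\<lambda>t. u t + v t) \<in> borel_measurable ?M" using um vm by measurable
    qed (use ub in \<open>auto simp: v_def\<close>)
    have "f = (\<lambda>t. indicator E t * f t + (u t + v t))"
      using sets.sets_into_space[OF E] by (auto simp: u_def v_def indicator_def fun_eq_iff)
    then have "L f = L (\<lambda>t. indicator E t * f t + (u t + v t))" by simp
    also have "\<dots> = L (\<lambda>t. indicator E t * f t) + (L u + L v)"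
      using orlicz_dual_add[OF L EO uvO] orlicz_dual_add[OF L uO vO] by simp
    finally have Lf: "L f = L (\<lambda>t. indicator E t * f t) + L u" using Lv by simp
    have 1: "\<bar>L (\<lambda>t. indicator E t * f t)\<bar> \<le> e / 3"
      using C(2)[OF EO norm] C(1) by simp
    have 2: "L u = (LINT t|?M. u t * h t)" by (rule h(2)[OF um]) (use ub in blast)
    have i1: "integrable ?M (\<lambda>t. hK t * f t)" by (rule abs_LINT_mult_le(1)[OF fi hKm hKb])
    have Gi: "integrable ?M (\<lambda>t. indicator G t * f t)" by (rule integrable_indicator_mult[OF fi Gm])
    have i2: "integrable ?M (\<lambda>t. hK t * (indicator G t * f t))" by (rule abs_LINT_mult_le(1)[OF Gi hKm hKb])
    \<comment> \<open>Pointwise: off \<open>E\<close> both sides are h f, on \<open>H\<close> the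
      cut-off \<open>hK\<close> vanishes, and on \<open>G\<close> the two terms on the right
      cancel.\<close>
    have "(LINT t|?M. u t * h t) = (LINT t|?M. hK t * f t - hK t * (indicator G t * f t))"
      by (rule Bochner_Integration.integral_cong)
         (auto simp: u_def hK_def E_def H_def G_def indicator_def)
    then have 3: "(LINT t|?M. u t * h t) = (LINT t|?M. hK t * f t) - (LINT t|?M. hK t * (indicator G t * f t))"
      using Bochner_Integration.integral_diff[OF i1 i2] by simp
    have "(LINT t|?M. \<bar>indicator G t * f t\<bar>) = (LINT t|?M. indicator G t * \<bar>f t\<bar>)"
      by (simp add: abs_mult)
    also have "\<dots> \<le> e / (3 * K)" by (rule d2(2)[OF Gm _ f]) (use B(2) in \<open>simp add: G_def\<close>)
    finally have "K * (LINT t|?M. \<bar>indicator G t * f t\<bar>) \<le> K * (e / (3 * K))"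
      using K(1) by (intro mult_left_mono) auto
    then have 4: "\<bar>LINT t|?M. hK t * (indicator G t * f t)\<bar> \<le> e / 3"
      using abs_LINT_mult_le(2)[OF Gi hKm hKb] K(1) by simp
    show ?thesis using Lf 1 2 3 4 by linarith
  qed
  have eR: "e / (3 * R) > 0" using e R by simp
  obtain n :: nat and c E where E: "\<And>i. E i \<in> sets ?M"
    and q: "\<And>t. t \<in> space ?M \<Longrightarrow> \<bar>hK t - (\<Sum>i<n. c i * indicator (E i) t)\<bar> \<le> e / (3 * R)"
    using bounded_measurable_quantize[OF hKm hKb eR] by blast
  have "\<bar>L f - (\<Sum>i<n. c i * H_int_on a b (E i) f)\<bar> \<le> e" if f: "f \<in> threshold_class a b T" for f
  proof -
    note fi = threshold_classD(1)[OF f]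
    define w where "w t = (\<Sum>i<n. c i * indicator (E i) t)" for t
    have wm: "w \<in> borel_measurable ?M" unfolding w_def using E by measurable
    have dm: "(\<lambda>t. hK t - w t) \<in> borel_measurable ?M" using wm by measurable
    have iw: "integrable ?M (\<lambda>t. w t * f t)" unfolding w_def by (rule LINT_simple_mult(1)[OF fi E])
    have ih: "integrable ?M (\<lambda>t. hK t * f t)" by (rule abs_LINT_mult_le(1)[OF fi hKm hKb])
    have w: "(LINT t|?M. w t * f t) = (\<Sum>i<n. c i * H_int_on a b (E i) f)"
      unfolding w_def LINT_simple_mult(2)[OF fi E] H_int_on_eq_LINT[OF fi E] ..
    have "\<bar>LINT t|?M. (hK t - w t) * f t\<bar> \<le> e / (3 * R) * (LINT t|?M. \<bar>f t\<bar>)"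
      by (rule abs_LINT_mult_le(2)[OF fi dm]) (use q in \<open>simp add: w_def\<close>)
    also have "\<dots> \<le> e / (3 * R) * R" using R(2)[OF f] e R(1) by (intro mult_left_mono) auto
    also have "\<dots> = e / 3" using R(1) by simp
    finally have "\<bar>(LINT t|?M. hK t * f t) - (LINT t|?M. w t * f t)\<bar> \<le> e / 3"
      using Bochner_Integration.integral_diff[OF ih iw] by (simp add: left_diff_distrib)
    then show ?thesis using approx_hK[OF f] unfolding w by linarith
  qed
  with E show ?thesis using that[of E c n] by blast
qed

text \<open>An intersection of closed half-spaces. This is shown apart from compactness because the
  topology lives on representatives, where functions equal almost everywhere are not separated and
  compact sets need not be closed.\<close>

lemma closedin_threshold_class:
  "closedin (orlicz_weak_topology a b (step_N_function T)) (threshold_class a b T)"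
proof -
  let ?M = "lebesgue_on {a..b}" and ?\<phi> = "step_N_function T"
  note N = N_function_step_N_function
  define S where "S = (\<lambda>(n, P, Q). {f \<in> orlicz_space a b ?\<phi>.
      H_int_on a b P f - H_int_on a b Q f \<le> T n * measure ?M (P \<union> Q) + (1/2) ^ n}) `
      (UNIV \<times> {(P, Q). P \<in> sets ?M \<and> Q \<in> sets ?M \<and> P \<inter> Q = {}})"
  have "closedin (orlicz_weak_topology a b ?\<phi>) (\<Inter>S)"
  proof (rule closedin_Inter)
    show "S \<noteq> {}" unfolding S_def by (auto intro!: exI[of _ "{}"])
    fix X assume "X \<in> S"
    then show "closedin (orlicz_weak_topology a b ?\<phi>) X"
      unfolding S_def
      by (auto intro!: closedin_orlicz_weak_topology_le H_int_on_diff_in_orlicz_dual[OF N])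
  qed
  also have "\<Inter>S = threshold_class a b T"
  proof (rule set_eqI)
    fix f
    have S_iff: "f \<in> \<Inter>S \<longleftrightarrow> f \<in> orlicz_space a b ?\<phi> \<and>
      (\<forall>n. \<forall>P\<in>sets ?M. \<forall>Q\<in>sets ?M. P \<inter> Q = {} \<longrightarrow>
       H_int_on a b P f - H_int_on a b Q f \<le> T n * measure ?M (P \<union> Q) + (1/2) ^ n)"
      unfolding S_def by (auto 0 3)
    show "f \<in> \<Inter>S \<longleftrightarrow> f \<in> threshold_class a b T"
    proof (cases "f \<in> orlicz_space a b ?\<phi>")
      case True
      then have "integrable ?M f" using orlicz_space_into_L1[OF N] by metis
      from threshold_class_iff_linear[OF this] True S_iff show ?thesis by blast
    next
      case False
      then show ?thesis using S_iff threshold_class_subset_orlicz_space by blast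
    qed
  qed
  finally show ?thesis .
qed

text \<open>Bounded norms put the image of \<open>C\<close> in a product of compact intervals, so
  only its closedness is at stake. A limit point \<open>x\<close> is merely a function on the dual;
  its values at the integrals over sets already determine the candidate \<open>h\<close>, and the
  uniform approximation forces all other values.\<close>

lemma compactin_threshold_class:
  "compactin (orlicz_weak_topology a b (step_N_function T)) (threshold_class a b T)"
proof -
  let ?M = "lebesgue_on {a..b}" and ?\<phi> = "step_N_function T"
  interpret finite_measure ?M by (rule finite_measure_lebesgue_on_ivl)
  note N = N_function_step_N_function
  define C where "C = threshold_class a b T"
  define D where "D = orlicz_dual a b ?\<phi>"
  define P where "P = product_topology (\<lambda>_::(real \<Rightarrow> real) \<Rightarrow> real. euclideanreal) D"
  define ev where "ev f = restrict (\<lambda>L. L f) D" for f :: "real \<Rightarrow> real"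
  have CO: "C \<subseteq> orlicz_space a b ?\<phi>" unfolding C_def by (rule threshold_class_subset_orlicz_space)
  have Ci: "integrable ?M f" if "f \<in> C" for f using that threshold_classD(1) unfolding C_def by blast
  have HD: "H_int_on a b E \<in> D" if "E \<in> sets ?M" for E
    unfolding D_def by (rule H_int_on_in_orlicz_dual[OF N that])
  obtain B where B: "\<And>f. f \<in> C \<Longrightarrow> orlicz_norm a b ?\<phi> f \<le> B"
    using threshold_class_norm_bounded[of a b] unfolding C_def by metis
  have "\<exists>\<beta>. \<forall>f\<in>C. \<bar>L f\<bar> \<le> \<beta>" if "L \<in> D" for L
    using orlicz_dual_bound[OF N that[unfolded D_def]] B CO by (metis subsetD)
  then obtain \<beta> where \<beta>: "\<And>L f. L \<in> D \<Longrightarrow> f \<in> C \<Longrightarrow> \<bar>L f\<bar> \<le> \<beta> L" by metis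
  \<comment> \<open>Every property of \<open>x\<close> below is obtained in this way: a bound on a
    continuous combination of finitely many coordinates that holds on the image of \<open>C\<close>
    persists on its closure.\<close>
  have limit: "F x \<le> k"
    if x: "x \<in> P closure_of (ev ` C)" and F: "continuous_map P euclideanreal F" and le: "\<And>f. f \<in> C \<Longrightarrow> F (ev f) \<le> k"
    for x F and k :: real
  proof -
    have "closedin P {x \<in> topspace P. F x \<in> {..k}}"
      by (rule closedin_continuous_map_preimage[OF F]) simp
    moreover have "ev ` C \<subseteq> {x \<in> topspace P. F x \<in> {..k}}"
      using le by (auto simp: P_def ev_def)
    ultimately have "P closure_of (ev ` C) \<subseteq> {x \<in> topspace P. F x \<in> {..k}}"
      by (rule closure_of_minimal[rotated])
    with x show ?thesis by blast
  qed
  have proj: "continuous_map P euclideanreal (\<lambda>x. x L)" if "L \<in> D" for L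
    unfolding P_def by (rule continuous_map_product_projection[OF that])
  have "P closure_of (ev ` C) \<subseteq> ev ` C"
  proof
    fix x assume x: "x \<in> P closure_of (ev ` C)"
    note lim = limit[OF x]
    have evH: "ev f (H_int_on a b E) = H_int_on a b E f" if "E \<in> sets ?M" for f E
      using HD[OF that] by (simp add: ev_def)
    have abs_lim: "\<bar>F x\<bar> \<le> k"
      if F: "continuous_map P euclideanreal F" and le: "\<And>f. f \<in> C \<Longrightarrow> \<bar>F (ev f)\<bar> \<le> k" for F k
      using lim[OF continuous_map_real_abs[OF F] le] by simp
    define \<nu> where "\<nu> E = x (H_int_on a b E)" for E
    obtain h where h: "integrable ?M h" "\<And>E. E \<in> sets ?M \<Longrightarrow> \<nu> E = (LINT t|?M. indicator E t * h t)"
    proof -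
      obtain R where R: "R > 0" "\<And>f. f \<in> C \<Longrightarrow> (LINT t|?M. \<bar>f t\<bar>) \<le> R"
        using threshold_class_L1_bounded[of a b] unfolding C_def by metis
      have "\<exists>h. integrable ?M h \<and> (\<forall>E\<in>sets ?M. \<nu> E = (LINT t|?M. indicator E t * h t))"
      proof (rule Radon_Nikodym_additive)
        fix E F assume E: "E \<in> sets ?M" "F \<in> sets ?M" "E \<inter> F = {}"
        have EF: "E \<union> F \<in> sets ?M" using E by auto
        have "\<bar>x (H_int_on a b (E \<union> F)) - (x (H_int_on a b E) + x (H_int_on a b F))\<bar> \<le> 0"
        proof (rule abs_lim)
          show "continuous_map P euclideanreal (\<lambda>x. x (H_int_on a b (E \<union> F)) - (x (H_int_on a b E) + x (H_int_on a b F)))"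
            by (intro continuous_map_diff continuous_map_add proj HD E EF)
          fix f assume "f \<in> C"
          note fi = Ci[OF this]
          have "H_int_on a b (E \<union> F) f = H_int_on a b E f + H_int_on a b F f"
            unfolding H_int_on_eq_LINT[OF fi E(1)] H_int_on_eq_LINT[OF fi E(2)] H_int_on_eq_LINT[OF fi EF]
              indicator_disj_union[OF E(3)] distrib_right
            by (intro Bochner_Integration.integral_add integrable_indicator_mult fi E)
          then show "\<bar>ev f (H_int_on a b (E \<union> F)) - (ev f (H_int_on a b E) + ev f (H_int_on a b F))\<bar> \<le> 0"
            using E EF by (simp add: evH)
        qed
        then show "\<nu> (E \<union> F) = \<nu> E + \<nu> F" by (simp add: \<nu>_def)
      next
        show "\<nu> E \<le> R" if E: "E \<in> sets ?M" for E
          unfolding \<nu>_def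
        proof (rule lim[OF proj[OF HD[OF E]]])
          fix f assume f: "f \<in> C"
          have "\<bar>LINT t|?M. indicator E t * f t\<bar> \<le> 1 * (LINT t|?M. \<bar>f t\<bar>)"
            by (rule abs_LINT_mult_le(2)[OF Ci[OF f]]) (use E in \<open>auto simp: indicator_def\<close>)
          then show "ev f (H_int_on a b E) \<le> R"
            using R(2)[OF f] by (simp add: evH[OF E] H_int_on_eq_LINT[OF Ci[OF f] E])
        qed
      next
        fix e :: real assume "e > 0"
        then obtain d where d: "d > 0" "\<And>E f. E \<in> sets ?M \<Longrightarrow> measure ?M E < d \<Longrightarrow>
           f \<in> C \<Longrightarrow> (LINT t|?M. indicator E t * \<bar>f t\<bar>) \<le> e"
          using threshold_class_equi_integrable[of e a b] unfolding C_def by metis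
        have "\<bar>\<nu> E\<bar> \<le> e" if E: "E \<in> sets ?M" "measure ?M E < d" for E
          unfolding \<nu>_def
        proof (rule abs_lim[OF proj[OF HD[OF E(1)]]])
          fix f assume f: "f \<in> C"
          have "\<bar>LINT t|?M. indicator E t * f t\<bar> \<le> (LINT t|?M. \<bar>indicator E t * f t\<bar>)"
            by (rule integral_abs_bound)
          also have "\<dots> \<le> e" using d(2)[OF E f] by (simp add: abs_mult)
          finally show "\<bar>ev f (H_int_on a b E)\<bar> \<le> e"
            by (simp add: evH[OF E(1)] H_int_on_eq_LINT[OF Ci[OF f] E(1)])
        qed
        then show "\<exists>d>0. \<forall>E\<in>sets ?M. measure ?M E < d \<longrightarrow> \<bar>\<nu> E\<bar> \<le> e" using d(1) by blast
      qed
      then show ?thesis using that by blast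
    qed
    have \<nu>h: "x (H_int_on a b E) = H_int_on a b E h" if "E \<in> sets ?M" for E
      using h(2)[OF that] H_int_on_eq_LINT[OF h(1) that] by (simp add: \<nu>_def)
    have "h \<in> C"
      unfolding C_def threshold_class_iff_linear[OF h(1)]
    proof (intro allI ballI impI)
      fix n Q Q' assume Q: "Q \<in> sets ?M" "Q' \<in> sets ?M" "Q \<inter> Q' = {}"
      have "x (H_int_on a b Q) - x (H_int_on a b Q') \<le> T n * measure ?M (Q \<union> Q') + (1/2) ^ n"
      proof (rule lim)
        show "continuous_map P euclideanreal (\<lambda>x. x (H_int_on a b Q) - x (H_int_on a b Q'))"
          by (intro continuous_map_diff proj HD Q)
        fix f assume f: "f \<in> C"
        then show "ev f (H_int_on a b Q) - ev f (H_int_on a b Q') \<le> T n * measure ?M (Q \<union> Q') + (1/2) ^ n"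
          using threshold_class_iff_linear[OF Ci[OF f]] Q unfolding C_def by (simp add: evH)
      qed
      then show "H_int_on a b Q h - H_int_on a b Q' h \<le> T n * measure ?M (Q \<union> Q') + (1/2) ^ n"
        using Q by (simp add: \<nu>h)
    qed
    have "x L = L h" if L: "L \<in> D" for L
    proof -
      \<comment> \<open>The approximation of \<open>L\<close> is valid at \<open>x\<close> by
        passage to the closure and at \<open>h\<close> because \<open>h\<close> lies in
        \<open>C\<close>; the approximating sums agree, so each side costs one
        \<open>e\<close>.\<close>
      have "\<bar>x L - L h\<bar> \<le> 2 * e" if e: "e > 0" for e
      proof -
        obtain n :: nat and c E where E: "\<And>i. E i \<in> sets ?M"
          and ap: "\<And>f. f \<in> C \<Longrightarrow> \<bar>L f - (\<Sum>i<n. c i * H_int_on a b (E i) f)\<bar> \<le> e"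
          using orlicz_dual_approx_on_threshold_class[OF L[unfolded D_def] e] unfolding C_def by metis
        have "\<bar>x L - (\<Sum>i<n. c i * x (H_int_on a b (E i)))\<bar> \<le> e"
        proof (rule abs_lim)
          show "continuous_map P euclideanreal (\<lambda>x. x L - (\<Sum>i<n. c i * x (H_int_on a b (E i))))"
            by (intro continuous_map_diff continuous_map_sum continuous_map_real_mult_left proj HD E L) simp
          fix f assume "f \<in> C"
          from ap[OF this] show "\<bar>ev f L - (\<Sum>i<n. c i * ev f (H_int_on a b (E i)))\<bar> \<le> e"
            using L by (simp add: evH[OF E]) (simp add: ev_def)
        qed
        then show ?thesis using ap[OF \<open>h \<in> C\<close>] by (simp add: \<nu>h[OF E])
      qed
      then have "\<bar>x L - L h\<bar> \<le> e" if "e > 0" for e using that[THEN half_gt_zero] by fastforce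
      then show ?thesis using field_le_epsilon[of "\<bar>x L - L h\<bar>" 0] by simp
    qed
    moreover have "x \<in> extensional D"
      using x closure_of_subset_topspace[of P] by (auto simp: P_def PiE_def)
    ultimately have "x = ev h" unfolding ev_def by (intro extensionalityI[of x D]) auto
    then show "x \<in> ev ` C" using \<open>h \<in> C\<close> by blast
  qed
  moreover have "ev ` C \<subseteq> topspace P" by (auto simp: P_def ev_def)
  ultimately have closed: "closedin P (ev ` C)"
    using closure_of_subset_eq by blast
  have "compactin P (PiE D (\<lambda>L. {- \<beta> L..\<beta> L}))"
    unfolding P_def compactin_PiE by auto
  moreover have "ev ` C \<subseteq> PiE D (\<lambda>L. {- \<beta> L..\<beta> L})"
    using \<beta> by (fastforce simp: ev_def abs_le_iff)
  ultimately have "compactin P (ev ` C)" using closed closed_compactin by blast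
  moreover have "D \<noteq> {}" using HD[of "{}"] by auto
  ultimately have "compactin (topology_generated_by {{f. L f \<in> U} | L U. L \<in> D \<and> open U}) C"
    using compactin_initial_topology[of D C] unfolding P_def ev_def by blast
  then show ?thesis
    unfolding orlicz_weak_topology_def compactin_subtopology using CO by (simp add: C_def D_def)
qed

text \<open>The class is closed, so it contains the closure of \<open>S\<close>, which is then a
  closed subset of a compact set.\<close>

lemma rel_weakly_compact_orlicz_subset_threshold_class:
  assumes "S \<subseteq> threshold_class a b T"
  shows "rel_weakly_compact_orlicz a b (step_N_function T) S"
  unfolding rel_weakly_compact_orlicz_def
proof
  show "S \<subseteq> orlicz_space a b (step_N_function T)"
    using assms threshold_class_subset_orlicz_space by blast
  show "compactin (orlicz_weak_topology a b (step_N_function T)) (orlicz_weak_topology a b (step_N_function T) closure_of S)"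
    by (rule closed_compactin[OF compactin_threshold_class closure_of_minimal[OF assms closedin_threshold_class] closedin_closure_of])
qed

end

theorem theorem3p1:
  fixes g :: "real \<Rightarrow> 'a::banach" and a b :: real
  assumes "HD_integrable a b g"
    and "\<forall>E\<in>leb_sets a b. HD_integrable a b (\<lambda>t. indicator E t *\<^sub>R g t)"
  shows "HD_countably_additive a b g \<longleftrightarrow>
    (\<exists>\<phi>. N_function \<phi> \<and> Delta'_cond \<phi> \<and>
       rel_weakly_compact_orlicz a b \<phi>
         {(\<lambda>t. blinfun_apply y (g t)) | y :: 'a \<Rightarrow>\<^sub>L real. norm y \<le> 1})"
proof
  assume "\<exists>\<phi>. N_function \<phi> \<and> Delta'_cond \<phi> \<and>
       rel_weakly_compact_orlicz a b \<phi>
         {(\<lambda>t. blinfun_apply y (g t)) | y :: 'a \<Rightarrow>\<^sub>L real. norm y \<le> 1}"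
  then show "HD_countably_additive a b g"
    using HD_countably_additive_if_rel_weakly_compact[OF assms] by blast
next
  let ?M = "lebesgue_on {a..b}"
  define K where "K = {(\<lambda>t. blinfun_apply y (g t)) | y :: 'a \<Rightarrow>\<^sub>L real. norm y \<le> 1}"
  assume ca: "HD_countably_additive a b g"
  have int: "integrable ?M f" if "f \<in> K" for f
    using that HD_integrable_imp_integrable[OF assms] by (auto simp: K_def)
  have equi: "\<exists>d>0. \<forall>E\<in>sets ?M. measure ?M E < d \<longrightarrow> (\<forall>f\<in>K. (LINT t|?M. indicator E t * \<bar>f t\<bar>) \<le> e)"
    if e: "e > 0" for e
  proof -
    obtain d where d: "d > 0" "\<forall>E\<in>sets ?M. measure ?M E < d \<longrightarrow>
        (\<forall>y :: 'a \<Rightarrow>\<^sub>L real. norm y \<le> 1 \<longrightarrow> \<bar>LINT t|?M. indicator E t * blinfun_apply y (g t)\<bar> \<le> e / 2)"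
      using HD_countably_additive_abs_continuous[OF assms ca half_gt_zero[OF e]] by blast
    have "\<forall>E\<in>sets ?M. measure ?M E < d \<longrightarrow> (\<forall>f\<in>K. \<bar>LINT t|?M. indicator E t * f t\<bar> \<le> e / 2)"
      using d(2) by (auto simp: K_def)
    from abs_continuous_imp_abs_integral_small[of K ?M "\<lambda>f. f", OF int finite_measure_lebesgue_on_ivl this]
    have "\<forall>E\<in>sets ?M. measure ?M E < d \<longrightarrow> (\<forall>f\<in>K. (LINT t|?M. indicator E t * \<bar>f t\<bar>) \<le> e)"
      by simp
    with d(1) show ?thesis by blast
  qed
  \<comment> \<open>The instance with bound 1 is enough to bound \<open>K\<close> in L1, and the
    choice of thresholds starts from that bound.\<close>
  obtain d where "d > 0" "\<And>E f. E \<in> sets ?M \<Longrightarrow> measure ?M E < d \<Longrightarrow> f \<in> K \<Longrightarrow> (LINT t|?M. indicator E t * \<bar>f t\<bar>) \<le> 1"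
    using equi[of 1] by auto
  then obtain R where R: "\<And>f. f \<in> K \<Longrightarrow> (LINT t|?M. \<bar>f t\<bar>) \<le> R"
    using equi_integrable_imp_L1_bounded[of K a b d, OF int] by blast
  obtain T :: "nat \<Rightarrow> real" where T: "2 \<le> T 0" "\<And>n. (T n)\<^sup>2 \<le> T (Suc n)"
    "\<And>n f. f \<in> K \<Longrightarrow> (LINT t|?M. max (\<bar>f t\<bar> - T n) 0) \<le> (1/2) ^ n"
    using equi_integrable_thresholds[OF finite_measure_lebesgue_on_ivl int R equi] by metis
  interpret square_growth T using T by unfold_locales auto
  have "K \<subseteq> threshold_class a b T" using int T(3) by (auto simp: threshold_class_def)
  then have "rel_weakly_compact_orlicz a b (step_N_function T) K"
    by (rule rel_weakly_compact_orlicz_subset_threshold_class)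
  then show "\<exists>\<phi>. N_function \<phi> \<and> Delta'_cond \<phi> \<and>
       rel_weakly_compact_orlicz a b \<phi>
         {(\<lambda>t. blinfun_apply y (g t)) | y :: 'a \<Rightarrow>\<^sub>L real. norm y \<le> 1}"
    using N_function_step_N_function Delta'_cond_step_N_function unfolding K_def by blast
qed

end
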